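(* Let $n\ge2$, $m\ge1$ be integers, $k=n-1$, and $\mu_{n,m}=\frac{n+m}{m(n+1)}$. Let $e_1=(1,0,\ldots,0)\in\mathbb C^k$ and set $p_s=(se_1,0)\in E_{n,m}$ for $0<s<1$. Then there is a constant $D_{n,m}>0$, independent of $s$, such that $$S_{n,m}(p_s,p_s)=D_{n,m}\,(1-s^2)^{-\gamma_{n,m}},\qquad \gamma_{n,m}=k+\mu_{n,m}=n-1+\frac{n+m}{m(n+1)}.$$ For fixed $n$, the map $m\mapsto\gamma_{n,m}$ (on positive integers) is strictly decreasing. Hence the weak-normal blow-up exponent $\gamma_{n,m}$ determines $m$ (for fixed $n$).
   Context: $E_{n,m}=\{(z,w)\in\mathbb C^{k}\times\mathbb C: |z|^2+|w|^{2m}<1\}$. The Fefferman--Szegő kernel $S_{n,m}$: with $\rho(z,w)=|z|^2+|w|^{2m}-1$, let $M(\rho)=-\det\begin{pmatrix}0&\rho_{\bar \ell}\\ \rho_j&\rho_{j\bar \ell}\end{pmatrix}_{1\le j,\ell\le n}$ be the $(n+1)\times(n+1)$ complex bordered Hessian determinant on $\partial E_{n,m}$, and $d\mu_F=M(\rho)^{1/(n+1)}\,d\sigma/|\nabla\rho|$ with $d\sigma$ Euclidean hypersurface measure and $|\nabla\rho|$ the Euclidean length of the real gradient. $H_F^2(E_{n,m})$ is the closure in $L^2(\partial E_{n,m},d\mu_F)$ of the holomorphic functions defined in a neighbourhood of $\overline{E_{n,m}}$; it is a reproducing-kernel Hilbert space of functions on $E_{n,m}$ and $S_{n,m}$ is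 its reproducing kernel: $f(q)=\langle f,S_{n,m}(\cdot,q)\rangle_{L^2(d\mu_F)}$. *)

theory Defs
  imports "HOL-Analysis.Analysis"
begin

section \<open>Hypersurface measure\<close>

text \<open>
  Euclidean hypersurface measure is the Hausdorff measure of codimension one.  The factor
  \<open>unit_ball_vol d / 2 ^ d\<close> is the standard normalization, for which the \<open>d\<close>-dimensional
  Hausdorff measure on \<open>d\<close>-dimensional Euclidean space is Lebesgue measure.  The covering sets
  are required to be bounded because \<^const>\<open>diameter\<close> is meaningless otherwise.  The
  definition is meant for \<open>d > 0\<close>, where empty covering sets contribute nothing.
\<close>

definition hausdorff_pre :: "nat \<Rightarrow> real \<Rightarrow> 'a::metric_space set \<Rightarrow> ennreal" where
  "hausdorff_pre d \<delta> A =
     (INF C \<in> {C :: nat \<Rightarrow> 'a set. A \<subseteq> (\<Union>i. C i) \<and> (\<forall>i. bounded (C i) \<and> diameter (C i) \<le> \<delta>)}.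
        (\<Sum>i. ennreal (unit_ball_vol (real d) * (diameter (C i) / 2) ^ d)))"

definition hausdorff_outer :: "nat \<Rightarrow> 'a::metric_space set \<Rightarrow> ennreal" where
  "hausdorff_outer d A = (SUP \<delta> \<in> {0<..}. hausdorff_pre d \<delta> A)"

definition hausdorff_measure :: "nat \<Rightarrow> 'a::metric_space measure" where
  "hausdorff_measure d = measure_of UNIV (sets borel) (hausdorff_outer d)"

definition hypersurface_measure :: "'a::euclidean_space set \<Rightarrow> 'a measure" where
  "hypersurface_measure M = restrict_space (hausdorff_measure (DIM('a) - 1)) M"

definition gradient :: "('a::real_inner \<Rightarrow> real) \<Rightarrow> 'a \<Rightarrow> 'a" where
  "gradient f p = (THE D. GDERIV f p :> D)"


section \<open>Complex calculus on \<open>\<complex>\<^sup>k \<times> \<complex>\<close>\<close>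

text \<open>
  The coordinates are indexed by \<open>'k option\<close>: \<open>Some j\<close> stands for \<open>z\<^sub>j\<close> and \<open>None\<close> for \<open>w\<close>,
  so that the complex dimension is \<open>n = CARD('k) + 1\<close>.  The product norm is the Euclidean one.
\<close>

type_synonym 'k cspace = "(complex ^ 'k) \<times> complex"

definition cscale :: "complex \<Rightarrow> 'k::finite cspace \<Rightarrow> 'k cspace" where
  "cscale c v = (c *s fst v, c * snd v)"

definition cbasis :: "'k::finite option \<Rightarrow> 'k cspace" where
  "cbasis a = (case a of Some j \<Rightarrow> (axis j 1, 0) | None \<Rightarrow> (0, 1))"

definition holo_on :: "('k::finite cspace \<Rightarrow> complex) \<Rightarrow> 'k cspace set \<Rightarrow> bool" where
  "holo_on f U \<longleftrightarrow>
     (\<forall>p\<in>U. \<exists>D. (f has_derivative D) (at p) \<and> (\<forall>c v. D (cscale c v) = c * D v))"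

text \<open>The Wirtinger derivatives \<open>\<partial>/\<partial>\<zeta>\<^sub>a = (\<partial>/\<partial>x\<^sub>a - \<i> \<partial>/\<partial>y\<^sub>a)/2\<close> and
  \<open>\<partial>/\<partial>\<zeta>\<^sub>a-bar = (\<partial>/\<partial>x\<^sub>a + \<i> \<partial>/\<partial>y\<^sub>a)/2\<close>.\<close>

definition wirt :: "'k::finite option \<Rightarrow> ('k cspace \<Rightarrow> complex) \<Rightarrow> 'k cspace \<Rightarrow> complex" where
  "wirt a f p = (frechet_derivative f (at p) (cbasis a)
                 - \<i> * frechet_derivative f (at p) (cscale \<i> (cbasis a))) / 2"

definition wirt_bar :: "'k::finite option \<Rightarrow> ('k cspace \<Rightarrow> complex) \<Rightarrow> 'k cspace \<Rightarrow> complex" where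
  "wirt_bar a f p = (frechet_derivative f (at p) (cbasis a)
                     + \<i> * frechet_derivative f (at p) (cscale \<i> (cbasis a))) / 2"

text \<open>The bordering row and column carry the extra index \<open>None\<close>.\<close>

definition bordered_hessian ::
    "('k::finite cspace \<Rightarrow> real) \<Rightarrow> 'k cspace \<Rightarrow> complex ^ 'k option option ^ 'k option option" where
  "bordered_hessian \<rho> p = (\<chi> a b.
     case (a, b) of
       (None, None) \<Rightarrow> 0
     | (None, Some l) \<Rightarrow> wirt_bar l (\<lambda>x. of_real (\<rho> x)) p
     | (Some j, None) \<Rightarrow> wirt j (\<lambda>x. of_real (\<rho> x)) p
     | (Some j, Some l) \<Rightarrow> wirt j (wirt_bar l (\<lambda>x. of_real (\<rho> x))) p)"

text \<open>The determinant is real, being that of a matrix which is Hermitian for \<open>\<rho>\<close> of class \<open>C\<^sup>2\<close>.\<close>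

definition fefferman_M :: "('k::finite cspace \<Rightarrow> real) \<Rightarrow> 'k cspace \<Rightarrow> real" where
  "fefferman_M \<rho> p = Re (- det (bordered_hessian \<rho> p))"

text \<open>The exponent is \<open>1 / (n + 1)\<close> with \<open>n = CARD('k) + 1\<close>.\<close>

definition fefferman_measure ::
    "('k::finite cspace \<Rightarrow> real) \<Rightarrow> 'k cspace set \<Rightarrow> 'k cspace measure" where
  "fefferman_measure \<rho> \<Omega> =
     density (hypersurface_measure (frontier \<Omega>))
       (\<lambda>p. ennreal (fefferman_M \<rho> p powr (1 / (real CARD('k) + 2)) / norm (gradient \<rho> p)))"


section \<open>Hardy space and its reproducing kernel\<close>

definition holo_closure :: "'k::finite cspace set \<Rightarrow> ('k cspace \<Rightarrow> complex) set" where
  "holo_closure \<Omega> = {g. \<exists>U. open U \<and> closure \<Omega> \<subseteq> U \<and> holo_on g U}"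

definition L2_dist_sq :: "'a measure \<Rightarrow> ('a \<Rightarrow> complex) \<Rightarrow> ('a \<Rightarrow> complex) \<Rightarrow> ennreal" where
  "L2_dist_sq \<mu> f g = (\<integral>\<^sup>+ x. ennreal ((cmod (f x - g x))\<^sup>2) \<partial>\<mu>)"

definition L2_inner :: "'a measure \<Rightarrow> ('a \<Rightarrow> complex) \<Rightarrow> ('a \<Rightarrow> complex) \<Rightarrow> complex" where
  "L2_inner \<mu> f g = (\<integral>x. f x * cnj (g x) \<partial>\<mu>)"

text \<open>Elements of the Hardy space are represented by functions rather than by classes of functions
  modulo equality almost everywhere; only their values on \<open>frontier \<Omega>\<close> matter.\<close>

definition hardy ::
    "'k::finite cspace set \<Rightarrow> 'k cspace measure \<Rightarrow> ('k cspace \<Rightarrow> complex) set" where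
  "hardy \<Omega> \<mu> = {f \<in> borel_measurable \<mu>. (\<integral>\<^sup>+ x. ennreal ((cmod (f x))\<^sup>2) \<partial>\<mu>) < \<infinity> \<and>
                   (\<forall>\<epsilon>>0. \<exists>g\<in>holo_closure \<Omega>. L2_dist_sq \<mu> f g < ennreal \<epsilon>)}"

text \<open>A Hardy space element, given by its boundary values \<open>f\<close>, is a function on \<open>\<Omega>\<close>: its value
  at \<open>q \<in> \<Omega>\<close> is the limit of \<open>g\<^sub>i(q)\<close> for any \<open>g\<^sub>i\<close> holomorphic near the closure
  of \<open>\<Omega>\<close> and tending to \<open>f\<close> in \<open>L\<^sup>2\<close>.\<close>

definition hardy_eval ::
    "'k::finite cspace set \<Rightarrow> 'k cspace measure \<Rightarrow> ('k cspace \<Rightarrow> complex) \<Rightarrow> 'k cspace \<Rightarrow> complex" where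
  "hardy_eval \<Omega> \<mu> f q =
     (THE v. \<forall>g. (\<forall>i::nat. g i \<in> holo_closure \<Omega>) \<and> (\<lambda>i. L2_dist_sq \<mu> f (g i)) \<longlonglongrightarrow> 0
               \<longrightarrow> (\<lambda>i. g i q) \<longlonglongrightarrow> v)"

text \<open>The boundary function \<open>S(\<cdot>, q)\<close>, unique up to null sets.\<close>

definition kernel_section ::
    "'k::finite cspace set \<Rightarrow> 'k cspace measure \<Rightarrow> 'k cspace \<Rightarrow> 'k cspace \<Rightarrow> complex" where
  "kernel_section \<Omega> \<mu> q =
     (SOME K. K \<in> hardy \<Omega> \<mu> \<and> (\<forall>f\<in>hardy \<Omega> \<mu>. hardy_eval \<Omega> \<mu> f q = L2_inner \<mu> f K))"

definition reproducing_kernel ::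
    "'k::finite cspace set \<Rightarrow> 'k cspace measure \<Rightarrow> 'k cspace \<Rightarrow> 'k cspace \<Rightarrow> complex" where
  "reproducing_kernel \<Omega> \<mu> p q = hardy_eval \<Omega> \<mu> (kernel_section \<Omega> \<mu> q) p"


section \<open>The domains \<open>E\<^sub>n\<^sub>,\<^sub>m\<close>\<close>

definition egg_rho :: "nat \<Rightarrow> 'k::finite cspace \<Rightarrow> real" where
  "egg_rho m = (\<lambda>(z, w). (norm z)\<^sup>2 + norm w ^ (2 * m) - 1)"

definition egg :: "nat \<Rightarrow> 'k::finite cspace set" where
  "egg m = {(z, w). (norm z)\<^sup>2 + norm w ^ (2 * m) < 1}"

definition fefferman_szego :: "nat \<Rightarrow> 'k::finite cspace \<Rightarrow> 'k cspace \<Rightarrow> complex" where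
  "fefferman_szego m = reproducing_kernel (egg m) (fefferman_measure (egg_rho m) (egg m))"

definition mu_exp :: "nat \<Rightarrow> nat \<Rightarrow> real" where
  "mu_exp n m = (real n + real m) / (real m * (real n + 1))"

definition gamma_exp :: "nat \<Rightarrow> nat \<Rightarrow> real" where
  "gamma_exp n m = real n - 1 + mu_exp n m"

end

theory Submission
  imports Defs "HOL-Complex_Analysis.Complex_Analysis"
begin

text \<open>
  For \<open>q = (s e\<^sub>i, 0)\<close> the section \<open>S(\<cdot>, q)\<close> of the kernel is \<open>K(z, w) = D (1 - s z\<^sub>i) powr (- \<gamma>)\<close>.
  The Fefferman measure is invariant under \<open>(z', w) \<mapsto> e\<^sup>i\<^sup>\<theta> (z', w)\<close>, where \<open>z'\<close> are the coordinates
  other than \<open>z\<^sub>i\<close>, and under \<open>z\<^sub>i \<mapsto> e\<^sup>i\<^sup>\<theta> z\<^sub>i\<close>.  By the mean value property the inner product of a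
  holomorphic \<open>g\<close> with \<open>z\<^sub>i ^ j\<close> is therefore the \<open>j\<close>-th Taylor coefficient of \<open>g\<close> along the
  \<open>z\<^sub>i\<close>-axis times the moment \<open>\<integral> \<bar>z\<^sub>i\<bar>^(2 j)\<close>.  These moments are multiples of
  \<open>j! / Gamma (\<gamma> + j)\<close>, the inverses of the binomial coefficients of \<open>K\<close>, so that \<open>K\<close> reproduces
  \<open>g(q)\<close>, and \<open>S(q, q) = K(q)\<close>.

  To compute the moments, the hypersurface measure is written in coordinates by the area formula for
  \<open>C\<^sup>1\<close> graphs; this turns them into moments of the weight \<open>(1 - \<bar>z\<bar>\<^sup>2) powr (mu - 1)\<close> on the unit ball
  of \<open>\<complex>\<^sup>k\<close>.  The constant relating Hausdorff and Lebesgue measure only enters \<open>D\<close>, so the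
  isodiametric inequality is not needed.
\<close>

section \<open>Hausdorff measure as a metric outer measure\<close>

text \<open>The exponent comes out of a cancellation. With n the complex dimension, M = m^2
  |w|^(2(m-1)) on the boundary, while the Jacobian of the graph Im w over (z, Re w) is |grad rho| /
  (2 m |w|^(2(m-1)) |Im w|). The gradient drops out, |w|^2 = (1 - |z|^2)^(1/m) remains, and the
  weight has the exponent \<alpha> = (m-1)/m (1/(n+1) - 1). Hence \<alpha> + 1 = mu and \<gamma> = k
  + \<alpha> + 1. Integration over Re w gives pi for every z.

  Evaluation on the Hardy space is defined by \<open>THE\<close> and the kernel by
  \<open>SOME\<close>, so existence and uniqueness have to be proved. Since s < 1, \<open>K\<close>
  is holomorphic past the closure and bounded on the boundary. Pairing with \<open>K\<close> is
  therefore continuous in L2, and the identity g(q) = <g, K> for holomorphic g itself shows that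
  evaluation at q extends to the Hardy space.\<close>

lemma hausdorff_pre_empty:
  assumes "d > 0" "\<delta> \<ge> 0"
  shows "hausdorff_pre d \<delta> {} = 0"
proof -
  have "hausdorff_pre d \<delta> {} \<le> (\<Sum>i::nat. ennreal (unit_ball_vol (real d) * (diameter ({}::'a set) / 2) ^ d))"
    unfolding hausdorff_pre_def by (rule INF_lower2[of "\<lambda>_. {}"]) (use assms in auto)
  also have "\<dots> = 0"
    using assms by (simp add: zero_power)
  finally show ?thesis by simp
qed

lemma hausdorff_pre_mono: "A \<subseteq> B \<Longrightarrow> hausdorff_pre d \<delta> A \<le> hausdorff_pre d \<delta> B"
  unfolding hausdorff_pre_def by (rule INF_superset_mono) auto

lemma hausdorff_pre_antimono: "\<delta> \<le> \<epsilon> \<Longrightarrow> hausdorff_pre d \<epsilon> A \<le> hausdorff_pre d \<delta> A"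
  unfolding hausdorff_pre_def by (rule INF_superset_mono) (auto intro: order_trans)

text \<open>Near-optimal covers of the sets \<open>A n\<close>, with excess
  \<open>e * (1/2)^Suc n\<close>, are merged into one sequence by the pairing function; the excesses
  add up to \<open>e\<close>.\<close>

lemma hausdorff_pre_UN:
  fixes A :: "nat \<Rightarrow> 'a::metric_space set"
  shows "hausdorff_pre d \<delta> (\<Union>n. A n) \<le> (\<Sum>n. hausdorff_pre d \<delta> (A n))"
proof (rule ennreal_le_epsilon)
  fix e :: real assume e: "0 < e" and fin: "(\<Sum>n. hausdorff_pre d \<delta> (A n)) < top"
  let ?v = "\<lambda>C::'a set. ennreal (unit_ball_vol (real d) * (diameter C / 2) ^ d)"
  have *: "hausdorff_pre d \<delta> (A n) < hausdorff_pre d \<delta> (A n) + e * (1/2)^Suc n" for n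
    using fin e by (auto simp add: less_top dest!: ennreal_suminf_lessD)
  have "\<exists>C::nat \<Rightarrow> 'a set. A n \<subseteq> (\<Union>i. C i) \<and> (\<forall>i. bounded (C i) \<and> diameter (C i) \<le> \<delta>) \<and>
      (\<Sum>i. ?v (C i)) < hausdorff_pre d \<delta> (A n) + e * (1/2)^Suc n" for n
    using *[of n] unfolding hausdorff_pre_def[of d \<delta> "A n"] INF_less_iff by auto
  then obtain C :: "nat \<Rightarrow> nat \<Rightarrow> 'a set" where C: "\<And>n. A n \<subseteq> (\<Union>i. C n i)"
      "\<And>n i. bounded (C n i)" "\<And>n i. diameter (C n i) \<le> \<delta>"
      "\<And>n. (\<Sum>i. ?v (C n i)) < hausdorff_pre d \<delta> (A n) + e * (1/2)^Suc n"
    by metis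
  have cov: "(\<Union>n. A n) \<subseteq> (\<Union>j. case_prod C (prod_decode j))"
  proof
    fix x assume "x \<in> (\<Union>n. A n)"
    then obtain n i where "x \<in> C n i" using C(1) by blast
    then have "x \<in> case_prod C (prod_decode (prod_encode (n, i)))" by simp
    then show "x \<in> (\<Union>j. case_prod C (prod_decode j))" by (rule UN_I[OF UNIV_I])
  qed
  have "hausdorff_pre d \<delta> (\<Union>n. A n) \<le> (\<Sum>j. ?v (case_prod C (prod_decode j)))"
    unfolding hausdorff_pre_def by (rule INF_lower) (use cov C(2,3) in \<open>auto split: prod.split\<close>)
  also have "\<dots> = (\<Sum>n. \<Sum>i. ?v (C n i))"
    by (rule suminf_ennreal_2dimen[where f = "\<lambda>p. ?v (case_prod C p)"]) simp
  also have "\<dots> \<le> (\<Sum>n. hausdorff_pre d \<delta> (A n) + ennreal (e * (1/2)^Suc n))"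
    using C(4) by (intro suminf_le) (auto intro: less_imp_le)
  also have "\<dots> = (\<Sum>n. hausdorff_pre d \<delta> (A n)) + (\<Sum>n. ennreal (e * (1/2)^Suc n))"
    by (rule suminf_add[symmetric]) auto
  also have "(\<Sum>n. ennreal (e * (1/2)^Suc n)) = ennreal e"
    using sums_mult[OF power_half_series, of e] e
    by (intro suminf_ennreal_eq) auto
  finally show "hausdorff_pre d \<delta> (\<Union>n. A n) \<le> (\<Sum>n. hausdorff_pre d \<delta> (A n)) + ennreal e" .
qed

lemma hausdorff_outer_empty: "d > 0 \<Longrightarrow> hausdorff_outer d {} = 0"
  by (auto simp: hausdorff_outer_def hausdorff_pre_empty bot_ennreal)

lemma hausdorff_outer_mono: "A \<subseteq> B \<Longrightarrow> hausdorff_outer d A \<le> hausdorff_outer d B"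
  unfolding hausdorff_outer_def by (intro SUP_mono) (auto intro: hausdorff_pre_mono)

lemma hausdorff_outer_UN:
  fixes A :: "nat \<Rightarrow> 'a::metric_space set"
  shows "hausdorff_outer d (\<Union>n. A n) \<le> (\<Sum>n. hausdorff_outer d (A n))"
proof -
  have "hausdorff_pre d \<delta> (\<Union>n. A n) \<le> (\<Sum>n. hausdorff_outer d (A n))" if "\<delta> > 0" for \<delta>
  proof -
    have "hausdorff_pre d \<delta> (\<Union>n. A n) \<le> (\<Sum>n. hausdorff_pre d \<delta> (A n))"
      by (rule hausdorff_pre_UN)
    also have "\<dots> \<le> (\<Sum>n. hausdorff_outer d (A n))"
      using that by (intro suminf_le) (auto simp: hausdorff_outer_def intro: SUP_upper)
    finally show ?thesis .
  qed
  then show ?thesis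
    by (subst hausdorff_outer_def) (auto intro: SUP_least)
qed

lemma hausdorff_outer_Un:
  assumes "d > 0"
  shows "hausdorff_outer d (A \<union> B) \<le> hausdorff_outer d A + hausdorff_outer d B"
proof -
  let ?S = "\<lambda>i::nat. if i = 0 then A else if i = 1 then B else {}"
  have "A \<subseteq> ?S 0" "B \<subseteq> ?S 1" "\<And>i. ?S i \<subseteq> A \<union> B" by auto
  then have "A \<union> B = (\<Union>i. ?S i)" by blast
  then have "hausdorff_outer d (A \<union> B) \<le> (\<Sum>i. hausdorff_outer d (?S i))"
    using hausdorff_outer_UN[of d ?S] by simp
  also have "\<dots> = (\<Sum>i\<in>{0,1}. hausdorff_outer d (?S i))"
    by (rule suminf_finite) (auto simp: hausdorff_outer_empty assms)
  finally show ?thesis by simp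
qed

text \<open>A covering set of diameter below \<open>e\<close> meets at most one of the two sets, so
  intersecting a cover with \<open>A\<close> and with \<open>B\<close> splits its cost. The empty
  intersections are free because \<open>d > 0\<close>.\<close>

lemma hausdorff_pre_separated:
  fixes A B :: "'a::metric_space set"
  assumes "d > 0" "0 < \<delta>" "\<delta> < e" and sep: "\<And>x y. x \<in> A \<Longrightarrow> y \<in> B \<Longrightarrow> e \<le> dist x y"
  shows "hausdorff_pre d \<delta> A + hausdorff_pre d \<delta> B \<le> hausdorff_pre d \<delta> (A \<union> B)"
proof -
  let ?v = "\<lambda>C::'a set. ennreal (unit_ball_vol (real d) * (diameter C / 2) ^ d)"
  have "hausdorff_pre d \<delta> A + hausdorff_pre d \<delta> B \<le> (\<Sum>i. ?v (C i))"
    if C: "A \<union> B \<subseteq> (\<Union>i. C i)" "\<And>i. bounded (C i)" "\<And>i. diameter (C i) \<le> \<delta>" for C :: "nat \<Rightarrow> 'a set"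
  proof -
    have b: "bounded (C i \<inter> X)" for i X using C(2) by (auto intro: bounded_subset)
    have le: "diameter (C i \<inter> X) \<le> diameter (C i)" for i X
      using C(2) by (intro diameter_subset) auto
    have "hausdorff_pre d \<delta> A + hausdorff_pre d \<delta> B \<le> (\<Sum>i. ?v (C i \<inter> A)) + (\<Sum>i. ?v (C i \<inter> B))"
      unfolding hausdorff_pre_def
      by (intro add_mono INF_lower) (use C(1) b order_trans[OF le C(3)] in auto)
    also have "\<dots> = (\<Sum>i. ?v (C i \<inter> A) + ?v (C i \<inter> B))"
      by (rule suminf_add) auto
    also have "\<dots> \<le> (\<Sum>i. ?v (C i))"
    proof (intro suminf_le)
      fix i
      have "C i \<inter> A = {} \<or> C i \<inter> B = {}"
      proof (rule ccontr)
        assume "\<not> ?thesis"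
        then obtain x y where "x \<in> C i" "x \<in> A" "y \<in> C i" "y \<in> B" by blast
        then show False
          using sep[of x y] diameter_bounded_bound[OF C(2)[of i], of x y] C(3)[of i] \<open>\<delta> < e\<close> by linarith
      qed
      moreover have "?v (C i \<inter> X) \<le> ?v (C i)" for X
        using le by (intro ennreal_leI mult_left_mono power_mono)
          (auto intro!: divide_right_mono diameter_ge_0 b)
      ultimately show "?v (C i \<inter> A) + ?v (C i \<inter> B) \<le> ?v (C i)"
        using \<open>d > 0\<close> by (auto simp: zero_power)
    qed auto
    finally show ?thesis .
  qed
  then show ?thesis
    by (subst (3) hausdorff_pre_def) (auto intro!: INF_greatest)
qed

text \<open>\<open>hausdorff_pre\<close> grows as the mesh shrinks, so the two suprema are directed
  and their sum is the supremum of the sums. The mesh can be cut down below the separation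
  \<open>e\<close>.\<close>

lemma hausdorff_outer_separated:
  fixes A B :: "'a::metric_space set"
  assumes "d > 0" "0 < e" and sep: "\<And>x y. x \<in> A \<Longrightarrow> y \<in> B \<Longrightarrow> e \<le> dist x y"
  shows "hausdorff_outer d A + hausdorff_outer d B \<le> hausdorff_outer d (A \<union> B)"
proof -
  have "hausdorff_outer d A + hausdorff_outer d B =
      (SUP \<delta>\<in>{0<..}. hausdorff_pre d \<delta> A + hausdorff_pre d \<delta> B)"
    unfolding hausdorff_outer_def
  proof (rule SUP_add_directed_ennreal[symmetric])
    fix i j :: real assume "i \<in> {0<..}" "j \<in> {0<..}"
    then show "\<exists>k\<in>{0<..}. hausdorff_pre d i A + hausdorff_pre d j B \<le> hausdorff_pre d k A + hausdorff_pre d k B"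
      by (intro bexI[of _ "min i j"] add_mono hausdorff_pre_antimono) auto
  qed
  also have "\<dots> \<le> hausdorff_outer d (A \<union> B)"
  proof (rule SUP_least)
    fix \<delta> :: real assume "\<delta> \<in> {0<..}"
    then have "hausdorff_pre d \<delta> A + hausdorff_pre d \<delta> B
        \<le> hausdorff_pre d (min \<delta> (e/2)) A + hausdorff_pre d (min \<delta> (e/2)) B"
      by (intro add_mono hausdorff_pre_antimono) auto
    also have "\<dots> \<le> hausdorff_pre d (min \<delta> (e/2)) (A \<union> B)"
      by (rule hausdorff_pre_separated[where e = e]) (use assms \<open>\<delta> \<in> _\<close> in auto)
    also have "\<dots> \<le> hausdorff_outer d (A \<union> B)"
      unfolding hausdorff_outer_def by (rule SUP_upper) (use \<open>\<delta> \<in> _\<close> \<open>0 < e\<close> in auto)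
    finally show "hausdorff_pre d \<delta> A + hausdorff_pre d \<delta> B \<le> hausdorff_outer d (A \<union> B)" .
  qed
  finally show ?thesis .
qed

text \<open>The part of \<open>A\<close> off \<open>F\<close> is exhausted by the sets \<open>B n\<close> at distance at least
  \<open>1 / (n + 1)\<close> from \<open>F\<close>; every second one of the shells \<open>B (n + 1) - B n\<close> forms a
  separated family, so the measures of the shells have a finite sum.\<close>

lemma hausdorff_outer_closed_split:
  fixes A F :: "'a::metric_space set"
  assumes d: "d > 0" and F: "closed F"
  shows "hausdorff_outer d (A \<inter> F) + hausdorff_outer d (A - F) = hausdorff_outer d A"
proof (rule antisym)
  let ?H = "hausdorff_outer d :: 'a set \<Rightarrow> ennreal"
  show "?H A \<le> ?H (A \<inter> F) + ?H (A - F)"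
    using hausdorff_outer_Un[OF d, of "A \<inter> F" "A - F"] by (simp add: Int_Diff_Un)
  show "?H (A \<inter> F) + ?H (A - F) \<le> ?H A"
  \<comment> \<open>\<open>infdist x {}\<close> is 0 by convention, so an empty \<open>F\<close>
    would leave every \<open>B n\<close> empty. Infinite \<open>?H A\<close> is split off because
    the argument ends by cancelling a finite sum.\<close>
  proof (cases "F = {} \<or> ?H A = top")
    case True
    then show ?thesis by (auto simp: hausdorff_outer_empty d)
  next
    case False
    define B where "B n = {x \<in> A. 1 / real (Suc n) \<le> infdist x F}" for n
    define D where "D n = B (Suc n) - B n" for n
    have BA: "B n \<subseteq> A" and DB: "D n \<subseteq> B (Suc n)" for n by (auto simp: B_def D_def)
    have Bmono: "B m \<subseteq> B n" if "m \<le> n" for m n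
    proof
      fix x assume "x \<in> B m"
      moreover have "1 / real (Suc n) \<le> 1 / real (Suc m)" using that by (simp add: frac_le)
      ultimately show "x \<in> B n" by (auto simp: B_def)
    qed
    have BF: "?H (A \<inter> F) + ?H (B n) \<le> ?H A" for n
    proof -
      have "?H (A \<inter> F) + ?H (B n) \<le> ?H (A \<inter> F \<union> B n)"
      proof (rule hausdorff_outer_separated[OF d])
        show "0 < 1 / real (Suc n)" by simp
        fix x y assume "x \<in> A \<inter> F" "y \<in> B n"
        then show "1 / real (Suc n) \<le> dist x y"
          using infdist_le[of x F y] by (auto simp: B_def dist_commute)
      qed
      also have "\<dots> \<le> ?H A" by (rule hausdorff_outer_mono) (use BA in auto)
      finally show ?thesis .
    qed
    \<comment> \<open>\<open>infdist\<close> is 1-Lipschitz, at least 1/(n+1) on \<open>B n\<close>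
      and below 1/(n+2) on \<open>D (Suc n)\<close>. The shell \<open>D n\<close> between them is
      skipped, which leaves a gap.\<close>
    have step: "?H C + ?H (D (Suc n)) \<le> ?H (C \<union> D (Suc n))" if "C \<subseteq> B n" for C n
    proof (rule hausdorff_outer_separated[OF d])
      show "0 < 1 / real (Suc n) - 1 / real (Suc (Suc n))" by (simp add: divide_strict_left_mono)
      fix x y assume "x \<in> C" "y \<in> D (Suc n)"
      then have "1 / real (Suc n) \<le> infdist x F" "infdist y F < 1 / real (Suc (Suc n))"
        using that by (auto simp: B_def D_def)
      then show "1 / real (Suc n) - 1 / real (Suc (Suc n)) \<le> dist x y"
        using infdist_triangle[of x F y] by linarith
    qed
    have par: "(\<Sum>i<N. ?H (D (2 * i + p))) \<le> ?H (\<Union>i<N. D (2 * i + p))" if "p \<le> 1" for N p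
    proof (induction N)
      case (Suc N)
      let ?C = "\<Union>i<N. D (2 * i + p)"
      have "?H ?C + ?H (D (2 * N + p)) \<le> ?H (?C \<union> D (2 * N + p))"
      proof (cases N)
        case 0
        then show ?thesis by (simp add: hausdorff_outer_empty d)
      next
        case (Suc M)
        \<comment> \<open>With \<open>N = Suc M\<close> the earlier shells lie in
          \<open>B (2 * M + 1 + p)\<close>, and the new shell \<open>D (2 * N + p)\<close> has
          exactly the index \<open>Suc (2 * M + 1 + p)\<close> that \<open>step\<close> asks
          for.\<close>
        have "D (2 * i + p) \<subseteq> B (2 * M + 1 + p)" if "i < N" for i
          using order_trans[OF DB[of "2 * i + p"] Bmono[of "Suc (2 * i + p)" "2 * M + 1 + p"]] that Suc by simp
        then have "?C \<subseteq> B (2 * M + 1 + p)" by blast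
        from step[OF this] show ?thesis using Suc by simp
      qed
      moreover have "?C \<union> D (2 * N + p) = (\<Union>i<Suc N. D (2 * i + p))"
        by (auto simp: lessThan_Suc)
      ultimately show ?case
        using order_trans[OF add_right_mono[OF Suc.IH, of "?H (D (2 * N + p))"]] by simp
    qed simp
    have par': "(\<Sum>i<N. ?H (D (2 * i + p))) \<le> ?H A" if "p \<le> 1" for N p
    proof -
      have "(\<Union>i<N. D (2 * i + p)) \<subseteq> A" using DB BA by fast
      from hausdorff_outer_mono[OF this] par[OF that] show ?thesis by (rule order_trans[rotated])
    qed
    have split2: "(\<Sum>i<2 * N. f i) = (\<Sum>i<N. f (2 * i + 0)) + (\<Sum>i<N. f (2 * i + 1))"
      for N and f :: "nat \<Rightarrow> ennreal"
      by (induction N) (auto simp: algebra_simps)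
    have "(\<Sum>i. ?H (D i)) \<le> ?H A + ?H A"
    proof (rule suminf_le_const)
      fix N
      have "(\<Sum>i<N. ?H (D i)) \<le> (\<Sum>i<2 * N. ?H (D i))"
        by (rule sum_mono2) auto
      also have "\<dots> \<le> ?H A + ?H A"
        unfolding split2 by (intro add_mono par') auto
      finally show "(\<Sum>i<N. ?H (D i)) \<le> ?H A + ?H A" .
    qed auto
    then have fin: "(\<Sum>i. ?H (D i)) \<noteq> top"
      using False by (auto simp: top_unique)
    have cov: "A - F \<subseteq> B n \<union> (\<Union>i. D (i + n))" for n
    proof
      fix x assume x: "x \<in> A - F"
      then have "0 < infdist x F"
        using F False by (metis DiffD2 in_closed_iff_infdist_zero infdist_nonneg order_le_less)
      then obtain N where "1 / real (Suc N) < infdist x F"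
        using nat_approx_posE by blast
      then have ex: "x \<in> B N" using x by (auto simp: B_def)
      define k where "k = (LEAST k. x \<in> B k)"
      have k: "x \<in> B k" "\<And>j. j < k \<Longrightarrow> x \<notin> B j"
        using LeastI[of "\<lambda>k. x \<in> B k", OF ex] not_less_Least unfolding k_def by blast+
      show "x \<in> B n \<union> (\<Union>i. D (i + n))"
      proof (cases "k \<le> n")
        case True
        then show ?thesis using k(1) Bmono by blast
      next
        case f: False
        then have "x \<in> D (k - 1)" using k unfolding D_def by (cases k) auto
        then have "x \<in> D ((k - 1 - n) + n)" using f by simp
        then show ?thesis by blast
      qed
    qed
    \<comment> \<open>Adding the first shells on the left completes the tail to the whole series
      without a subtraction in \<open>ennreal\<close>. In the limit the same finite sum stands on
      both sides and cancels.\<close>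
    have main: "?H (A \<inter> F) + ?H (A - F) + (\<Sum>i<n. ?H (D i)) \<le> ?H A + (\<Sum>i. ?H (D i))" for n
    proof -
      have "?H (A - F) \<le> ?H (B n) + (\<Sum>i. ?H (D (i + n)))"
        using hausdorff_outer_mono[OF cov, of d n] hausdorff_outer_Un[OF d, of "B n" "\<Union>i. D (i + n)"]
          add_left_mono[OF hausdorff_outer_UN[of d "\<lambda>i. D (i + n)"], of "?H (B n)"]
        by (meson order_trans)
      then have "?H (A \<inter> F) + ?H (A - F) + (\<Sum>i<n. ?H (D i))
          \<le> ?H (A \<inter> F) + (?H (B n) + (\<Sum>i. ?H (D (i + n)))) + (\<Sum>i<n. ?H (D i))"
        by (intro add_mono) auto
      also have "\<dots> = (?H (A \<inter> F) + ?H (B n)) + ((\<Sum>i. ?H (D (i + n))) + (\<Sum>i<n. ?H (D i)))"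
        by (simp add: ac_simps)
      also have "(\<Sum>i. ?H (D (i + n))) + (\<Sum>i<n. ?H (D i)) = (\<Sum>i. ?H (D i))"
        by (rule suminf_offset[symmetric]) auto
      also have "(?H (A \<inter> F) + ?H (B n)) + (\<Sum>i. ?H (D i)) \<le> ?H A + (\<Sum>i. ?H (D i))"
        by (intro add_right_mono BF)
      finally show ?thesis .
    qed
    have "?H (A \<inter> F) + ?H (A - F) + (\<Sum>i. ?H (D i)) \<le> ?H A + (\<Sum>i. ?H (D i))"
      using main by (intro LIMSEQ_le_const2[OF tendsto_add[OF tendsto_const summable_LIMSEQ]]) auto
    then show ?thesis
      using fin by (simp add: ennreal_add_left_cancel_le add.commute)
  qed
qed

text \<open>Caratheodory: closed sets split every set additively, so the Borel sets lie in the
  lambda-system of the outer measure. If this failed, \<open>measure_of\<close> would fall back to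
  the zero measure.\<close>

lemma measure_space_hausdorff_outer:
  assumes "d > 0"
  shows "measure_space UNIV (sets borel) (hausdorff_outer d :: 'a::metric_space set \<Rightarrow> ennreal)"
proof -
  let ?H = "hausdorff_outer d :: 'a set \<Rightarrow> ennreal"
  interpret P: sigma_algebra UNIV "UNIV :: 'a set set" by (metis Pow_UNIV sigma_algebra_Pow)
  have oms: "outer_measure_space UNIV ?H"
    unfolding outer_measure_space_def positive_def increasing_def countably_subadditive_def
    using assms by (auto simp: hausdorff_outer_empty intro: hausdorff_outer_mono hausdorff_outer_UN)
  let ?L = "lambda_system UNIV UNIV ?H"
  have ms: "measure_space UNIV ?L ?H" by (rule P.caratheodory_lemma[OF oms])
  then have sa: "sigma_algebra UNIV ?L" by (simp add: measure_space_def)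
  have cl: "F \<in> ?L" if "closed F" for F
    using hausdorff_outer_closed_split[OF assms that] by (simp add: P.lambda_system_eq)
  have "sets borel \<subseteq> ?L"
  proof -
    have "sigma_sets UNIV (Collect closed) \<subseteq> ?L"
      using sa cl by (intro sigma_algebra.sigma_sets_subset) auto
    then show ?thesis by (simp add: borel_eq_closed)
  qed
  then show ?thesis
    using ms sets.sigma_algebra_axioms[of "borel :: 'a measure"] by (auto intro: measure_down)
qed

lemma sets_hausdorff_measure [simp, measurable_cong]: "sets (hausdorff_measure d) = sets borel"
  unfolding hausdorff_measure_def by (metis sets.sets_measure_of_eq sets_measure_of space_borel subset_UNIV Pow_UNIV)

lemma space_hausdorff_measure [simp]: "space (hausdorff_measure d) = UNIV"
  unfolding hausdorff_measure_def by (simp add: space_measure_of_conv)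

lemma emeasure_hausdorff_measure:
  assumes "d > 0" "A \<in> sets borel"
  shows "emeasure (hausdorff_measure d) A = hausdorff_outer d A"
  using measure_space_hausdorff_outer[OF assms(1)] assms(2)
  unfolding hausdorff_measure_def measure_space_def by (intro emeasure_measure_of_sigma) auto

section \<open>Comparison of Hausdorff measures through covers\<close>

lemma hausdorff_pre_finite_cover:
  fixes C :: "'i \<Rightarrow> 'a::metric_space set"
  assumes "d > 0" "\<delta> \<ge> 0" "finite I" "A \<subseteq> (\<Union>i\<in>I. C i)"
    and C: "\<And>i. i \<in> I \<Longrightarrow> bounded (C i)" "\<And>i. i \<in> I \<Longrightarrow> diameter (C i) \<le> \<delta>"
  shows "hausdorff_pre d \<delta> A \<le> (\<Sum>i\<in>I. ennreal (unit_ball_vol (real d) * (diameter (C i) / 2) ^ d))"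
proof -
  let ?v = "\<lambda>C::'a set. ennreal (unit_ball_vol (real d) * (diameter C / 2) ^ d)"
  obtain h where h: "bij_betw h {0..<card I} I"
    using ex_bij_betw_nat_finite[OF \<open>finite I\<close>] by blast
  define C' where "C' j = (if j < card I then C (h j) else {})" for j
  have "hausdorff_pre d \<delta> A \<le> (\<Sum>j. ?v (C' j))"
    unfolding hausdorff_pre_def
  proof (rule INF_lower, safe)
    fix x assume "x \<in> A"
    then obtain i where "i \<in> I" "x \<in> C i" using assms(4) by blast
    moreover then obtain j where "j < card I" "h j = i" using h unfolding bij_betw_def by (metis atLeastLessThan_iff imageE)
    ultimately have "x \<in> C' j" by (simp add: C'_def)
    then show "x \<in> (\<Union>j. C' j)" by blast
  next
    fix j
    have "h j \<in> I" if "j < card I" using h that unfolding bij_betw_def by auto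
    then show "bounded (C' j)" "diameter (C' j) \<le> \<delta>" using C assms(2) by (auto simp: C'_def)
  qed
  also have "\<dots> = (\<Sum>j\<in>{0..<card I}. ?v (C' j))"
    using \<open>d > 0\<close> by (intro suminf_finite) (auto simp: C'_def zero_power)
  also have "\<dots> = (\<Sum>j\<in>{0..<card I}. ?v (C (h j)))"
    by (intro sum.cong) (auto simp: C'_def)
  also have "\<dots> = (\<Sum>i\<in>I. ?v (C i))"
    by (rule sum.reindex_bij_betw[OF h])
  finally show ?thesis .
qed

text \<open>A cover of the image under \<open>g\<close> is pulled back to \<open>A\<close> and
  pushed forward by \<open>f\<close>, which multiplies diameters by at most \<open>L\<close>. Two
  maps on a common domain treat both directions of a bi-Lipschitz comparison alike and avoid inverse
  maps.\<close>

lemma hausdorff_outer_lipschitz: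
  fixes f :: "'x \<Rightarrow> 'a::real_normed_vector" and g :: "'x \<Rightarrow> 'b::metric_space"
  assumes L: "L > 0" and lip: "\<And>x y. x \<in> A \<Longrightarrow> y \<in> A \<Longrightarrow> dist (f x) (f y) \<le> L * dist (g x) (g y)"
  shows "hausdorff_outer d (f ` A) \<le> ennreal (L ^ d) * hausdorff_outer d (g ` A)"
proof -
  let ?va = "\<lambda>C::'a set. ennreal (unit_ball_vol (real d) * (diameter C / 2) ^ d)"
  let ?vb = "\<lambda>C::'b set. ennreal (unit_ball_vol (real d) * (diameter C / 2) ^ d)"
  have main: "hausdorff_pre d \<delta> (f ` A) \<le> ennreal (L ^ d) * hausdorff_pre d (\<delta> / L) (g ` A)" if "\<delta> > 0" for \<delta>
  proof -
    have "hausdorff_pre d \<delta> (f ` A) \<le> ennreal (L ^ d) * (\<Sum>i. ?vb (C i))"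
      if C: "g ` A \<subseteq> (\<Union>i. C i)" "\<And>i. bounded (C i)" "\<And>i. diameter (C i) \<le> \<delta> / L" for C :: "nat \<Rightarrow> 'b set"
    proof -
      define C' where "C' i = f ` {x \<in> A. g x \<in> C i}" for i
      have dd: "dist x y \<le> L * diameter (C i)" if "x \<in> C' i" "y \<in> C' i" for x y i
        using that unfolding C'_def
        by (auto intro!: order_trans[OF lip] mult_left_mono diameter_bounded_bound C(2) less_imp_le[OF L])
      have bd: "bounded (C' i)" for i
        unfolding bounded_two_points using dd by blast
      have dm: "diameter (C' i) \<le> L * diameter (C i)" for i
        using dd by (intro diameter_le) (auto simp: dist_norm intro!: mult_nonneg_nonneg diameter_ge_0 C(2) less_imp_le[OF L])
      have "hausdorff_pre d \<delta> (f ` A) \<le> (\<Sum>i. ?va (C' i))"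
        unfolding hausdorff_pre_def
      proof (rule INF_lower, safe)
        fix x assume "x \<in> A"
        then obtain i where "g x \<in> C i" using C(1) by blast
        then have "f x \<in> C' i" using \<open>x \<in> A\<close> by (auto simp: C'_def)
        then show "f x \<in> (\<Union>i. C' i)" by blast
      next
        fix i
        have "L * diameter (C i) \<le> \<delta>" using C(3)[of i] L by (simp add: field_simps)
        then show "diameter (C' i) \<le> \<delta>" using dm[of i] by linarith
      qed (rule bd)
      also have "\<dots> \<le> (\<Sum>i. ennreal (L ^ d) * ?vb (C i))"
      proof (intro suminf_le)
        fix i
        have "?va (C' i) \<le> ennreal (unit_ball_vol (real d) * ((L * diameter (C i)) / 2) ^ d)"
          using dm by (intro ennreal_leI mult_left_mono power_mono) (auto intro!: divide_right_mono diameter_ge_0 bd)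
        also have "\<dots> = ennreal (L ^ d) * ?vb (C i)"
          using L diameter_ge_0[OF C(2)] by (subst ennreal_mult[symmetric]) (auto simp: power_mult_distrib power_divide field_simps)
        finally show "?va (C' i) \<le> ennreal (L ^ d) * ?vb (C i)" .
      qed auto
      also have "\<dots> = ennreal (L ^ d) * (\<Sum>i. ?vb (C i))" by simp
      finally show ?thesis .
    qed
    \<comment> \<open>\<open>INF_greatest\<close> bounds a bare infimum from below, so the factor
      \<open>L ^ d\<close> is first moved to the other side by its inverse and restored
      afterwards.\<close>
    then have "ennreal (inverse (L ^ d)) * hausdorff_pre d \<delta> (f ` A) \<le> ennreal (inverse (L ^ d)) * (ennreal (L ^ d) * (\<Sum>i. ?vb (C i)))"
      if "g ` A \<subseteq> (\<Union>i. C i)" "\<And>i. bounded (C i)" "\<And>i. diameter (C i) \<le> \<delta> / L" for C :: "nat \<Rightarrow> 'b set"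
      using that by (intro mult_left_mono) auto
    moreover have inv: "ennreal (inverse (L ^ d)) * (ennreal (L ^ d) * x) = x" "ennreal (L ^ d) * (ennreal (inverse (L ^ d)) * x) = x" for x
      using L by (simp_all add: mult.assoc[symmetric] ennreal_mult[symmetric])
    ultimately have "ennreal (inverse (L ^ d)) * hausdorff_pre d \<delta> (f ` A) \<le> hausdorff_pre d (\<delta> / L) (g ` A)"
      by (subst (2) hausdorff_pre_def) (auto intro!: INF_greatest)
    from mult_left_mono[OF this, of "ennreal (L ^ d)"] show ?thesis by (simp add: inv)
  qed
  show ?thesis
    unfolding hausdorff_outer_def[of d "f ` A"]
  proof (rule SUP_least)
    fix \<delta> :: real assume "\<delta> \<in> {0<..}"
    then show "hausdorff_pre d \<delta> (f ` A) \<le> ennreal (L ^ d) * hausdorff_outer d (g ` A)"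
      using L by (intro order_trans[OF main] mult_left_mono) (auto simp: hausdorff_outer_def intro!: SUP_upper)
  qed
qed

lemma hausdorff_outer_isometric:
  fixes f :: "'x \<Rightarrow> 'a::real_normed_vector" and g :: "'x \<Rightarrow> 'b::real_normed_vector"
  assumes "\<And>x y. x \<in> A \<Longrightarrow> y \<in> A \<Longrightarrow> dist (f x) (f y) = dist (g x) (g y)"
  shows "hausdorff_outer d (f ` A) = hausdorff_outer d (g ` A)"
  using hausdorff_outer_lipschitz[of 1 A f g d] hausdorff_outer_lipschitz[of 1 A g f d] assms
  by (intro antisym) auto


section \<open>Top-dimensional Hausdorff measure is a multiple of Lebesgue measure\<close>

lemma nn_integral_lborel_affine:
  fixes t :: "'a::euclidean_space"
  assumes [measurable]: "f \<in> borel_measurable borel" and "c \<noteq> 0"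
  shows "(\<integral>\<^sup>+x. f x \<partial>lborel) = ennreal (\<bar>c\<bar> ^ DIM('a)) * (\<integral>\<^sup>+x. f (t + c *\<^sub>R x) \<partial>lborel)"
  by (subst lborel_affine[OF \<open>c \<noteq> 0\<close>, of t])
    (simp add: nn_integral_density nn_integral_distr nn_integral_cmult)

text \<open>Evaluate the double integral of \<open>indicator A x * indicator B (x + y)\<close>, with
  \<open>M\<close> in x and Lebesgue measure in y. Integrating over y at once gives the left side.
  Shifting x by y under \<open>M\<close> turns the integrand into
  \<open>indicator A (x - y) * indicator B x\<close>, and then the y-integral is the volume of
  \<open>A\<close>. The product form stays correct for measures that are 0 or infinite.\<close>

lemma translation_invariant_measure_unique:
  fixes M :: "'a::euclidean_space measure"
  assumes sets [measurable_cong]: "sets M = sets borel" and sf: "sigma_finite_measure M"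
    and inv: "\<And>a. distr M borel ((+) a) = M" and A [measurable]: "A \<in> sets borel" and B [measurable]: "B \<in> sets borel"
  shows "emeasure M A * emeasure lborel B = emeasure M B * emeasure lborel A"
proof -
  interpret M: sigma_finite_measure M by (rule sf)
  interpret P: pair_sigma_finite M "lborel :: 'a measure" ..
  have [simp]: "space M = UNIV" using sets_eq_imp_space_eq[OF sets] by simp
  have "emeasure M A * emeasure lborel B = (\<integral>\<^sup>+x. indicator A x * emeasure lborel B \<partial>M)"
    by (simp add: nn_integral_multc)
  also have "\<dots> = (\<integral>\<^sup>+x. \<integral>\<^sup>+y. indicator A x * indicator B (x + y) \<partial>lborel \<partial>M)"
  proof (rule nn_integral_cong)
    fix x
    show "indicator A x * emeasure lborel B = (\<integral>\<^sup>+y. indicator A x * indicator B (x + y) \<partial>lborel)"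
      using nn_integral_lborel_affine[of "indicator B" 1 x] by (simp add: nn_integral_cmult)
  qed
  also have "\<dots> = (\<integral>\<^sup>+y. \<integral>\<^sup>+x. indicator A x * indicator B (x + y) \<partial>M \<partial>lborel)"
    by (rule P.Fubini'[symmetric]) measurable
  also have "\<dots> = (\<integral>\<^sup>+y. \<integral>\<^sup>+x. indicator A (x - y) * indicator B x \<partial>M \<partial>lborel)"
  proof (rule nn_integral_cong)
    fix y
    have "(\<integral>\<^sup>+x. indicator A (x - y) * indicator B x \<partial>M) =
        (\<integral>\<^sup>+x. indicator A (x - y) * indicator B x \<partial>(distr M borel ((+) y)))"
      by (simp add: inv)
    also have "\<dots> = (\<integral>\<^sup>+x. indicator A x * indicator B (x + y) \<partial>M)"
      by (subst nn_integral_distr) (auto simp: add.commute)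
    finally show "(\<integral>\<^sup>+x. indicator A x * indicator B (x + y) \<partial>M) = (\<integral>\<^sup>+x. indicator A (x - y) * indicator B x \<partial>M)" ..
  qed
  also have "\<dots> = (\<integral>\<^sup>+x. \<integral>\<^sup>+y. indicator A (x - y) * indicator B x \<partial>lborel \<partial>M)"
    by (rule P.Fubini') measurable
  also have "\<dots> = (\<integral>\<^sup>+x. emeasure lborel A * indicator B x \<partial>M)"
  proof (rule nn_integral_cong)
    fix x
    show "(\<integral>\<^sup>+y. indicator A (x - y) * indicator B x \<partial>lborel) = emeasure lborel A * indicator B x"
      using nn_integral_lborel_affine[of "indicator A" "-1" x] by (simp add: nn_integral_multc)
  qed
  also have "\<dots> = emeasure M B * emeasure lborel A"
    by (simp add: nn_integral_cmult mult.commute[of "emeasure M B"])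
  finally show ?thesis .
qed

text \<open>The cube is cut into N^d cubes of side 1/N and diameter at most d/N. The cost of this
  cover is at most \<open>?K\<close> whatever N is, so the bound survives as the mesh tends to
  0.\<close>

lemma hausdorff_outer_unit_box_finite:
  "hausdorff_outer (DIM('a)) (cbox 0 One :: 'a::euclidean_space set) < top"
proof -
  let ?d = "DIM('a)"
  let ?K = "ennreal (unit_ball_vol (real ?d) * (real ?d / 2) ^ ?d)"
  have "hausdorff_pre ?d \<delta> (cbox 0 One :: 'a set) \<le> ?K" if "\<delta> > 0" for \<delta>
  proof -
    obtain N :: nat where N: "real ?d / \<delta> < real N" using reals_Archimedean2 by blast
    have "0 < real ?d / \<delta>" using that by simp
    then have N0: "N > 0" using N by (metis of_nat_0_less_iff order_less_trans)
    have Nd: "real ?d / real N \<le> \<delta>" using N N0 that by (simp add: field_simps)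
    define I where "I = PiE (Basis :: 'a set) (\<lambda>_. {..<N})"
    define Q :: "('a \<Rightarrow> nat) \<Rightarrow> 'a set" where
      "Q k = cbox (\<Sum>b\<in>Basis. (real (k b) / N) *\<^sub>R b) (\<Sum>b\<in>Basis. (real (k b + 1) / N) *\<^sub>R b)" for k
    have fin: "finite I" unfolding I_def by (intro finite_PiE) auto
    have card: "card I = N ^ ?d" unfolding I_def by (simp add: card_PiE)
    have dQ: "diameter (Q k) \<le> real ?d / real N" for k
    proof (rule diameter_le)
      fix x y assume "x \<in> Q k" "y \<in> Q k"
      then have "\<bar>(x - y) \<bullet> b\<bar> \<le> 1 / N" if "b \<in> Basis" for b
        using that by (fastforce simp: Q_def mem_box inner_diff_left add_divide_distrib)
      then have "(\<Sum>b\<in>Basis. \<bar>(x - y) \<bullet> b\<bar>) \<le> (\<Sum>b\<in>(Basis::'a set). 1 / real N)" by (rule sum_mono)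
      then show "norm (x - y) \<le> real ?d / real N" using norm_le_l1[of "x - y"] by simp
    qed auto
    have cov: "(cbox 0 One :: 'a set) \<subseteq> (\<Union>k\<in>I. Q k)"
    proof
      fix x :: 'a assume "x \<in> cbox 0 One"
      then have x: "0 \<le> x \<bullet> b" "x \<bullet> b \<le> 1" if "b \<in> Basis" for b using that by (auto simp: mem_box)
      have "\<exists>j<N. real j / N \<le> x \<bullet> b \<and> x \<bullet> b \<le> real (j + 1) / N" if b: "b \<in> Basis" for b
      \<comment> \<open>The face where the coordinate is 1 goes to the last cell: the floor would
        give the index \<open>N\<close>, which is out of range.\<close>
      proof (cases "x \<bullet> b = 1")
        case True
        then show ?thesis using N0 by (intro exI[of _ "N - 1"]) (auto simp: of_nat_diff)
      next
        case False
        then have lt: "x \<bullet> b < 1" using x[OF b] by simp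
        let ?j = "nat \<lfloor>N * (x \<bullet> b)\<rfloor>"
        have 0: "0 \<le> N * (x \<bullet> b)" using x[OF b] by simp
        have j: "real ?j \<le> N * (x \<bullet> b)" "N * (x \<bullet> b) \<le> real ?j + 1" using 0 by linarith+
        have "N * (x \<bullet> b) < N" using lt N0 by simp
        then have "?j < N" using j(1) by linarith
        then show ?thesis using j N0 by (intro exI[of _ ?j]) (auto simp: field_simps)
      qed
      then obtain k where k: "\<And>b. b \<in> Basis \<Longrightarrow> k b < N \<and> real (k b) / N \<le> x \<bullet> b \<and> x \<bullet> b \<le> real (k b + 1) / N"
        by metis
      have "restrict k Basis \<in> I" using k by (auto simp: I_def)
      moreover have "x \<in> Q (restrict k Basis)" using k by (auto simp: Q_def mem_box)
      ultimately show "x \<in> (\<Union>k\<in>I. Q k)" by blast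
    qed
    have "hausdorff_pre ?d \<delta> (cbox 0 One :: 'a set) \<le>
        (\<Sum>k\<in>I. ennreal (unit_ball_vol (real ?d) * (diameter (Q k) / 2) ^ ?d))"
      using fin cov dQ Nd that
      by (intro hausdorff_pre_finite_cover) (auto simp: Q_def intro: order_trans)
    also have "\<dots> \<le> (\<Sum>k\<in>I. ennreal (unit_ball_vol (real ?d) * ((real ?d / real N) / 2) ^ ?d))"
      using dQ by (intro sum_mono ennreal_leI mult_left_mono power_mono)
        (auto intro!: divide_right_mono diameter_ge_0 simp: Q_def)
    also have "\<dots> = ?K"
      using N0 by (simp add: card ennreal_of_nat_eq_real_of_nat ennreal_mult[symmetric] power_divide)
    finally show ?thesis .
  qed
  then have "hausdorff_outer ?d (cbox 0 One :: 'a set) \<le> ?K"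
    unfolding hausdorff_outer_def by (intro SUP_least) auto
  then show ?thesis by (simp add: order_le_less_trans)
qed

text \<open>A set of diameter r lies in a closed ball of radius r, not r/2, about one of its points,
  whence the factor \<open>2 ^ DIM('a)\<close>. The estimate serves to show that the constant
  relating the two measures is not zero.\<close>

lemma lborel_le_hausdorff_outer:
  fixes A :: "'a::euclidean_space set"
  assumes [measurable]: "A \<in> sets borel"
  shows "emeasure lborel A \<le> ennreal (2 ^ DIM('a)) * hausdorff_outer (DIM('a)) A"
proof -
  let ?d = "DIM('a)"
  have "emeasure lborel A * ennreal (inverse (2 ^ ?d)) \<le> hausdorff_pre ?d 1 A"
    unfolding hausdorff_pre_def
  proof (rule INF_greatest, safe)
    fix C :: "nat \<Rightarrow> 'a set"
    assume C: "A \<subseteq> (\<Union>i. C i)" "\<forall>i. bounded (C i) \<and> diameter (C i) \<le> 1"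
    define B where "B i = (if C i = {} then {} else cball (SOME x. x \<in> C i) (diameter (C i)))" for i
    have CB: "C i \<subseteq> B i" for i
    proof
      fix x assume x: "x \<in> C i"
      then have "(SOME x. x \<in> C i) \<in> C i" by (rule someI)
      then have "dist (SOME x. x \<in> C i) x \<le> diameter (C i)"
        using x C(2) by (intro diameter_bounded_bound) auto
      then show "x \<in> B i" using x by (auto simp: B_def)
    qed
    have [measurable]: "B i \<in> sets borel" for i by (auto simp: B_def)
    have "emeasure lborel A \<le> emeasure lborel (\<Union>i. B i)"
      using C CB by (intro emeasure_mono) (blast, measurable)
    also have "\<dots> \<le> (\<Sum>i. emeasure lborel (B i))"
      by (rule emeasure_subadditive_countably) auto
    also have "\<dots> \<le> (\<Sum>i. ennreal (unit_ball_vol (real ?d) * diameter (C i) ^ ?d))"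
      using C(2) by (intro suminf_le) (auto simp: B_def emeasure_cball diameter_ge_0)
    finally have "emeasure lborel A * ennreal (inverse (2 ^ ?d))
        \<le> (\<Sum>i. ennreal (unit_ball_vol (real ?d) * diameter (C i) ^ ?d)) * ennreal (inverse (2 ^ ?d))"
      by (rule mult_right_mono) simp
    also have "\<dots> = (\<Sum>i. ennreal (unit_ball_vol (real ?d) * diameter (C i) ^ ?d) * ennreal (inverse (2 ^ ?d)))"
      by simp
    also have "\<dots> = (\<Sum>i. ennreal (unit_ball_vol (real ?d) * (diameter (C i) / 2) ^ ?d))"
      using C(2) by (intro suminf_cong) (auto simp: ennreal_mult[symmetric] diameter_ge_0 power_divide field_simps)
    finally show "emeasure lborel A * ennreal (inverse (2 ^ ?d)) \<le> \<dots>" .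
  qed
  also have "\<dots> \<le> hausdorff_outer ?d A"
    unfolding hausdorff_outer_def by (rule SUP_upper) simp
  finally have "ennreal (2 ^ ?d) * (emeasure lborel A * ennreal (inverse (2 ^ ?d))) \<le> ennreal (2 ^ ?d) * hausdorff_outer ?d A"
    by (rule mult_left_mono) simp
  moreover have "ennreal (2 ^ ?d) * (x * ennreal (inverse (2 ^ ?d))) = x" for x
    by (metis (no_types, lifting) mult.assoc mult.commute ennreal_1 ennreal_mult inverse_nonnegative_iff_nonnegative
        mult.left_neutral power_not_zero right_inverse zero_le_numeral zero_le_power zero_neq_numeral)
  ultimately show ?thesis by simp
qed

text \<open>Hausdorff measure is translation invariant and sigma-finite, hence proportional to
  Lebesgue measure. The factor is the measure of the unit cube: finite by the grid covers, positive
  by the comparison with balls.\<close>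

lemma hausdorff_outer_eq_lborel:
  "\<exists>c>0. \<forall>A\<in>sets borel. hausdorff_outer (DIM('a)) (A :: 'a::euclidean_space set) = ennreal c * emeasure lborel A"
proof -
  let ?d = "DIM('a)" and ?H = "hausdorff_measure (DIM('a)) :: 'a measure"
  have H: "emeasure ?H A = hausdorff_outer ?d A" if "A \<in> sets borel" for A
    using that by (intro emeasure_hausdorff_measure) auto
  have "sigma_finite_measure ?H"
  proof
    \<comment> \<open>\<open>T n\<close> carries the unit cube onto the cube of half-side n + 1
      about the origin. These cubes exhaust the space and have finite measure by the Lipschitz
      bound.\<close>
    define T :: "nat \<Rightarrow> 'a \<Rightarrow> 'a" where "T n x = (2 * real (Suc n)) *\<^sub>R x - real (Suc n) *\<^sub>R One" for n x
    have bor: "T n ` cbox 0 One \<in> sets borel" for n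
    proof -
      have "compact (T n ` cbox 0 One)" unfolding T_def by (intro compact_continuous_image continuous_intros) auto
      then show ?thesis by (intro borel_closed compact_imp_closed)
    qed
    have "hausdorff_outer ?d (T n ` cbox 0 One) \<noteq> \<infinity>" for n
    proof -
      have "hausdorff_outer ?d (T n ` cbox 0 One) \<le> ennreal ((2 * real (Suc n)) ^ ?d) * hausdorff_outer ?d (id ` cbox 0 One :: 'a set)"
      proof (rule hausdorff_outer_lipschitz)
        fix x y :: 'a
        have "T n x - T n y = (2 * real (Suc n)) *\<^sub>R (x - y)" by (simp add: T_def algebra_simps)
        then show "dist (T n x) (T n y) \<le> 2 * real (Suc n) * dist (id x) (id y)" by (simp add: dist_norm)
      qed auto
      also have "\<dots> < top" using hausdorff_outer_unit_box_finite[where 'a='a] by (auto simp: ennreal_mult_less_top)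
      finally show ?thesis by simp
    qed
    moreover have "(\<Union>n. T n ` cbox 0 One) = UNIV"
    proof -
      have "x \<in> (\<Union>n. T n ` cbox 0 One)" for x
      proof -
        obtain n where n: "norm x \<le> real n" using real_arch_simple by blast
        let ?y = "(1 / (2 * real (Suc n))) *\<^sub>R (x + real (Suc n) *\<^sub>R One)"
        have y: "?y \<bullet> b = (x \<bullet> b + real (Suc n)) / (2 * real (Suc n))" if "b \<in> Basis" for b
          using that by (simp add: inner_add_left del: of_nat_Suc)
        have "0 \<le> ?y \<bullet> b \<and> ?y \<bullet> b \<le> 1" if "b \<in> Basis" for b
          using Basis_le_norm[OF that, of x] n unfolding y[OF that] by (auto simp: divide_simps)
        then have "?y \<in> cbox 0 One"
          by (simp add: mem_box)
        moreover have "T n ?y = x" by (simp add: T_def del: of_nat_Suc)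
        ultimately show ?thesis by (metis UN_I UNIV_I imageI)
      qed
      then show ?thesis by blast
    qed
    ultimately show "\<exists>A. countable A \<and> A \<subseteq> sets ?H \<and> \<Union> A = space ?H \<and> (\<forall>a\<in>A. emeasure ?H a \<noteq> \<infinity>)"
      using bor by (intro exI[of _ "range (\<lambda>n. T n ` cbox 0 One)"]) (auto simp: H)
  qed
  moreover have "distr ?H borel ((+) a) = ?H" for a
  proof (rule measure_eqI)
    fix A :: "'a set" assume "A \<in> sets (distr ?H borel ((+) a))"
    then have A[measurable]: "A \<in> sets borel" by simp
    have [measurable]: "(+) a \<in> ?H \<rightarrow>\<^sub>M borel" by measurable
    have vA: "(+) a -` A \<in> sets borel" using measurable_sets[of "(+) a" borel borel A] by simp
    have "emeasure (distr ?H borel ((+) a)) A = hausdorff_outer ?d ((+) a -` A)"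
      using vA by (subst emeasure_distr) (simp_all add: H)
    also have "\<dots> = hausdorff_outer ?d (id ` ((+) a -` A))" by simp
    also have "\<dots> = hausdorff_outer ?d ((+) a ` ((+) a -` A))" by (rule hausdorff_outer_isometric) simp
    also have "(+) a ` ((+) a -` A) = A" by (rule surj_image_vimage_eq[OF surj_plus])
    finally show "emeasure (distr ?H borel ((+) a)) A = emeasure ?H A" by (simp add: H)
  qed simp
  ultimately have *: "emeasure ?H A * emeasure lborel (cbox 0 One :: 'a set) = emeasure ?H (cbox 0 One) * emeasure lborel A" if "A \<in> sets borel" for A
    using that by (intro translation_invariant_measure_unique) auto
  have one: "emeasure lborel (cbox 0 One :: 'a set) = 1"
    by (subst emeasure_lborel_cbox) auto
  define c where "c = enn2real (hausdorff_outer ?d (cbox 0 One :: 'a set))"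
  have c: "ennreal c = hausdorff_outer ?d (cbox 0 One :: 'a set)"
    using hausdorff_outer_unit_box_finite[where 'a='a] by (simp add: c_def)
  have "hausdorff_outer ?d (cbox 0 One :: 'a set) \<noteq> 0"
    using lborel_le_hausdorff_outer[of "cbox 0 One :: 'a set"] one by auto
  then have "c \<noteq> 0" using c by auto
  then have "c > 0" by (simp add: c_def order_less_le)
  moreover have "hausdorff_outer ?d A = ennreal c * emeasure lborel A" if "A \<in> sets borel" for A :: "'a set"
    using *[OF that] H[OF that] H[of "cbox 0 One"] by (simp add: one c)
  ultimately show ?thesis by (intro exI[of _ c] conjI ballI)
qed

text \<open>Hausdorff measure sees only distances; being a positive multiple of Lebesgue measure, it
  passes its invariance on.\<close>

lemma emeasure_lborel_isometric_image:
  fixes f :: "'a::euclidean_space \<Rightarrow> 'a"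
  assumes "\<And>x y. dist (f x) (f y) = dist x y" and "A \<in> sets borel" "f ` A \<in> sets borel"
  shows "emeasure lborel (f ` A) = emeasure lborel A"
proof -
  obtain c where c: "c > 0" "\<And>A. A \<in> sets borel \<Longrightarrow> hausdorff_outer (DIM('a)) (A :: 'a set) = ennreal c * emeasure lborel A"
    using hausdorff_outer_eq_lborel[where 'a='a] by (elim exE conjE) (rule that, simp_all)
  have "hausdorff_outer (DIM('a)) (f ` A) = hausdorff_outer (DIM('a)) (id ` A)"
    by (rule hausdorff_outer_isometric) (simp add: assms(1))
  then have "ennreal c * emeasure lborel (f ` A) = ennreal c * emeasure lborel A"
    unfolding c(2)[OF assms(2)] c(2)[OF assms(3)] image_id id_apply .
  then show ?thesis
    using c(1) by (auto simp: ennreal_mult_cancel_left)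
qed

section \<open>Volume under stretching in one direction\<close>

definition stretch :: "'a::real_inner \<Rightarrow> real \<Rightarrow> 'a \<Rightarrow> 'a" where
  "stretch u t x = x + ((t - 1) * (x \<bullet> u)) *\<^sub>R u"

lemma stretch_stretch:
  assumes "norm u = 1"
  shows "stretch u t (stretch u s x) = stretch u (t * s) x"
proof -
  have "stretch u s x \<bullet> u = s * (x \<bullet> u)"
    using norm_eq_1[THEN iffD1, OF assms] by (simp add: stretch_def inner_add_left algebra_simps)
  then have "stretch u t (stretch u s x) = x + ((s - 1) * (x \<bullet> u)) *\<^sub>R u + ((t - 1) * (s * (x \<bullet> u))) *\<^sub>R u"
    by (simp add: stretch_def[of u t] stretch_def[of u s])
  also have "\<dots> = stretch u (t * s) x"
    unfolding stretch_def add.assoc scaleR_left_distrib[symmetric] by (simp add: algebra_simps)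
  finally show ?thesis .
qed

lemma stretch_inverse:
  assumes "norm u = 1" "t \<noteq> 0"
  shows "stretch u t (stretch u (inverse t) x) = x" "stretch u (inverse t) (stretch u t x) = x"
  unfolding stretch_stretch[OF assms(1)] using assms(2) by (simp_all add: stretch_def)

lemma stretch_diff: "stretch u t x - stretch u t y = stretch u t (x - y)"
  by (simp add: stretch_def algebra_simps inner_diff_left)

lemma norm_stretch_sq:
  assumes "norm u = 1"
  shows "(norm (stretch u t x))\<^sup>2 = (norm x)\<^sup>2 + (t\<^sup>2 - 1) * (x \<bullet> u)\<^sup>2"
  using norm_eq_1[THEN iffD1, OF assms] unfolding stretch_def power2_norm_eq_inner
  by (simp add: inner_add_left inner_add_right inner_commute[of u x] power2_eq_square algebra_simps)

lemma stretch_image: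
  assumes "norm u = 1" "t \<noteq> 0"
  shows "stretch u t ` A = stretch u (inverse t) -` A"
proof safe
  fix x assume "x \<in> A"
  then show "stretch u t x \<in> stretch u (inverse t) -` A" by (simp add: stretch_inverse[OF assms])
next
  fix x assume "stretch u (inverse t) x \<in> A"
  then show "x \<in> stretch u t ` A" by (metis image_eqI stretch_inverse(1)[OF assms])
qed

lemma borel_measurable_stretch [measurable]: "stretch (u::'a::euclidean_space) t \<in> borel \<rightarrow>\<^sub>M borel"
  unfolding stretch_def by measurable

lemma stretch_image_borel:
  assumes "norm u = 1" "t \<noteq> 0" "A \<in> sets borel"
  shows "stretch (u::'a::euclidean_space) t ` A \<in> sets borel"
  using measurable_sets[OF borel_measurable_stretch assms(3), of u "inverse t"] by (simp add: stretch_image assms)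

text \<open>In a coordinate direction the map is diagonal with one entry \<open>t\<close> and all
  others 1, so the coordinatewise scaling of \<open>lborel\<close> applies.\<close>

lemma emeasure_lborel_stretch_Basis:
  fixes b :: "'a::euclidean_space"
  assumes b: "b \<in> Basis" and t: "t > 0" and A: "A \<in> sets borel"
  shows "emeasure lborel (stretch b t ` A) = ennreal t * emeasure lborel A"
proof -
  let ?c = "\<lambda>j. if j = b then t else 1"
  have T: "(\<lambda>x. 0 + (\<Sum>j\<in>Basis. (?c j * (x \<bullet> j)) *\<^sub>R j)) = stretch b t"
  proof
    fix x :: 'a
    have "(\<Sum>j\<in>Basis. (?c j * (x \<bullet> j)) *\<^sub>R j) = (\<Sum>j\<in>Basis. (x \<bullet> j) *\<^sub>R j + (if j = b then ((t - 1) * (x \<bullet> b)) *\<^sub>R b else 0))"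
      by (intro sum.cong) (auto simp: algebra_simps)
    also have "\<dots> = stretch b t x"
      using b by (simp add: sum.distrib euclidean_representation stretch_def)
    finally show "0 + (\<Sum>j\<in>Basis. (?c j * (x \<bullet> j)) *\<^sub>R j) = stretch b t x" by simp
  qed
  have "(\<Prod>j\<in>Basis. \<bar>?c j\<bar>) = (\<Prod>j\<in>(Basis::'a set). if j = b then t else 1)"
    using t by (intro prod.cong) auto
  also have "\<dots> = t" using b by simp
  finally have P: "(\<Prod>j\<in>Basis. \<bar>?c j\<bar>) = t" .
  have L: "lborel = density (distr lborel borel (stretch b t)) (\<lambda>_. ennreal t)"
    using lborel_affine_euclidean[of ?c 0] t unfolding T P by simp
  note B = stretch_image_borel[OF _ _ A, of b t]
  have "emeasure lborel (stretch b t ` A) = ennreal t * emeasure (distr lborel borel (stretch b t)) (stretch b t ` A)"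
    using B b t by (subst L) (simp add: emeasure_density_const norm_Basis)
  also have "emeasure (distr lborel borel (stretch b t)) (stretch b t ` A) = emeasure lborel (stretch b t -` stretch b t ` A)"
    using B b t by (subst emeasure_distr) (auto simp: norm_Basis)
  also have "stretch b t -` stretch b t ` A = A"
    using stretch_inverse(2)[of b t] b t by (intro inj_vimage_image_eq injI) (metis less_irrefl norm_Basis)
  finally show ?thesis .
qed

text \<open>A reflection carries the direction \<open>u\<close> to a coordinate direction.\<close>

lemma emeasure_lborel_stretch:
  fixes u :: "'a::euclidean_space"
  assumes u: "norm u = 1" and t: "t > 0" and A: "A \<in> sets borel"
  shows "emeasure lborel (stretch u t ` A) = ennreal t * emeasure lborel A"
proof -
  obtain b :: 'a where b: "b \<in> Basis" using nonempty_Basis by blast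
  define w where "w = u - b"
  \<comment> \<open>The Householder reflection that exchanges \<open>u\<close> and \<open>b\<close>.
    If \<open>u = b\<close> then \<open>w = 0\<close>, and since division by zero yields 0,
    \<open>R\<close> is the identity.\<close>
  define R where "R x = x - (2 * (x \<bullet> w) / (w \<bullet> w)) *\<^sub>R w" for x
  have ww: "2 * (x \<bullet> w) / (w \<bullet> w) * (w \<bullet> w) = 2 * (x \<bullet> w)" for x
    by (cases "w = 0") auto
  have Rw: "R x \<bullet> w = - (x \<bullet> w)" for x
    using ww[of x] by (simp add: R_def inner_diff_left)
  have inner_R: "R x \<bullet> R y = x \<bullet> y" for x y
  proof -
    have "R x \<bullet> R y = R x \<bullet> y - 2 * (y \<bullet> w) / (w \<bullet> w) * (R x \<bullet> w)"
      by (simp add: R_def[of y] inner_diff_right)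
    also have "R x \<bullet> y = x \<bullet> y - 2 * (x \<bullet> w) / (w \<bullet> w) * (y \<bullet> w)"
      by (simp add: R_def inner_diff_left inner_commute[of w y])
    finally show ?thesis by (simp add: Rw mult.commute)
  qed
  have R_diff: "R x - R y = R (x - y)" for x y
    by (simp add: R_def inner_diff_left algebra_simps diff_divide_distrib)
  have R_add: "R (x + y) = R x + R y" and R_scale: "R (c *\<^sub>R x) = c *\<^sub>R R x" for x y c
    by (simp_all add: R_def inner_add_left algebra_simps add_divide_distrib)
  have dist_R: "dist (R x) (R y) = dist x y" for x y
    by (simp add: dist_norm R_diff norm_eq_sqrt_inner inner_R)
  have RR: "R (R x) = x" for x
    by (simp add: R_def[of "R x"] Rw) (simp add: R_def)
  have Ru: "R u = b"
  proof (cases "w = 0")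
    case False
    have "w \<bullet> w = 2 * (u \<bullet> w)"
      using norm_eq_1[THEN iffD1, OF u] b by (simp add: w_def inner_diff_left inner_diff_right inner_commute[of b u] inner_same_Basis)
    then have "2 * (u \<bullet> w) / (w \<bullet> w) = 1" using False by (metis divide_self inner_eq_zero_iff)
    then have "R u = u - w" by (simp only: R_def scaleR_one)
    then show ?thesis by (simp add: w_def)
  qed (simp add: R_def w_def)
  have "stretch u t x = R (stretch b t (R x))" for x
  proof -
    have "R x \<bullet> b = x \<bullet> u" using inner_R[of x u] by (simp add: Ru)
    moreover have "R b = u" using RR[of u] by (simp add: Ru)
    ultimately show ?thesis by (simp add: stretch_def R_add R_scale RR)
  qed
  then have eq: "stretch u t ` A = R ` (stretch b t ` (R ` A))" by (auto simp: image_image)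
  have R_image: "R ` X = R -` X" for X
  proof safe
    fix x assume "R x \<in> X"
    then show "x \<in> R ` X" by (metis RR image_eqI)
  qed (simp add: RR)
  have [measurable]: "R \<in> borel \<rightarrow>\<^sub>M borel" unfolding R_def by measurable
  have bor: "R ` X \<in> sets borel" if "X \<in> sets borel" for X
    using measurable_sets[of R borel borel X] that by (simp add: R_image)
  have RA: "R ` A \<in> sets borel" and SRA: "stretch b t ` R ` A \<in> sets borel"
    using bor[OF A] stretch_image_borel[OF _ _ bor[OF A], of b t] b t by auto
  show ?thesis
    unfolding eq
    by (simp add: emeasure_lborel_isometric_image[OF dist_R SRA bor[OF SRA]]
        emeasure_lborel_stretch_Basis[OF b t RA] emeasure_lborel_isometric_image[OF dist_R A RA])
qed

section \<open>The area formula for graphs\<close>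

text \<open>Letting \<open>e\<close> tend to 0 removes the error factor of the local comparison of
  graph and tangent plane. There the exponent is one more than the dimension: the Lipschitz constant
  enters once per dimension, the oscillation of the Jacobian once more.\<close>

lemma ennreal_le_one_plus_power_mult:
  fixes x y :: ennreal
  assumes "\<And>e::real. e > 0 \<Longrightarrow> x \<le> ennreal ((1 + e) ^ k) * y"
  shows "x \<le> y"
proof -
  have "(\<lambda>n. (1 + 1 / real (Suc n)) ^ k) \<longlonglongrightarrow> (1 + 0) ^ k"
    by (intro tendsto_intros LIMSEQ_Suc[OF lim_1_over_n])
  then have "(\<lambda>n. ennreal ((1 + 1 / real (Suc n)) ^ k)) \<longlonglongrightarrow> ennreal 1"
    by (intro tendsto_ennrealI) simp
  then have "(\<lambda>n. ennreal ((1 + 1 / real (Suc n)) ^ k) * y) \<longlonglongrightarrow> ennreal 1 * y"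
    by (intro tendsto_mult_ennreal tendsto_const) auto
  from LIMSEQ_le_const[OF this, of x] show ?thesis
    using assms by auto
qed

text \<open>Near a point the graph is bi-Lipschitz, with constants close to \<open>1\<close>, to its tangent plane,
  and that plane is isometric to the domain stretched in the direction of the gradient.\<close>

lemma hausdorff_outer_graph_local:
  fixes f :: "'b::euclidean_space \<Rightarrow> real" and \<iota> :: "'b \<times> real \<Rightarrow> 'a::euclidean_space"
  assumes c: "\<And>A. A \<in> sets borel \<Longrightarrow> hausdorff_outer (DIM('b)) (A :: 'b set) = ennreal c * emeasure lborel A"
    and \<iota>: "\<And>p q. dist (\<iota> p) (\<iota> q) = dist p q"
    and U: "open U" and f: "\<And>x. x \<in> U \<Longrightarrow> (f has_derivative (\<lambda>h. h \<bullet> g x)) (at x)"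
    and g: "continuous_on U g" and x0: "x0 \<in> U" and e: "e > 0"
  defines "J \<equiv> \<lambda>x. sqrt (1 + (norm (g x))\<^sup>2)"
  shows "\<exists>V. open V \<and> x0 \<in> V \<and> V \<subseteq> U \<and> (\<forall>A\<in>sets borel. A \<subseteq> V \<longrightarrow>
    hausdorff_outer (DIM('b)) ((\<lambda>x. \<iota> (x, f x)) ` A) \<le>
      ennreal ((1 + e) ^ Suc (DIM('b))) * (ennreal c * (\<integral>\<^sup>+x. ennreal (J x) * indicator A x \<partial>lborel)) \<and>
    ennreal c * (\<integral>\<^sup>+x. ennreal (J x) * indicator A x \<partial>lborel) \<le>
      ennreal ((1 + e) ^ Suc (DIM('b))) * hausdorff_outer (DIM('b)) ((\<lambda>x. \<iota> (x, f x)) ` A))"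
proof -
  let ?d = "DIM('b)"
  define a where "a = g x0"
  define t where "t = sqrt (1 + (norm a)\<^sup>2)"
  have t1: "t \<ge> 1" by (simp add: t_def)
  obtain u :: 'b where u: "norm u = 1" "a = norm a *\<^sub>R u"
  proof (cases "a = 0")
    case True
    obtain b :: 'b where "b \<in> Basis" using nonempty_Basis by blast
    then show ?thesis using True that[of b] by simp
  qed (auto intro: that[of "a /\<^sub>R norm a"])
  have Jc: "continuous_on U J" unfolding J_def by (intro continuous_intros g)
  have "\<forall>\<^sub>F x in at x0. norm (g x - a) < e"
    using g U x0 e unfolding a_def continuous_on_eq_continuous_at[OF U] isCont_def tendsto_iff dist_norm by blast
  moreover have "\<forall>\<^sub>F x in at x0. J x < (1 + e) * t" "\<forall>\<^sub>F x in at x0. t / (1 + e) < J x"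
  proof -
    have "J \<midarrow>x0\<rightarrow> t" using Jc x0 unfolding continuous_on_eq_continuous_at[OF U] isCont_def t_def a_def J_def by blast
    then show "\<forall>\<^sub>F x in at x0. J x < (1 + e) * t" "\<forall>\<^sub>F x in at x0. t / (1 + e) < J x"
      using order_tendstoD[OF \<open>J \<midarrow>x0\<rightarrow> t\<close>, of "(1 + e) * t"] order_tendstoD[OF \<open>J \<midarrow>x0\<rightarrow> t\<close>, of "t / (1 + e)"] t1 e
      by (simp_all add: divide_less_eq)
  qed
  moreover have "\<forall>\<^sub>F x in at x0. x \<in> U" using U x0 by (rule eventually_at_in_open')
  ultimately have "\<forall>\<^sub>F x in at x0. norm (g x - a) < e \<and> J x < (1 + e) * t \<and> t / (1 + e) < J x \<and> x \<in> U"
    by (intro eventually_conj)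
  then obtain r where r: "r > 0" and near: "\<And>x. x \<noteq> x0 \<Longrightarrow> dist x x0 < r \<Longrightarrow>
      norm (g x - a) < e \<and> J x < (1 + e) * t \<and> t / (1 + e) < J x \<and> x \<in> U"
    unfolding eventually_at by blast
  define V where "V = ball x0 r"
  have V: "norm (g x - a) \<le> e" "J x \<le> (1 + e) * t" "t \<le> (1 + e) * J x" "x \<in> U" if "x \<in> V" for x
  proof -
    have "norm (g x - a) \<le> e \<and> J x \<le> (1 + e) * t \<and> t / (1 + e) \<le> J x \<and> x \<in> U"
    proof (cases "x = x0")
      case True
      then have "J x = t" by (simp add: a_def J_def t_def)
      then show ?thesis using True e t1 x0 by (simp add: a_def divide_le_eq)
    next
      case False
      then show ?thesis using near[of x] that by (simp add: V_def dist_commute less_imp_le)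
    qed
    then show "norm (g x - a) \<le> e" "J x \<le> (1 + e) * t" "t \<le> (1 + e) * J x" "x \<in> U"
      using e by (simp_all add: divide_le_eq mult.commute)
  qed
  \<comment> \<open>The mean value inequality for \<open>f\<close> minus the linear function with
    gradient \<open>a\<close>: the gradient of the difference has norm at most \<open>e\<close> on
    the convex ball \<open>V\<close>.\<close>
  have slope: "\<bar>(f x - f y) - (x - y) \<bullet> a\<bar> \<le> e * norm (x - y)" if "x \<in> V" "y \<in> V" for x y
  proof -
    have "norm ((f x - x \<bullet> a) - (f y - y \<bullet> a)) \<le> e * norm (x - y)"
    proof (rule differentiable_bound[where S = V and f' = "\<lambda>x h. h \<bullet> g x - h \<bullet> a"])
      show "convex V" by (simp add: V_def)
      fix x assume x: "x \<in> V"
      show "((\<lambda>x. f x - x \<bullet> a) has_derivative (\<lambda>h. h \<bullet> g x - h \<bullet> a)) (at x within V)"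
        using V(4)[OF x] by (intro derivative_intros has_derivative_at_withinI[OF f]) (auto intro!: derivative_eq_intros)
      show "onorm (\<lambda>h. h \<bullet> g x - h \<bullet> a) \<le> e"
      proof (rule onorm_le)
        fix h
        have "norm (h \<bullet> g x - h \<bullet> a) \<le> norm h * norm (g x - a)"
          by (metis Cauchy_Schwarz_ineq2 inner_diff_right real_norm_def)
        also have "\<dots> \<le> norm h * e" using V(1)[OF x] by (rule mult_left_mono) simp
        finally show "norm (h \<bullet> g x - h \<bullet> a) \<le> e * norm h" by (simp add: mult.commute)
      qed
    qed (use that in auto)
    then show ?thesis by (simp add: inner_diff_left algebra_simps)
  qed
  let ?G = "\<lambda>x. \<iota> (x, f x)"
  let ?S = "stretch u t"
  \<comment> \<open>By the choice of \<open>t\<close>, the stretched distance is the distance of the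
    corresponding points on the plane of all (x, x \<bullet> a).\<close>
  have S: "dist (?S x) (?S y) = norm (x - y, (x - y) \<bullet> a)" for x y
  proof -
    have "(norm a)\<^sup>2 * ((x - y) \<bullet> u)\<^sup>2 = ((x - y) \<bullet> a)\<^sup>2"
      by (subst (2) u(2)) (simp add: power_mult_distrib)
    then have "(norm (?S (x - y)))\<^sup>2 = (norm (x - y))\<^sup>2 + ((x - y) \<bullet> a)\<^sup>2"
      by (simp add: norm_stretch_sq[OF u(1)] t_def)
    then have "norm (?S (x - y)) = sqrt ((norm (x - y))\<^sup>2 + ((x - y) \<bullet> a)\<^sup>2)"
      by (metis norm_ge_zero real_sqrt_abs abs_of_nonneg)
    then show ?thesis by (simp add: dist_norm stretch_diff norm_Pair)
  qed
  \<comment> \<open>Moving the last coordinate by at most \<open>e * norm w\<close> costs a factor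
    of at most \<open>1 + e\<close>. The roles of \<open>p\<close> and \<open>q\<close> can be
    exchanged, which yields both Lipschitz bounds.\<close>
  have tri: "norm (w, p) \<le> (1 + e) * norm (w, q)" if "\<bar>p - q\<bar> \<le> e * norm w" for w :: 'b and p q :: real
  proof -
    have "norm (w, p) \<le> norm (w, q) + norm (0 :: 'b, p - q)"
      using norm_triangle_ineq[of "(w, q)" "(0, p - q)"] by simp
    also have "norm (0 :: 'b, p - q) = \<bar>p - q\<bar>" by (simp add: norm_Pair)
    also have "\<dots> \<le> e * norm (w, q)"
      using that mult_left_mono[OF norm_fst_le[of w q], of e] e by linarith
    finally show ?thesis by (simp add: algebra_simps)
  qed
  have GS: "dist (?G x) (?G y) \<le> (1 + e) * dist (?S x) (?S y)"
    and SG: "dist (?S x) (?S y) \<le> (1 + e) * dist (?G x) (?G y)" if "x \<in> V" "y \<in> V" for x y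
  proof -
    have G: "dist (?G x) (?G y) = norm (x - y, f x - f y)" unfolding \<iota> by (simp add: dist_norm)
    show "dist (?G x) (?G y) \<le> (1 + e) * dist (?S x) (?S y)"
      unfolding G S using slope[OF that] by (intro tri) simp
    show "dist (?S x) (?S y) \<le> (1 + e) * dist (?G x) (?G y)"
      unfolding G S using slope[OF that] by (intro tri) (simp add: abs_minus_commute)
  qed
  have "hausdorff_outer ?d (?G ` A) \<le> ennreal ((1 + e) ^ Suc ?d) * (ennreal c * (\<integral>\<^sup>+x. ennreal (J x) * indicator A x \<partial>lborel)) \<and>
    ennreal c * (\<integral>\<^sup>+x. ennreal (J x) * indicator A x \<partial>lborel) \<le> ennreal ((1 + e) ^ Suc ?d) * hausdorff_outer ?d (?G ` A)"
    if A: "A \<in> sets borel" "A \<subseteq> V" for A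
  proof -
    let ?I = "\<integral>\<^sup>+x. ennreal (J x) * indicator A x \<partial>lborel"
    have J0: "J x \<ge> 0" for x by (simp add: J_def)
    have HS: "hausdorff_outer ?d (?S ` A) = ennreal c * (ennreal t * emeasure lborel A)"
      using t1 A(1) u(1) by (simp add: c stretch_image_borel emeasure_lborel_stretch)
    have "(\<lambda>x. ennreal (indicator A x *\<^sub>R J x)) \<in> borel_measurable borel"
      using A V(4) by (intro measurable_compose[OF _ measurable_ennreal] borel_measurable_continuous_on_indicator
          continuous_on_subset[OF Jc]) auto
    then have meas: "(\<lambda>x. ennreal (J x) * indicator A x) \<in> borel_measurable borel"
      by (rule measurable_cong[THEN iffD1, rotated]) (auto simp: indicator_def)
    have tI: "ennreal t * emeasure lborel A \<le> ennreal (1 + e) * ?I"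
    proof -
      have "ennreal t * emeasure lborel A = (\<integral>\<^sup>+x. ennreal t * indicator A x \<partial>lborel)"
        using A(1) by (simp add: nn_integral_cmult_indicator)
      also have "\<dots> \<le> (\<integral>\<^sup>+x. ennreal (1 + e) * (ennreal (J x) * indicator A x) \<partial>lborel)"
      proof (rule nn_integral_mono)
        fix x
        have "ennreal t \<le> ennreal (1 + e) * ennreal (J x)" if "x \<in> V"
          using V(3)[OF that] e J0 by (subst ennreal_mult[symmetric]) (auto intro: ennreal_leI)
        then show "ennreal t * indicator A x \<le> ennreal (1 + e) * (ennreal (J x) * indicator A x)"
          using A(2) by (auto simp: indicator_def simp del: ennreal_plus)
      qed
      also have "\<dots> \<le> ennreal (1 + e) * ?I"
        using meas by (subst nn_integral_cmult) auto
      finally show ?thesis .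
    qed
    have It: "?I \<le> ennreal (1 + e) * (ennreal t * emeasure lborel A)"
    proof -
      have "?I \<le> (\<integral>\<^sup>+x. ennreal ((1 + e) * t) * indicator A x \<partial>lborel)"
        using V(2) A(2) by (intro nn_integral_mono) (auto simp: indicator_def intro!: ennreal_leI)
      also have "\<dots> = ennreal (1 + e) * (ennreal t * emeasure lborel A)"
        using A(1) e t1 by (subst nn_integral_cmult_indicator) (auto simp: ennreal_mult mult.assoc simp del: ennreal_plus)
      finally show ?thesis .
    qed
    have q: "ennreal ((1 + e) ^ Suc ?d) = ennreal ((1 + e) ^ ?d) * ennreal (1 + e)"
      using e by (subst ennreal_mult[symmetric]) (auto simp: mult.commute)
    have "hausdorff_outer ?d (?G ` A) \<le> ennreal ((1 + e) ^ ?d) * hausdorff_outer ?d (?S ` A)"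
      using GS A(2) e by (intro hausdorff_outer_lipschitz) auto
    also have "\<dots> \<le> ennreal ((1 + e) ^ ?d) * (ennreal c * (ennreal (1 + e) * ?I))"
      unfolding HS by (intro mult_left_mono tI) auto
    finally have 1: "hausdorff_outer ?d (?G ` A) \<le> ennreal ((1 + e) ^ Suc ?d) * (ennreal c * ?I)"
      unfolding q by (simp add: ac_simps)
    have "ennreal c * ?I \<le> ennreal c * (ennreal (1 + e) * (ennreal t * emeasure lborel A))"
      by (intro mult_left_mono It) auto
    also have "\<dots> = ennreal (1 + e) * hausdorff_outer ?d (?S ` A)"
      unfolding HS by (simp add: ac_simps)
    also have "\<dots> \<le> ennreal (1 + e) * (ennreal ((1 + e) ^ ?d) * hausdorff_outer ?d (?G ` A))"
      using SG A(2) e by (intro mult_left_mono hausdorff_outer_lipschitz) auto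
    finally have 2: "ennreal c * ?I \<le> ennreal ((1 + e) ^ Suc ?d) * hausdorff_outer ?d (?G ` A)"
      unfolding q by (simp add: ac_simps)
    from 1 2 show ?thesis ..
  qed
  moreover have "open V" "x0 \<in> V" "V \<subseteq> U" using r V(4) by (auto simp: V_def)
  ultimately show ?thesis by blast
qed

text \<open>Countably many neighbourhoods from the local estimate cover \<open>U\<close> (Lindelof).
  Cutting a Borel set along them and summing preserves the error factor, which tends to 1 with
  \<open>e\<close>. So Hausdorff measure on the graph is the push-forward of a measure with density
  \<open>c\<close> times the Jacobian. The isometry \<open>\<iota>\<close> allows any coordinate of
  the ambient space as the direction of the graph.\<close>

lemma nn_integral_hausdorff_graph:
  fixes f :: "'b::euclidean_space \<Rightarrow> real" and \<iota> :: "'b \<times> real \<Rightarrow> 'a::euclidean_space"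
  assumes c: "\<And>A. A \<in> sets borel \<Longrightarrow> hausdorff_outer (DIM('b)) (A :: 'b set) = ennreal c * emeasure lborel A"
    and \<iota>: "\<And>p q. dist (\<iota> p) (\<iota> q) = dist p q" "\<And>q. \<iota> (\<pi> q) = q" "\<And>p. \<pi> (\<iota> p) = p"
    and [measurable]: "\<iota> \<in> borel \<rightarrow>\<^sub>M borel" "\<pi> \<in> borel \<rightarrow>\<^sub>M borel"
    and U: "open U" and f: "\<And>x. x \<in> U \<Longrightarrow> (f has_derivative (\<lambda>h. h \<bullet> g x)) (at x)"
    and g: "continuous_on U g"
    and [measurable]: "h \<in> borel_measurable borel"
  shows "(\<lambda>x. \<iota> (x, f x)) ` U \<in> sets borel"
    and "(\<integral>\<^sup>+p. h p * indicator ((\<lambda>x. \<iota> (x, f x)) ` U) p \<partial>hausdorff_measure (DIM('b))) =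
      ennreal c * (\<integral>\<^sup>+x. h (\<iota> (x, f x)) * ennreal (sqrt (1 + (norm (g x))\<^sup>2)) * indicator U x \<partial>lborel)"
proof -
  let ?d = "DIM('b)" and ?G = "\<lambda>x. \<iota> (x, f x)" and ?H = "hausdorff_measure (DIM('b)) :: 'a measure"
  have U' [measurable]: "U \<in> sets borel" using U by simp
  have fc: "continuous_on U f"
    using f has_derivative_continuous by (intro continuous_at_imp_continuous_on ballI) blast
  \<comment> \<open>Extension by 0 off \<open>U\<close> makes the height and the Jacobian Borel on
    the whole space, as \<open>density\<close> and \<open>distr\<close> want.\<close>
  define f' where "f' x = indicator U x *\<^sub>R f x" for x
  define J where "J x = indicator U x *\<^sub>R sqrt (1 + (norm (g x))\<^sup>2)" for x
  have [measurable]: "f' \<in> borel_measurable borel" "J \<in> borel_measurable borel"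
    unfolding f'_def J_def using fc g U'
    by (intro borel_measurable_continuous_on_indicator continuous_intros; simp)+
  have [measurable]: "(\<lambda>q. fst (\<pi> q)) \<in> borel_measurable borel" "(\<lambda>q. snd (\<pi> q)) \<in> borel_measurable borel"
    by (intro measurable_compose[OF \<open>\<pi> \<in> _\<close>] borel_measurable_continuous_onI continuous_intros)+
  have G_borel: "?G ` A \<in> sets borel" if A [measurable]: "A \<in> sets borel" and "A \<subseteq> U" for A
  proof -
    have "?G ` A = {q. fst (\<pi> q) \<in> A \<and> snd (\<pi> q) = f' (fst (\<pi> q))}"
    proof safe
      fix x assume "x \<in> A"
      then show "fst (\<pi> (?G x)) \<in> A" "snd (\<pi> (?G x)) = f' (fst (\<pi> (?G x)))"
        using \<open>A \<subseteq> U\<close> by (auto simp: \<iota> f'_def)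
    next
      fix q assume q: "fst (\<pi> q) \<in> A" "snd (\<pi> q) = f' (fst (\<pi> q))"
      then have "snd (\<pi> q) = f (fst (\<pi> q))" using \<open>A \<subseteq> U\<close> by (auto simp: f'_def)
      then have "?G (fst (\<pi> q)) = \<iota> (\<pi> q)" by (simp flip: \<open>snd (\<pi> q) = f (fst (\<pi> q))\<close>)
      then have "q = ?G (fst (\<pi> q))" by (simp add: \<iota>(2))
      then show "q \<in> ?G ` A" using q(1) by (rule image_eqI)
    qed
    also have "\<dots> \<in> sets borel" by measurable
    finally show ?thesis .
  qed
  then show GU [measurable]: "?G ` U \<in> sets borel" by simp
  have inj: "inj_on ?G U" using \<iota>(3) by (intro inj_onI) (metis fst_conv)
  define N where "N = density lborel (\<lambda>x. ennreal c * ennreal (J x))"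
  have N_eq: "emeasure N A = ennreal c * (\<integral>\<^sup>+x. ennreal (sqrt (1 + (norm (g x))\<^sup>2)) * indicator A x \<partial>lborel)"
    if [measurable]: "A \<in> sets borel" and "A \<subseteq> U" for A
  proof -
    have "emeasure N A = (\<integral>\<^sup>+x. ennreal c * (ennreal (J x) * indicator A x) \<partial>lborel)"
      unfolding N_def by (subst emeasure_density) (auto simp: mult.assoc)
    also have "\<dots> = ennreal c * (\<integral>\<^sup>+x. ennreal (J x) * indicator A x \<partial>lborel)"
      by (rule nn_integral_cmult) measurable
    also have "(\<integral>\<^sup>+x. ennreal (J x) * indicator A x \<partial>lborel) = (\<integral>\<^sup>+x. ennreal (sqrt (1 + (norm (g x))\<^sup>2)) * indicator A x \<partial>lborel)"
      using \<open>A \<subseteq> U\<close> by (intro nn_integral_cong) (auto simp: J_def indicator_def)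
    finally show ?thesis .
  qed
  have main: "hausdorff_outer ?d (?G ` A) = emeasure N A" if A [measurable]: "A \<in> sets borel" and AU: "A \<subseteq> U" for A
  proof -
    have both: "hausdorff_outer ?d (?G ` A) \<le> ennreal ((1 + e) ^ Suc ?d) * emeasure N A \<and>
        emeasure N A \<le> ennreal ((1 + e) ^ Suc ?d) * hausdorff_outer ?d (?G ` A)" if e: "e > 0" for e :: real
    proof -
      define q where "q = ennreal ((1 + e) ^ Suc ?d)"
      define F where "F = {V. open V \<and> V \<subseteq> U \<and> (\<forall>A\<in>sets borel. A \<subseteq> V \<longrightarrow>
          hausdorff_outer ?d (?G ` A) \<le> q * emeasure N A \<and> emeasure N A \<le> q * hausdorff_outer ?d (?G ` A))}"
      have "\<exists>V\<in>F. x \<in> V" if "x \<in> U" for x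
      proof -
        let ?I = "\<lambda>A. \<integral>\<^sup>+x. ennreal (sqrt (1 + (norm (g x))\<^sup>2)) * indicator A x \<partial>lborel"
        have "\<exists>V. open V \<and> x \<in> V \<and> V \<subseteq> U \<and> (\<forall>A\<in>sets borel. A \<subseteq> V \<longrightarrow>
            hausdorff_outer ?d (?G ` A) \<le> q * (ennreal c * ?I A) \<and> ennreal c * ?I A \<le> q * hausdorff_outer ?d (?G ` A))"
          unfolding q_def by (rule hausdorff_outer_graph_local) (use c \<iota>(1) U f g that e in auto)
        then obtain V where V: "open V" "x \<in> V" "V \<subseteq> U" "\<And>A. A \<in> sets borel \<Longrightarrow> A \<subseteq> V \<Longrightarrow>
            hausdorff_outer ?d (?G ` A) \<le> q * (ennreal c * ?I A) \<and> ennreal c * ?I A \<le> q * hausdorff_outer ?d (?G ` A)"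
          by blast
        then have "V \<in> F" unfolding F_def by (auto simp: N_eq)
        then show ?thesis using V(2) by blast
      qed
      then have UF: "\<Union>F = U" by (auto simp: F_def)
      obtain F' where F': "F' \<subseteq> F" "countable F'" "\<Union>F' = U"
        using Lindelof[of F] UF by (auto simp: F_def)
      \<comment> \<open>The empty set is adjoined so that \<open>from_nat_into\<close> enumerates a
        nonempty family even if \<open>U\<close> is empty.\<close>
      have "{} \<in> F" by (auto simp: F_def hausdorff_outer_empty)
      define V where "V = from_nat_into (insert {} F')"
      have rV: "range V = insert {} F'" unfolding V_def using F'(2) by (intro range_from_nat_into) auto
      then have VF: "V i \<in> F" for i using F'(1) \<open>{} \<in> F\<close> by (metis insert_subset range_subsetD)
      have [measurable]: "V i \<in> sets borel" for i using VF[of i] by (auto simp: F_def)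
      then have rVb: "range V \<subseteq> sets borel" by blast
      have UV: "(\<Union>i. V i) = U" using rV F'(3) by simp
      define B where "B i = A \<inter> disjointed V i" for i
      have [measurable]: "B i \<in> sets borel" for i
        using sets.range_disjointed_sets[OF rVb] by (auto simp: B_def)
      have BV: "B i \<subseteq> V i" for i using disjointed_subset[of V i] by (auto simp: B_def)
      have BU: "B i \<subseteq> U" for i using AU by (auto simp: B_def)
      have dB: "disjoint_family B" using disjoint_family_disjointed[of V] by (auto simp: B_def disjoint_family_on_def)
      have AB: "A = (\<Union>i. B i)" unfolding B_def using UN_disjointed_eq[of V] UV AU by blast
      have HA: "hausdorff_outer ?d (?G ` A) = (\<Sum>i. hausdorff_outer ?d (?G ` B i))"
      proof -
        have "hausdorff_outer ?d (?G ` A) = emeasure ?H (\<Union>i. ?G ` B i)"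
          using G_borel[OF A AU] by (simp add: emeasure_hausdorff_measure AB image_UN)
        also have "\<dots> = (\<Sum>i. emeasure ?H (?G ` B i))"
        proof (rule suminf_emeasure[symmetric])
          show "range (\<lambda>i. ?G ` B i) \<subseteq> sets ?H" using G_borel BU by auto
          show "disjoint_family (\<lambda>i. ?G ` B i)"
            using dB inj BU unfolding disjoint_family_on_def by (metis image_empty inj_on_image_Int)
        qed
        also have "\<dots> = (\<Sum>i. hausdorff_outer ?d (?G ` B i))"
          using G_borel BU by (intro suminf_cong emeasure_hausdorff_measure) auto
        finally show ?thesis .
      qed
      have NA: "emeasure N A = (\<Sum>i. emeasure N (B i))"
        unfolding AB using dB by (intro suminf_emeasure[symmetric]) (auto simp: N_def)
      have loc: "hausdorff_outer ?d (?G ` B i) \<le> q * emeasure N (B i)" "emeasure N (B i) \<le> q * hausdorff_outer ?d (?G ` B i)" for i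
        using VF[of i] BV[of i] by (auto simp: F_def)
      have "(\<Sum>i. hausdorff_outer ?d (?G ` B i)) \<le> q * (\<Sum>i. emeasure N (B i))"
        "(\<Sum>i. emeasure N (B i)) \<le> q * (\<Sum>i. hausdorff_outer ?d (?G ` B i))"
        unfolding ennreal_suminf_cmult[symmetric] by (intro suminf_le loc; simp)+
      then show ?thesis
        unfolding HA[symmetric] NA[symmetric] q_def by (rule conjI)
    qed
    show ?thesis
      by (rule antisym; rule ennreal_le_one_plus_power_mult[of _ "Suc ?d"];
          rule both[THEN conjunct1] both[THEN conjunct2])
  qed
  have eq: "density ?H (indicator (?G ` U)) = distr N borel (\<lambda>x. \<iota> (x, f' x))"
  proof (rule measure_eqI)
    fix B :: "'a set" assume "B \<in> sets (density ?H (indicator (?G ` U)))"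
    then have B [measurable]: "B \<in> sets borel" by simp
    define A where "A = (\<lambda>x. \<iota> (x, f' x)) -` B \<inter> U"
    have A [measurable]: "A \<in> sets borel"
      unfolding A_def using measurable_sets[of "\<lambda>x. \<iota> (x, f' x)" borel borel B] by auto
    have "?G ` U \<inter> B = ?G ` A" by (auto simp: A_def f'_def)
    moreover have "?G ` A \<in> sets borel" using G_borel[OF A] by (simp add: A_def)
    ultimately have "emeasure (density ?H (indicator (?G ` U))) B = emeasure ?H (?G ` A)"
      by (subst emeasure_density) (auto simp flip: indicator_inter_arith)
    also have "\<dots> = emeasure N A"
      using main[OF A] G_borel[OF A] by (simp add: emeasure_hausdorff_measure A_def)
    also have "\<dots> = emeasure N ((\<lambda>x. \<iota> (x, f' x)) -` B)"
    proof -
      have v [measurable]: "(\<lambda>x. \<iota> (x, f' x)) -` B \<in> sets borel"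
        using measurable_sets[of "\<lambda>x. \<iota> (x, f' x)" borel borel B] by auto
      show ?thesis
        unfolding N_def by (simp add: emeasure_density)
          (auto intro!: nn_integral_cong simp: A_def J_def indicator_def)
    qed
    also have "\<dots> = emeasure (distr N borel (\<lambda>x. \<iota> (x, f' x))) B"
      by (subst emeasure_distr) (auto simp: N_def)
    finally show "emeasure (density ?H (indicator (?G ` U))) B = emeasure (distr N borel (\<lambda>x. \<iota> (x, f' x))) B" .
  qed simp
  have "(\<integral>\<^sup>+p. h p * indicator (?G ` U) p \<partial>?H) = (\<integral>\<^sup>+p. h p \<partial>density ?H (indicator (?G ` U)))"
    by (subst nn_integral_density) (auto simp: mult.commute)
  also have "\<dots> = (\<integral>\<^sup>+x. h (\<iota> (x, f' x)) \<partial>N)"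
    unfolding eq by (subst nn_integral_distr) (auto simp: N_def)
  also have "\<dots> = (\<integral>\<^sup>+x. ennreal c * (h (\<iota> (x, f' x)) * ennreal (J x)) \<partial>lborel)"
    unfolding N_def by (subst nn_integral_density) (auto simp: ac_simps)
  also have "\<dots> = ennreal c * (\<integral>\<^sup>+x. h (\<iota> (x, f' x)) * ennreal (J x) \<partial>lborel)"
    by (rule nn_integral_cmult) measurable
  also have "(\<integral>\<^sup>+x. h (\<iota> (x, f' x)) * ennreal (J x) \<partial>lborel) =
      (\<integral>\<^sup>+x. h (?G x) * ennreal (sqrt (1 + (norm (g x))\<^sup>2)) * indicator U x \<partial>lborel)"
    by (intro nn_integral_cong) (auto simp: f'_def J_def indicator_def)
  finally show "(\<integral>\<^sup>+p. h p * indicator (?G ` U) p \<partial>?H) =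
      ennreal c * (\<integral>\<^sup>+x. h (?G x) * ennreal (sqrt (1 + (norm (g x))\<^sup>2)) * indicator U x \<partial>lborel)" .
qed

section \<open>Moments of a weighted ball\<close>

lemma borel_measurable_vec_nth [measurable (raw)]:
  fixes f :: "'a \<Rightarrow> complex^'k::finite"
  assumes "f \<in> borel_measurable M"
  shows "(\<lambda>x. f x $ i) \<in> borel_measurable M"
  by (rule measurable_compose[OF assms]) (intro borel_measurable_continuous_onI continuous_intros)

section \<open>Gaussian moments through their generating function\<close>

definition gauss_const :: ennreal where
  "gauss_const = (\<integral>\<^sup>+(x::real). ennreal (exp (- x\<^sup>2)) \<partial>lborel)"

text \<open>Compare with 1 / (1 + x^2), whose primitive is arctan; reflection doubles the
  half-line.\<close>

lemma gauss_const_finite: "gauss_const < top"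
proof -
  have half: "(\<integral>\<^sup>+x. ennreal (exp (- x\<^sup>2)) * indicator {0..} x \<partial>lborel) \<le> ennreal (pi / 2)"
  proof -
    have "(\<integral>\<^sup>+x. ennreal (exp (- x\<^sup>2)) * indicator {0..} x \<partial>lborel) \<le> (\<integral>\<^sup>+x. ennreal (inverse (1 + x\<^sup>2)) * indicator {0..} x \<partial>lborel)"
    proof (intro nn_integral_mono mult_right_mono ennreal_leI)
      fix x :: real
      have "1 + x\<^sup>2 \<le> exp (x\<^sup>2)" by (rule exp_ge_add_one_self)
      then have "inverse (exp (x\<^sup>2)) \<le> inverse (1 + x\<^sup>2)"
        by (intro le_imp_inverse_le) (auto intro: add_pos_nonneg)
      then show "exp (- x\<^sup>2) \<le> inverse (1 + x\<^sup>2)" by (simp add: exp_minus)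
    qed auto
    also have "\<dots> = ennreal (pi / 2 - arctan 0)"
      by (intro nn_integral_FTC_atLeast) (auto intro!: DERIV_arctan tendsto_arctan_at_top)
    finally show ?thesis by simp
  qed
  have "gauss_const \<le> (\<integral>\<^sup>+x. ennreal (exp (- x\<^sup>2)) * indicator {0..} x + ennreal (exp (- x\<^sup>2)) * indicator {0..} (-x) \<partial>lborel)"
    unfolding gauss_const_def by (intro nn_integral_mono) (auto simp: indicator_def)
  also have "\<dots> = (\<integral>\<^sup>+x. ennreal (exp (- x\<^sup>2)) * indicator {0..} x \<partial>lborel) + (\<integral>\<^sup>+x. ennreal (exp (- x\<^sup>2)) * indicator {0..} (-x) \<partial>lborel)"
    by (rule nn_integral_add) auto
  also have "(\<integral>\<^sup>+x. ennreal (exp (- x\<^sup>2)) * indicator {0..} (-x) \<partial>lborel) = (\<integral>\<^sup>+x. ennreal (exp (- x\<^sup>2)) * indicator {0..} x \<partial>lborel)"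
    using nn_integral_lborel_affine[of "\<lambda>x::real. ennreal (exp (- x\<^sup>2)) * indicator {0..} x" "-1" 0] by simp
  also have "(\<integral>\<^sup>+x. ennreal (exp (- x\<^sup>2)) * indicator {0..} x \<partial>lborel) + (\<integral>\<^sup>+x. ennreal (exp (- x\<^sup>2)) * indicator {0..} x \<partial>lborel) \<le> ennreal (pi / 2) + ennreal (pi / 2)"
    by (intro add_mono half)
  finally show ?thesis by (rule order_le_less_trans) simp
qed

lemma gauss_const_pos: "gauss_const > 0"
proof -
  have "ennreal (exp (- 1)) = (\<integral>\<^sup>+x. ennreal (exp (- 1)) * indicator {0..1::real} x \<partial>lborel)"
    by (subst nn_integral_cmult_indicator) auto
  also have "\<dots> \<le> gauss_const"
    unfolding gauss_const_def
    by (intro nn_integral_mono) (auto simp: indicator_def power_le_one intro!: ennreal_leI)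
  finally show ?thesis using exp_gt_zero[of "-1"] by (metis ennreal_less_zero_iff order_less_le_trans)
qed

lemma nn_integral_gauss_scale:
  assumes "c > 0"
  shows "(\<integral>\<^sup>+(x::real). ennreal (exp (- (c * x\<^sup>2))) \<partial>lborel) = ennreal (1 / sqrt c) * gauss_const"
proof -
  have "gauss_const = ennreal (sqrt c) * (\<integral>\<^sup>+(x::real). ennreal (exp (- (c * x\<^sup>2))) \<partial>lborel)"
    unfolding gauss_const_def using assms
    by (subst nn_integral_lborel_affine[where c = "sqrt c" and t = 0]) (auto simp: power_mult_distrib)
  then have "ennreal (1 / sqrt c) * gauss_const = ennreal (1 / sqrt c) * ennreal (sqrt c) * (\<integral>\<^sup>+(x::real). ennreal (exp (- (c * x\<^sup>2))) \<partial>lborel)"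
    by (simp add: mult.assoc)
  also have "ennreal (1 / sqrt c) * ennreal (sqrt c) = 1"
    using assms by (simp flip: ennreal_mult)
  finally show ?thesis by simp
qed

text \<open>The Gaussian factors over the 2k real coordinates. The two real coordinates of z_i carry
  the rate \<open>1 - t\<close> and contribute 1 / sqrt (1 - t) each. As a function of
  \<open>t\<close> this is the generating function of the moments of |z_i|^2.\<close>

lemma nn_integral_gauss_exp_moment:
  fixes i :: "'k::finite"
  assumes t: "t < 1"
  shows "(\<integral>\<^sup>+(z::complex^'k). ennreal (exp (t * (cmod (z $ i))\<^sup>2 - (norm z)\<^sup>2)) \<partial>lborel) =
    ennreal (1 / (1 - t)) * gauss_const ^ (2 * CARD('k))"
proof -
  let ?S = "{axis i 1, axis i \<i>} :: (complex^'k) set"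
  define c where "c b = (if b \<in> ?S then 1 - t else 1)" for b
  have c0: "c b > 0" for b using t by (simp add: c_def)
  have SB: "?S \<subseteq> Basis" by (auto simp: Basis_complex_def)
  have ne: "axis i (1::complex) \<noteq> axis i \<i>" by (simp add: axis_eq_axis)
  have "exp (t * (cmod (z $ i))\<^sup>2 - (norm z)\<^sup>2) = (\<Prod>b\<in>Basis. exp (- (c b * (z \<bullet> b)\<^sup>2)))" for z :: "complex^'k"
  proof -
    have "(\<Sum>b\<in>Basis. c b * (z \<bullet> b)\<^sup>2) = (\<Sum>b\<in>Basis. (z \<bullet> b)\<^sup>2 - (if b \<in> ?S then t * (z \<bullet> b)\<^sup>2 else 0))"
      by (intro sum.cong) (auto simp: c_def algebra_simps)
    also have "\<dots> = (\<Sum>b\<in>Basis. (z \<bullet> b)\<^sup>2) - (\<Sum>b\<in>Basis. if b \<in> ?S then t * (z \<bullet> b)\<^sup>2 else 0)"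
      by (rule sum_subtractf)
    also have "(\<Sum>b\<in>Basis. if b \<in> ?S then t * (z \<bullet> b)\<^sup>2 else 0) = (\<Sum>b\<in>?S. t * (z \<bullet> b)\<^sup>2)"
      using SB by (subst sum.inter_restrict[symmetric]) (auto simp: Int_absorb1)
    also have "\<dots> = t * (cmod (z $ i))\<^sup>2"
      using ne by (simp add: inner_axis cmod_power2 inner_complex_def algebra_simps)
    also have "(\<Sum>b\<in>Basis. (z \<bullet> b)\<^sup>2) = (norm z)\<^sup>2"
      unfolding power2_norm_eq_inner by (subst euclidean_inner) (simp add: power2_eq_square)
    finally show ?thesis
      by (simp add: exp_sum[symmetric] sum_negf)
  qed
  then have "(\<integral>\<^sup>+(z::complex^'k). ennreal (exp (t * (cmod (z $ i))\<^sup>2 - (norm z)\<^sup>2)) \<partial>lborel) =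
      (\<integral>\<^sup>+(z::complex^'k). (\<Prod>b\<in>Basis. ennreal (exp (- (c b * (z \<bullet> b)\<^sup>2)))) \<partial>lborel)"
    by (simp add: prod_ennreal)
  also have "\<dots> = (\<Prod>b\<in>(Basis :: (complex^'k) set). \<integral>\<^sup>+x. ennreal (exp (- (c b * x\<^sup>2))) \<partial>lborel)"
    by (rule nn_integral_lborel_prod) auto
  also have "\<dots> = (\<Prod>b\<in>(Basis :: (complex^'k) set). ennreal (1 / sqrt (c b))) * gauss_const ^ (2 * CARD('k))"
    using c0 by (simp add: nn_integral_gauss_scale prod.distrib mult.commute)
  also have "(\<Prod>b\<in>(Basis :: (complex^'k) set). ennreal (1 / sqrt (c b))) = (\<Prod>b\<in>Basis. if b \<in> ?S then ennreal (1 / sqrt (1 - t)) else 1)"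
    by (intro prod.cong) (auto simp: c_def)
  also have "\<dots> = (\<Prod>b\<in>?S. ennreal (1 / sqrt (1 - t)))"
    using SB by (subst prod.inter_restrict[symmetric]) (auto simp: Int_absorb1)
  also have "\<dots> = ennreal (1 / (1 - t))"
    using ne t by (simp flip: ennreal_mult)
  finally show ?thesis .
qed

definition gauss_moment :: "'k::finite \<Rightarrow> nat \<Rightarrow> ennreal" where
  "gauss_moment i j = (\<integral>\<^sup>+(z::complex^'k). ennreal (cmod (z $ i) ^ (2 * j) * exp (- (norm z)\<^sup>2)) \<partial>lborel)"

lemma gauss_moment_series:
  fixes i :: "'k::finite"
  assumes t: "0 \<le> t" "t < 1"
  shows "(\<Sum>j. ennreal (t ^ j / fact j) * gauss_moment i j) = ennreal (1 / (1 - t)) * gauss_const ^ (2 * CARD('k))"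
proof -
  have "(\<Sum>j. ennreal (t ^ j / fact j) * gauss_moment i j) =
      (\<Sum>j. \<integral>\<^sup>+(z::complex^'k). ennreal (t ^ j / fact j) * ennreal (cmod (z $ i) ^ (2 * j) * exp (- (norm z)\<^sup>2)) \<partial>lborel)"
    unfolding gauss_moment_def by (intro suminf_cong nn_integral_cmult[symmetric]) measurable
  also have "\<dots> = (\<integral>\<^sup>+(z::complex^'k). (\<Sum>j. ennreal (t ^ j / fact j) * ennreal (cmod (z $ i) ^ (2 * j) * exp (- (norm z)\<^sup>2))) \<partial>lborel)"
    by (rule nn_integral_suminf[symmetric]) measurable
  also have "\<dots> = (\<integral>\<^sup>+(z::complex^'k). ennreal (exp (t * (cmod (z $ i))\<^sup>2 - (norm z)\<^sup>2)) \<partial>lborel)"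
  proof (rule nn_integral_cong)
    fix z :: "complex^'k"
    have "(\<lambda>j. (t * (cmod (z $ i))\<^sup>2) ^ j /\<^sub>R fact j * exp (- (norm z)\<^sup>2)) sums (exp (t * (cmod (z $ i))\<^sup>2) * exp (- (norm z)\<^sup>2))"
      by (intro sums_mult2 exp_converges)
    then have "(\<Sum>j. ennreal ((t * (cmod (z $ i))\<^sup>2) ^ j /\<^sub>R fact j * exp (- (norm z)\<^sup>2))) = ennreal (exp (t * (cmod (z $ i))\<^sup>2) * exp (- (norm z)\<^sup>2))"
      using t by (intro suminf_ennreal_eq) auto
    moreover have "ennreal (t ^ j / fact j) * ennreal (cmod (z $ i) ^ (2 * j) * exp (- (norm z)\<^sup>2)) = ennreal ((t * (cmod (z $ i))\<^sup>2) ^ j /\<^sub>R fact j * exp (- (norm z)\<^sup>2))" for j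
      using t unfolding power_mult[of "cmod (z $ i)" 2 j]
      by (subst ennreal_mult[symmetric]) (auto simp: power_mult_distrib divide_inverse mult_ac)
    ultimately show "(\<Sum>j. ennreal (t ^ j / fact j) * ennreal (cmod (z $ i) ^ (2 * j) * exp (- (norm z)\<^sup>2))) = ennreal (exp (t * (cmod (z $ i))\<^sup>2 - (norm z)\<^sup>2))"
      by (simp add: exp_diff exp_minus divide_inverse)
  qed
  also have "\<dots> = ennreal (1 / (1 - t)) * gauss_const ^ (2 * CARD('k))"
    by (rule nn_integral_gauss_exp_moment[OF t(2)])
  finally show ?thesis .
qed

text \<open>The moments divided by j! and the coefficients of a multiple of the geometric series
  generate the same function, so they agree by uniqueness of power series.\<close>

lemma gauss_moment_eq:
  fixes i :: "'k::finite"
  shows "gauss_moment i j = ennreal (fact j) * gauss_const ^ (2 * CARD('k))"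
proof -
  define g where "g = enn2real (gauss_const ^ (2 * CARD('k)))"
  have g: "gauss_const ^ (2 * CARD('k)) = ennreal g"
    unfolding g_def using gauss_const_finite by (simp add: power_less_top_ennreal)
  have g0: "g \<ge> 0" by (simp add: g_def)
  have fin: "gauss_moment i j < top" for j
  proof -
    \<comment> \<open>A term of a series of nonnegative terms is at most its sum; \<open>1/2\<close>
      is just a point of (0, 1) where the sum is finite.\<close>
    have "ennreal ((1/2) ^ j / fact j) * gauss_moment i j \<le> (\<Sum>j. ennreal ((1/2) ^ j / fact j) * gauss_moment i j)"
      using sum_le_suminf[of "\<lambda>j. ennreal ((1/2) ^ j / fact j) * gauss_moment i j" "{j}"] by simp
    also have "\<dots> < top"
      by (subst gauss_moment_series) (auto simp: g ennreal_mult_less_top)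
    finally show ?thesis by (auto simp: ennreal_mult_less_top)
  qed
  define a where "a j = enn2real (gauss_moment i j) / fact j" for j
  have a: "gauss_moment i j = ennreal (fact j * a j)" and a0: "a j \<ge> 0" for j
    using fin[of j] by (simp_all add: a_def)
  have "(\<lambda>j. a j * t ^ j) sums (g / (1 - t))" if t: "0 \<le> t" "t < 1" for t
  proof -
    have "(\<Sum>j. ennreal (a j * t ^ j)) = (\<Sum>j. ennreal (t ^ j / fact j) * gauss_moment i j)"
      using t a0 by (intro suminf_cong) (simp add: a mult.commute flip: ennreal_mult)
    also have "\<dots> = ennreal (g / (1 - t))"
      using t g0 by (simp add: gauss_moment_series g flip: ennreal_mult)
    finally have *: "(\<Sum>j. ennreal (a j * t ^ j)) = ennreal (g / (1 - t))" .
    have nn: "0 \<le> a j * t ^ j" for j using t(1) a0 by simp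
    have sm: "summable (\<lambda>j. a j * t ^ j)"
      by (rule summable_suminf_not_top[OF nn]) (simp add: *)
    moreover have "(\<Sum>j. a j * t ^ j) = g / (1 - t)"
    proof -
      have "ennreal (\<Sum>j. a j * t ^ j) = ennreal (g / (1 - t))"
        using * unfolding suminf_ennreal2[OF nn sm] .
      moreover have "0 \<le> g / (1 - t)" using t g0 by simp
      ultimately show ?thesis
        using suminf_nonneg[OF sm nn] by (simp only: ennreal_inj)
    qed
    ultimately show ?thesis by (simp add: sums_iff)
  qed
  then have sa: "(\<lambda>j. (a j - g) * t ^ j) sums 0" if "0 \<le> t" "t < 1" for t
    using sums_diff[OF _ sums_mult[OF geometric_sums[of t], of g], of "\<lambda>j. a j * t ^ j" "g / (1 - t)"] that
    by (simp add: algebra_simps)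
  have "a m - g = 0" for m
  proof (rule ccontr)
    assume ne: "a m - g \<noteq> 0"
    \<comment> \<open>The identity is known only for real t in [0, 1), but these accumulate at 0,
      where the zeros of a nonzero power series are isolated. \<open>powser_0_nonzero\<close> asks
      for a nonzero coefficient of positive index, so index 0 is settled separately.\<close>
    have "a 0 - g = 0" using sa[of 0] powser_sums_zero[of "\<lambda>j. a j - g"] sums_unique2 by force
    then have "m > 0" using ne by (cases m) auto
    define f where "f x = (\<Sum>j. (a j - g) * (x - 0) ^ j)" for x
    have sm: "(\<lambda>j. (a j - g) * (x - 0) ^ j) sums f x" if "norm (x - 0) < 1/2" for x
      using powser_inside[of "\<lambda>j. a j - g" "1/2" x] sums_summable[OF sa[of "1/2"]] that
      unfolding f_def by (simp add: summable_sums)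
    have f0: "f x = 0" if "0 \<le> x" "x < 1" for x
      unfolding f_def using sums_unique[OF sa[OF that]] by simp
    obtain s where "0 < s" "\<And>z. z \<in> cball 0 s - {0} \<Longrightarrow> f z \<noteq> 0"
      by (rule powser_0_nonzero[OF half_gt_zero[OF zero_less_one] sm f0[OF order_refl zero_less_one] ne \<open>m > 0\<close>]) (assumption, rule that, blast, blast)
    then have "f (min s (1/2)) \<noteq> 0" by auto
    then show False using f0[of "min s (1/2)"] \<open>0 < s\<close> by auto
  qed
  then have "a j = g" by simp
  then show ?thesis using g0 by (simp add: a g flip: ennreal_mult)
qed

section \<open>Moments of the unit ball\<close>

definition ball_moment :: "real \<Rightarrow> 'k::finite \<Rightarrow> nat \<Rightarrow> ennreal" where
  "ball_moment \<alpha> i j = (\<integral>\<^sup>+(z::complex^'k). ennreal (cmod (z $ i) ^ (2 * j) * (1 - (norm z)\<^sup>2) powr \<alpha>) * indicator (ball 0 1) z \<partial>lborel)"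

lemma nn_integral_Gamma:
  assumes "s > 0"
  shows "(\<integral>\<^sup>+t. ennreal (exp (- t) * t powr (s - 1)) * indicator {0<..} t \<partial>lborel) = ennreal (Gamma s)"
  unfolding Gamma_conv_nn_integral_real[OF assms]
  by (intro nn_integral_cong) (auto simp: indicator_def exp_minus field_simps)

text \<open>Integrate \<open>exp (- t) \<bar>z i\<bar>^(2 j) (t - \<bar>z\<bar>\<^sup>2)^\<alpha>\<close> over \<open>t > \<bar>z\<bar>\<^sup>2\<close>: in one order
  the inner integral is a Gamma function and leaves a Gaussian moment, in the other
  the substitution \<open>z = sqrt t z'\<close> leaves a ball moment.\<close>

lemma ball_moment_eq:
  fixes i :: "'k::finite"
  assumes \<alpha>: "\<alpha> > -1"
  shows "ennreal (Gamma (real CARD('k) + j + \<alpha> + 1)) * ball_moment \<alpha> i j = ennreal (Gamma (\<alpha> + 1)) * gauss_moment i j"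
proof -
  define F where "F t z = ennreal (exp (- t) * cmod (z $ i) ^ (2 * j) * (t - (norm z)\<^sup>2) powr \<alpha>) * indicator {0<..} (t - (norm z)\<^sup>2)"
    for t :: real and z :: "complex^'k"
  have [measurable]: "(\<lambda>(z, t). F t z) \<in> borel_measurable (lborel \<Otimes>\<^sub>M lborel)"
    unfolding F_def by measurable
  have inner_t: "(\<integral>\<^sup>+t. F t z \<partial>lborel) = ennreal (Gamma (\<alpha> + 1)) * ennreal (cmod (z $ i) ^ (2 * j) * exp (- (norm z)\<^sup>2))" for z
  proof -
    have "(\<integral>\<^sup>+t. F t z \<partial>lborel) = (\<integral>\<^sup>+t. F ((norm z)\<^sup>2 + t) z \<partial>lborel)"
      by (subst nn_integral_lborel_affine[where c = 1 and t = "(norm z)\<^sup>2"]) (auto simp: F_def)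
    also have "\<dots> = (\<integral>\<^sup>+t. ennreal (cmod (z $ i) ^ (2 * j) * exp (- (norm z)\<^sup>2)) * (ennreal (exp (- t) * t powr (\<alpha> + 1 - 1)) * indicator {0<..} t) \<partial>lborel)"
      by (intro nn_integral_cong)
        (auto simp: F_def indicator_def exp_diff exp_minus field_simps simp flip: ennreal_mult)
    also have "\<dots> = ennreal (cmod (z $ i) ^ (2 * j) * exp (- (norm z)\<^sup>2)) * ennreal (Gamma (\<alpha> + 1))"
      using \<alpha> nn_integral_Gamma[of "\<alpha> + 1"] by (subst nn_integral_cmult) auto
    finally show ?thesis by (simp add: mult.commute)
  qed
  have inner_z: "(\<integral>\<^sup>+z. F t z \<partial>lborel) = ball_moment \<alpha> i j * (ennreal (exp (- t) * t powr (real CARD('k) + j + \<alpha> + 1 - 1)) * indicator {0<..} t)" for t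
  proof (cases "t > 0")
    case False
    then have "F t z = 0" for z by (auto simp: F_def indicator_def not_less intro: order_trans)
    then show ?thesis using False by simp
  next
    case True
    have [measurable]: "ball (0 :: complex^'k) 1 \<in> sets borel" by simp
    let ?A = "\<lambda>z::complex^'k. ennreal (cmod (z $ i) ^ (2 * j) * (1 - (norm z)\<^sup>2) powr \<alpha>) * indicator (ball 0 1) z"
    \<comment> \<open>The scaling contributes t^k from the volume in real dimension 2k, t^j from
      |z_i|^(2j) and t^\<alpha> from the weight. Together with exp (- t) this is the integrand of
      Gamma (k + j + \<alpha> + 1).\<close>
    have "(\<integral>\<^sup>+z. F t z \<partial>lborel) = ennreal (sqrt t ^ (2 * CARD('k))) * (\<integral>\<^sup>+z. F t (sqrt t *\<^sub>R z) \<partial>lborel)"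
      using True by (subst nn_integral_lborel_affine[where c = "sqrt t" and t = 0]) (auto simp: F_def mult.commute)
    also have "(\<lambda>z. F t (sqrt t *\<^sub>R z)) = (\<lambda>z. ennreal (exp (- t) * t powr (real j + \<alpha>)) * ?A z)"
    proof
      fix z :: "complex^'k"
      have *: "t - (norm (sqrt t *\<^sub>R z))\<^sup>2 = t * (1 - (norm z)\<^sup>2)"
        using True by (simp add: power_mult_distrib algebra_simps)
      have ball: "z \<in> ball 0 1 \<longleftrightarrow> 0 < 1 - (norm z)\<^sup>2"
        by (simp add: abs_square_less_1)
      have "cmod ((sqrt t *\<^sub>R z) $ i) ^ (2 * j) = t powr real j * cmod (z $ i) ^ (2 * j)"
        using True by (simp add: power_mult power_mult_distrib powr_realpow norm_mult)
      then have "exp (- t) * cmod ((sqrt t *\<^sub>R z) $ i) ^ (2 * j) * (t * (1 - (norm z)\<^sup>2)) powr \<alpha> =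
          (exp (- t) * t powr (real j + \<alpha>)) * (cmod (z $ i) ^ (2 * j) * (1 - (norm z)\<^sup>2) powr \<alpha>)" if "z \<in> ball 0 1"
        using that True unfolding ball by (simp add: powr_mult powr_add)
      then show "F t (sqrt t *\<^sub>R z) = ennreal (exp (- t) * t powr (real j + \<alpha>)) * ?A z"
        unfolding F_def * using True ball
        by (auto simp: indicator_def zero_less_mult_iff simp flip: ennreal_mult)
    qed
    also have "(\<integral>\<^sup>+z. ennreal (exp (- t) * t powr (real j + \<alpha>)) * ?A z \<partial>lborel) = ennreal (exp (- t) * t powr (real j + \<alpha>)) * ball_moment \<alpha> i j"
      unfolding ball_moment_def by (rule nn_integral_cmult) measurable
    also have "ennreal (sqrt t ^ (2 * CARD('k))) * (ennreal (exp (- t) * t powr (real j + \<alpha>)) * ball_moment \<alpha> i j) =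
        ball_moment \<alpha> i j * ennreal (exp (- t) * t powr (real CARD('k) + j + \<alpha> + 1 - 1))"
    proof -
      have "sqrt t ^ (2 * CARD('k)) = t powr real CARD('k)"
        using True by (simp add: power_mult powr_realpow)
      then have "sqrt t ^ (2 * CARD('k)) * (exp (- t) * t powr (real j + \<alpha>)) = exp (- t) * t powr (real CARD('k) + j + \<alpha> + 1 - 1)"
        by (simp add: powr_add)
      then have "ennreal (sqrt t ^ (2 * CARD('k))) * ennreal (exp (- t) * t powr (real j + \<alpha>)) = ennreal (exp (- t) * t powr (real CARD('k) + j + \<alpha> + 1 - 1))"
        using True by (subst ennreal_mult[symmetric]) auto
      then show ?thesis by (metis mult.assoc mult.commute)
    qed
    finally show ?thesis using True by simp
  qed
  have "ennreal (Gamma (\<alpha> + 1)) * gauss_moment i j = (\<integral>\<^sup>+z. \<integral>\<^sup>+t. F t z \<partial>lborel \<partial>lborel)"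
    unfolding inner_t gauss_moment_def by (rule nn_integral_cmult[symmetric]) measurable
  also have "\<dots> = (\<integral>\<^sup>+t. \<integral>\<^sup>+z. F t z \<partial>lborel \<partial>lborel)"
    by (rule lborel_pair.Fubini'[symmetric]) measurable
  also have "\<dots> = ball_moment \<alpha> i j * ennreal (Gamma (real CARD('k) + j + \<alpha> + 1))"
    unfolding inner_z using \<alpha> nn_integral_Gamma[of "real CARD('k) + j + \<alpha> + 1"] by (subst nn_integral_cmult) auto
  finally show ?thesis by (simp add: mult.commute)
qed

text \<open>Solves the Gamma identity for the ball moment. The point is that one \<open>C\<close>
  serves all \<open>i\<close> and \<open>j\<close>: the dependence on \<open>j\<close> has to match
  the binomial coefficients of the kernel exactly.\<close>

lemma ball_moment_formula:
  assumes \<alpha>: "\<alpha> > -1"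
  shows "\<exists>C>0. \<forall>(i::'k::finite) j. ball_moment \<alpha> i j = ennreal (C * fact j / Gamma (real CARD('k) + \<alpha> + 1 + j))"
proof -
  define g where "g = enn2real (gauss_const ^ (2 * CARD('k)))"
  have g: "gauss_const ^ (2 * CARD('k)) = ennreal g"
    unfolding g_def using gauss_const_finite by (simp add: power_less_top_ennreal)
  have "gauss_const ^ (2 * CARD('k)) \<noteq> 0" using gauss_const_pos by auto
  then have g0: "g > 0" unfolding g by (simp add: ennreal_eq_0_iff)
  have "ball_moment \<alpha> i j = ennreal (Gamma (\<alpha> + 1) * g * fact j / Gamma (real CARD('k) + \<alpha> + 1 + j))" for i :: 'k and j
  proof -
    have G: "Gamma (real CARD('k) + \<alpha> + 1 + j) > 0" "Gamma (\<alpha> + 1) > 0"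
      using \<alpha> by (intro Gamma_real_pos; simp add: add_nonneg_pos add_pos_nonneg)+
    have "ennreal (Gamma (real CARD('k) + \<alpha> + 1 + j)) * ball_moment \<alpha> i j = ennreal (Gamma (\<alpha> + 1) * g * fact j)"
      using ball_moment_eq[OF \<alpha>, of j i] g0 G unfolding gauss_moment_eq g
      by (simp add: ac_simps flip: ennreal_mult)
    then have "ennreal (1 / Gamma (real CARD('k) + \<alpha> + 1 + j)) * (ennreal (Gamma (real CARD('k) + \<alpha> + 1 + j)) * ball_moment \<alpha> i j) =
        ennreal (1 / Gamma (real CARD('k) + \<alpha> + 1 + j)) * ennreal (Gamma (\<alpha> + 1) * g * fact j)" by simp
    then show ?thesis
      using G g0 by (simp add: mult.assoc[symmetric] flip: ennreal_mult)
  qed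
  moreover have "Gamma (\<alpha> + 1) * g > 0" using g0 \<alpha> by (intro mult_pos_pos Gamma_real_pos) auto
  ultimately show ?thesis by (intro exI[of _ "Gamma (\<alpha> + 1) * g"] conjI allI)
qed

section \<open>The boundary of the domain and its Fefferman density\<close>

text \<open>Only the identity survives in the Leibniz sum: row \<open>None\<close> forces
  \<open>p None = None\<close>, and then row \<open>Some j\<close> has only its diagonal entry left,
  as column \<open>None\<close> is taken.\<close>

lemma det_lower_arrowhead:
  fixes B :: "complex ^ 'b::finite option ^ 'b option"
  assumes B: "\<And>l. B $ None $ Some l = 0" "\<And>j l. j \<noteq> l \<Longrightarrow> B $ Some j $ Some l = 0"
  shows "det B = B $ None $ None * (\<Prod>j\<in>UNIV. B $ Some j $ Some j)"
proof -
  let ?P = "{p. p permutes (UNIV :: 'b option set)}"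
  have "(\<Sum>p\<in>?P. of_int (sign p) * (\<Prod>a\<in>UNIV. B $ a $ p a)) = (\<Sum>p\<in>{id}. of_int (sign p) * (\<Prod>a\<in>UNIV. B $ a $ p a))"
  proof (rule sum.mono_neutral_right)
    show "\<forall>p\<in>?P - {id}. of_int (sign p) * (\<Prod>a\<in>UNIV. B $ a $ p a) = 0"
    proof
      fix p assume "p \<in> ?P - {id}"
      then have p: "p permutes (UNIV :: 'b option set)" "p \<noteq> id" by auto
      have "\<exists>a. B $ a $ p a = 0"
      proof (rule ccontr)
        assume nz: "\<nexists>a. B $ a $ p a = 0"
        have N: "p None = None" using B(1) nz by (cases "p None") metis+
        have "p (Some j) = Some j" for j
        proof (cases "p (Some j)")
          case None
          then have "p (Some j) = p None" using N by simp
          then show ?thesis using permutes_inj[OF p(1)] by (simp add: inj_eq)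
        next
          case (Some l)
          then show ?thesis using B(2)[of j l] nz by metis
        qed
        then have "p a = id a" for a using N by (cases a) simp_all
        then show False using p(2) by blast
      qed
      then have "(\<Prod>a\<in>UNIV. B $ a $ p a) = 0" by (intro prod_zero) auto
      then show "of_int (sign p) * (\<Prod>a\<in>UNIV. B $ a $ p a) = 0" by simp
    qed
  qed (auto simp: finite_permutations permutes_id)
  then show ?thesis
    by (simp add: det_def sign_id UNIV_option_conv prod.reindex)
qed

text \<open>Clearing the top row with the diagonal rows leaves the Schur complement in the
  corner.\<close>

lemma det_arrowhead:
  fixes A :: "complex ^ 'b::finite option ^ 'b option"
  assumes d: "\<And>j. A $ Some j $ Some j \<noteq> 0" and A: "\<And>j l. j \<noteq> l \<Longrightarrow> A $ Some j $ Some l = 0"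
  shows "det A = (A $ None $ None - (\<Sum>j\<in>UNIV. A $ None $ Some j * A $ Some j $ None / A $ Some j $ Some j))
    * (\<Prod>j\<in>UNIV. A $ Some j $ Some j)"
proof -
  define v where "v = (\<Sum>j\<in>UNIV. (- (A $ None $ Some j / A $ Some j $ Some j)) *s row (Some j) A)"
  define B where "B = (\<chi> k. if k = None then row None A + v else row k A)"
  have "v \<in> vec.span {row j A |j. j \<noteq> None}"
    unfolding v_def by (intro vec.span_sum vec.span_scale vec.span_base) auto
  then have "det A = det B"
    unfolding B_def by (rule det_row_span[symmetric])
  also have "det B = B $ None $ None * (\<Prod>j\<in>UNIV. B $ Some j $ Some j)"
  proof (rule det_lower_arrowhead)
    fix l
    have "v $ Some l = (\<Sum>j\<in>UNIV. - (A $ None $ Some j / A $ Some j $ Some j) * A $ Some j $ Some l)"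
      by (simp add: v_def row_def)
    also have "\<dots> = (\<Sum>j\<in>UNIV. if j = l then - (A $ None $ Some l) else 0)"
      using A d by (intro sum.cong) auto
    finally show "B $ None $ Some l = 0" by (simp add: B_def row_def)
  next
    fix j l :: 'b assume "j \<noteq> l"
    then show "B $ Some j $ Some l = 0" by (simp add: B_def row_def A)
  qed
  also have "B $ None $ None = A $ None $ None - (\<Sum>j\<in>UNIV. A $ None $ Some j * A $ Some j $ None / A $ Some j $ Some j)"
    by (simp add: B_def v_def row_def sum_negf)
  also have "(\<Prod>j\<in>UNIV. B $ Some j $ Some j) = (\<Prod>j\<in>UNIV. A $ Some j $ Some j)"
    by (simp add: B_def row_def)
  finally show ?thesis .
qed

section \<open>Defining function, closure and frontier of the domain\<close>

lemma egg_rho_eq: "egg_rho m p = (norm (fst p))\<^sup>2 + norm (snd p) ^ (2 * m) - 1"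
  by (simp add: egg_rho_def split: prod.split)

lemma continuous_egg_rho: "continuous_on A (egg_rho m)"
  unfolding egg_rho_eq[abs_def] by (intro continuous_intros)

lemma egg_eq: "egg m = {p. egg_rho m p < 0}"
  by (auto simp: egg_def egg_rho_eq)

lemma closed_egg_rho_le: "closed {p :: 'k::finite cspace. egg_rho m p \<le> 0}"
  by (rule closed_Collect_le) (auto intro: continuous_egg_rho)

text \<open>The domain is star-shaped about 0 in the strict sense, since both \<open>t ^ 2\<close>
  and \<open>t ^ (2 * m)\<close> are at most \<open>t\<close>. Points with
  \<open>egg_rho m p = 0\<close> are thus limits of interior points, which identifies closure and
  frontier.\<close>

lemma egg_rho_scale_less:
  assumes "m \<ge> 1" "0 \<le> t" "t < 1" "egg_rho m p \<le> 0"
  shows "egg_rho m (t *\<^sub>R p) < 0"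
proof -
  have "t\<^sup>2 \<le> t" using assms by (simp add: power2_eq_square mult_left_le_one_le)
  moreover have "t ^ (2 * m) \<le> t" using assms power_decreasing[of 1 "2 * m" t] by simp
  ultimately have "t\<^sup>2 * (norm (fst p))\<^sup>2 + t ^ (2 * m) * norm (snd p) ^ (2 * m)
      \<le> t * (norm (fst p))\<^sup>2 + t * norm (snd p) ^ (2 * m)"
    by (intro add_mono mult_right_mono) auto
  also have "\<dots> = t * (egg_rho m p + 1)" by (simp add: egg_rho_eq algebra_simps)
  also have "\<dots> \<le> t * 1" using assms by (intro mult_left_mono) auto
  finally show ?thesis using assms by (simp add: egg_rho_eq power_mult_distrib)
qed

lemma closure_egg:
  assumes "m \<ge> 1"
  shows "closure (egg m) = {p :: 'k::finite cspace. egg_rho m p \<le> 0}"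
proof
  show "closure (egg m) \<subseteq> {p :: 'k cspace. egg_rho m p \<le> 0}"
    by (rule closure_minimal) (auto simp: egg_eq closed_egg_rho_le)
  show "{p :: 'k cspace. egg_rho m p \<le> 0} \<subseteq> closure (egg m)"
  proof
    fix p :: "'k cspace" assume p: "p \<in> {p. egg_rho m p \<le> 0}"
    have "(\<lambda>n. (real n / real (Suc n)) *\<^sub>R p) \<longlonglongrightarrow> 1 *\<^sub>R p"
      by (intro tendsto_intros LIMSEQ_n_over_Suc_n)
    then have lim: "(\<lambda>n. (real n / real (Suc n)) *\<^sub>R p) \<longlonglongrightarrow> p" by (simp only: scaleR_one)
    have mem: "(real n / real (Suc n)) *\<^sub>R p \<in> egg m" for n
      using p unfolding egg_eq by (auto intro!: egg_rho_scale_less[OF assms])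
    show "p \<in> closure (egg m)"
      unfolding closure_sequential by (intro exI conjI allI) (rule mem, rule lim)
  qed
qed

lemma frontier_egg:
  assumes "m \<ge> 1"
  shows "frontier (egg m) = {p :: 'k::finite cspace. egg_rho m p = 0}"
proof -
  have op: "open (egg m :: 'k cspace set)"
    unfolding egg_eq by (intro open_Collect_less) (auto intro: continuous_egg_rho)
  show ?thesis
    unfolding frontier_def interior_open[OF op] closure_egg[OF assms] by (auto simp: egg_eq)
qed

text \<open>Writing |w|^(2m) as the m-th power of an inner product makes it a polynomial in the real
  coordinates, so the formula covers w = 0 as well.\<close>

lemma egg_rho_has_derivative:
  "(egg_rho m has_derivative (\<lambda>h. h \<bullet> (2 *\<^sub>R fst p, (2 * real m * (norm (snd p))\<^sup>2 ^ (m - 1)) *\<^sub>R snd p))) (at p)"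
proof -
  have "egg_rho m = (\<lambda>p. fst p \<bullet> fst p + (snd p \<bullet> snd p) ^ m - 1)"
    by (simp add: egg_rho_eq[abs_def] power_mult power2_norm_eq_inner)
  show ?thesis
    unfolding \<open>egg_rho m = _\<close> power2_norm_eq_inner
    by (auto intro!: derivative_eq_intros ext simp: inner_prod_def inner_commute algebra_simps)
qed

lemma norm_gradient_egg_rho:
  "norm (gradient (egg_rho m) p) = 2 * sqrt ((norm (fst p))\<^sup>2 + (real m)\<^sup>2 * ((norm (snd p))\<^sup>2 ^ (m - 1))\<^sup>2 * (norm (snd p))\<^sup>2)"
proof -
  let ?D = "(2 *\<^sub>R fst p, (2 * real m * (norm (snd p))\<^sup>2 ^ (m - 1)) *\<^sub>R snd p)"
  have "gradient (egg_rho m) p = ?D"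
    unfolding gradient_def
  proof (rule the_equality)
    show "GDERIV (egg_rho m) p :> ?D" using egg_rho_has_derivative by (simp only: gderiv_def)
    fix D assume "GDERIV (egg_rho m) p :> D"
    then have "(\<lambda>h. h \<bullet> D) = (\<lambda>h. h \<bullet> ?D)"
      using egg_rho_has_derivative unfolding gderiv_def by (rule has_derivative_unique)
    then show "D = ?D" by (metis inner_commute vector_eq_ldot)
  qed
  moreover have "norm ?D = sqrt (4 * ((norm (fst p))\<^sup>2 + (real m)\<^sup>2 * ((norm (snd p))\<^sup>2 ^ (m - 1))\<^sup>2 * (norm (snd p))\<^sup>2))"
    by (simp add: norm_Pair power_mult_distrib algebra_simps)
  moreover have "sqrt (4 * x) = 2 * sqrt x" for x :: real by (simp add: real_sqrt_mult)
  ultimately show ?thesis by (simp only:)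
qed

section \<open>Wirtinger derivatives and the bordered Hessian\<close>

lemma wirt_eqI:
  assumes "(f has_derivative D) (at p)"
  shows "wirt a f p = (D (cbasis a) - \<i> * D (cscale \<i> (cbasis a))) / 2"
    and "wirt_bar a f p = (D (cbasis a) + \<i> * D (cscale \<i> (cbasis a))) / 2"
  using frechet_derivative_at[OF assms] by (simp_all add: wirt_def wirt_bar_def)

text \<open>As a polynomial in the coordinates and their conjugates, rho is differentiated by the
  product rule, and the Wirtinger derivatives can be read off.\<close>

lemma of_real_egg_rho:
  "complex_of_real (egg_rho m p) = (\<Sum>j\<in>UNIV. fst p $ j * cnj (fst p $ j)) + (snd p * cnj (snd p)) ^ m - 1"
proof -
  have "(norm (fst p))\<^sup>2 = (\<Sum>j\<in>UNIV. (cmod (fst p $ j))\<^sup>2)"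
    by (simp add: norm_vec_def L2_set_def sum_nonneg)
  then show ?thesis
    by (simp add: egg_rho_eq power_mult complex_norm_square[symmetric])
qed

lemma of_real_egg_rho_has_derivative:
  "((\<lambda>x. complex_of_real (egg_rho m x)) has_derivative
      (\<lambda>h. (\<Sum>j\<in>UNIV. fst h $ j * cnj (fst p $ j) + fst p $ j * cnj (fst h $ j))
        + of_nat m * (snd p * cnj (snd p)) ^ (m - 1) * (snd h * cnj (snd p) + snd p * cnj (snd h)))) (at p)"
proof -
  have "bounded_linear (\<lambda>x :: 'a cspace. fst x $ j)" for j
    by (intro bounded_linear_compose[OF bounded_linear_vec_nth] bounded_linear_fst)
  note [derivative_intros] = this[THEN bounded_linear_imp_has_derivative]
  have "((\<lambda>x :: 'a cspace. \<Sum>j\<in>UNIV. fst x $ j * cnj (fst x $ j)) has_derivative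
      (\<lambda>h. \<Sum>j\<in>UNIV. fst h $ j * cnj (fst p $ j) + fst p $ j * cnj (fst h $ j))) (at p)"
    by (auto intro!: derivative_eq_intros ext sum.cong simp: algebra_simps)
  moreover have "((\<lambda>x :: 'a cspace. snd x * cnj (snd x)) has_derivative
      (\<lambda>h. snd h * cnj (snd p) + snd p * cnj (snd h))) (at p)"
    by (auto intro!: derivative_eq_intros ext simp: algebra_simps)
  ultimately show ?thesis
    unfolding of_real_egg_rho
    by (rule has_derivative_eq_rhs[OF has_derivative_diff[OF has_derivative_add[OF _ has_derivative_power] has_derivative_const]])
      (simp add: mult_ac)
qed

lemma sum_axis_mult_cnj:
  fixes c :: "'k::finite \<Rightarrow> complex"
  shows "(\<Sum>l\<in>UNIV. axis j x $ l * cnj (c l) + c l * cnj (axis j x $ l)) = x * cnj (c j) + c j * cnj x"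
proof -
  have "(\<Sum>l\<in>UNIV. axis j x $ l * cnj (c l) + c l * cnj (axis j x $ l)) =
      (\<Sum>l\<in>UNIV. if l = j then x * cnj (c j) + c j * cnj x else 0)"
    by (intro sum.cong) (auto simp: axis_def)
  then show ?thesis by simp
qed

lemma cscale_cbasis:
  "cbasis (Some j) = (axis j 1, 0)" "cbasis None = (0, 1)"
  "cscale c (axis j 1, 0) = (axis j c, 0)" "cscale c (0, 1) = (0, c)"
  by (auto simp: cscale_def cbasis_def vec_eq_iff axis_def)

lemma wirt_egg_rho:
  fixes p :: "'k::finite cspace"
  shows "wirt (Some j) (\<lambda>x. complex_of_real (egg_rho m x)) p = cnj (fst p $ j)"
    "wirt_bar (Some j) (\<lambda>x. complex_of_real (egg_rho m x)) p = fst p $ j"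
    "wirt None (\<lambda>x. complex_of_real (egg_rho m x)) p = of_nat m * (snd p * cnj (snd p)) ^ (m - 1) * cnj (snd p)"
    "wirt_bar None (\<lambda>x. complex_of_real (egg_rho m x)) p = of_nat m * (snd p * cnj (snd p)) ^ (m - 1) * snd p"
proof -
  show "wirt (Some j) (\<lambda>x. complex_of_real (egg_rho m x)) p = cnj (fst p $ j)"
    "wirt_bar (Some j) (\<lambda>x. complex_of_real (egg_rho m x)) p = fst p $ j"
    unfolding wirt_eqI[OF of_real_egg_rho_has_derivative] cscale_cbasis fst_conv snd_conv sum_axis_mult_cnj
    by (simp_all add: algebra_simps)
  define A where "A = of_nat m * (snd p * cnj (snd p)) ^ (m - 1)"
  show "wirt None (\<lambda>x. complex_of_real (egg_rho m x)) p = of_nat m * (snd p * cnj (snd p)) ^ (m - 1) * cnj (snd p)"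
    "wirt_bar None (\<lambda>x. complex_of_real (egg_rho m x)) p = of_nat m * (snd p * cnj (snd p)) ^ (m - 1) * snd p"
    unfolding wirt_eqI[OF of_real_egg_rho_has_derivative] cscale_cbasis A_def[symmetric]
    by (simp_all add: algebra_simps)
qed

lemma wirt_wirt_bar_egg_rho:
  fixes p :: "'k::finite cspace"
  assumes "m \<ge> 1"
  shows "wirt (Some j) (wirt_bar (Some l) (\<lambda>x. complex_of_real (egg_rho m x))) p = (if j = l then 1 else 0)"
    "wirt None (wirt_bar (Some l) (\<lambda>x. complex_of_real (egg_rho m x))) p = 0"
    "wirt (Some j) (wirt_bar None (\<lambda>x. complex_of_real (egg_rho m x))) p = 0"
    "wirt None (wirt_bar None (\<lambda>x. complex_of_real (egg_rho m x))) p = (of_nat m)\<^sup>2 * (snd p * cnj (snd p)) ^ (m - 1)"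
proof -
  have "bounded_linear (\<lambda>x :: 'k cspace. fst x $ l)"
    by (intro bounded_linear_compose[OF bounded_linear_vec_nth] bounded_linear_fst)
  note D1 = wirt_eqI(1)[OF bounded_linear_imp_has_derivative[OF this]]
  have E: "wirt_bar (Some l) (\<lambda>x. complex_of_real (egg_rho m x)) = (\<lambda>p :: 'k cspace. fst p $ l)"
    "wirt_bar None (\<lambda>x. complex_of_real (egg_rho m x)) =
      (\<lambda>p :: 'k cspace. of_nat m * ((snd p * cnj (snd p)) ^ (m - 1) * snd p))"
    by (auto intro!: ext simp: wirt_egg_rho mult.assoc)
  show "wirt (Some j) (wirt_bar (Some l) (\<lambda>x. complex_of_real (egg_rho m x))) p = (if j = l then 1 else 0)"
    "wirt None (wirt_bar (Some l) (\<lambda>x. complex_of_real (egg_rho m x))) p = 0"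
    unfolding E D1 cscale_cbasis by (auto simp: axis_def)
  define X where "X = snd p * cnj (snd p)"
  \<comment> \<open>For \<open>m = 1\<close> the exponent \<open>m - 1 - 1\<close> is truncated to
    0, but then the factor \<open>of_nat (m - 1)\<close> vanishes, so \<open>B\<close> is right in
    every case.\<close>
  define B where "B = of_nat (m - 1) * X ^ (m - 1 - 1)"
  have "((\<lambda>x :: 'k cspace. snd x * cnj (snd x)) has_derivative
      (\<lambda>h. snd h * cnj (snd p) + snd p * cnj (snd h))) (at p)"
    by (auto intro!: derivative_eq_intros ext simp: algebra_simps)
  note P = has_derivative_power[OF this, of "m - 1"]
  have "((\<lambda>x :: 'k cspace. of_nat m * ((snd x * cnj (snd x)) ^ (m - 1) * snd x)) has_derivative
     (\<lambda>h. of_nat m * (X ^ (m - 1) * snd h + B * (snd h * cnj (snd p) + snd p * cnj (snd h)) * snd p))) (at p)"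
    by (rule has_derivative_eq_rhs[OF has_derivative_mult_right[OF has_derivative_mult[OF P has_derivative_snd[OF has_derivative_ident]]]])
      (simp add: B_def X_def mult_ac)
  note D2 = wirt_eqI(1)[OF this]
  show "wirt (Some j) (wirt_bar None (\<lambda>x. complex_of_real (egg_rho m x))) p = 0"
    unfolding E D2 cscale_cbasis by simp
  have "wirt None (wirt_bar None (\<lambda>x. complex_of_real (egg_rho m x))) p = of_nat m * (B * X + X ^ (m - 1))"
    unfolding E D2 cscale_cbasis by (simp add: X_def[symmetric] algebra_simps)
  also have "B * X = of_nat (m - 1) * X ^ (m - 1)"
    unfolding B_def by (cases "m - 1") auto
  also have "of_nat m * (of_nat (m - 1) * X ^ (m - 1) + X ^ (m - 1)) = (of_nat m)\<^sup>2 * X ^ (m - 1)"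
    using assms by (simp add: of_nat_diff power2_eq_square algebra_simps)
  finally show "wirt None (wirt_bar None (\<lambda>x. complex_of_real (egg_rho m x))) p = (of_nat m)\<^sup>2 * (snd p * cnj (snd p)) ^ (m - 1)"
    by (simp add: X_def)
qed

text \<open>The bordered matrix is an arrowhead with corner 0 and diagonal 1, ..., 1, m^2
  |w|^(2(m-1)). The Schur complement of the corner is -(|z|^2 + |w|^(2m)), which is -1 on the
  boundary, so minus the determinant is the product of the diagonal.\<close>

lemma fefferman_M_egg:
  fixes p :: "'k::finite cspace"
  assumes m: "m \<ge> 1" and p: "egg_rho m p = 0"
  shows "fefferman_M (egg_rho m) p = (real m)\<^sup>2 * (norm (snd p))\<^sup>2 ^ (m - 1)"
proof -
  define X where "X = snd p * cnj (snd p)"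
  define A where "A = of_nat m * X ^ (m - 1)"
  define x where "x j = (case j of Some j \<Rightarrow> cnj (fst p $ j) | None \<Rightarrow> A * cnj (snd p))" for j
  define y where "y j = (case j of Some j \<Rightarrow> fst p $ j | None \<Rightarrow> A * snd p)" for j
  define d where "d j = (case j of Some j \<Rightarrow> 1 | None \<Rightarrow> of_nat m * A)" for j :: "'k option"
  have X: "X = of_real ((norm (snd p))\<^sup>2)" unfolding X_def by (simp only: complex_norm_square)
  define H where "H = bordered_hessian (egg_rho m) p"
  have H: "H $ None $ None = 0" "H $ None $ Some l = y l" "H $ Some j $ None = x j"
    "H $ Some j $ Some l = (if j = l then d j else 0)" for j l
    by (auto simp: H_def bordered_hessian_def wirt_egg_rho x_def y_def A_def X_def split: option.split)
      (cases j; cases l; auto simp: wirt_wirt_bar_egg_rho[OF m] d_def A_def X_def power2_eq_square)+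
  have "- det H = of_nat m * A"
  proof (cases "A = 0")
    case True
    have "row (Some None) H = 0"
      using True by (auto simp: row_def vec_eq_iff H x_def d_def) (metis H(3,4) True d_def mult_zero_left mult_zero_right not_None_eq option.case(1) x_def)
    then show ?thesis using True det_zero_row(1)[of "Some None" H] by simp
  next
    case False
    then have d0: "d j \<noteq> 0" for j using m by (auto simp: d_def split: option.split)
    have "- det H = (\<Sum>j\<in>UNIV. y j * x j / d j) * prod d UNIV"
      by (subst det_arrowhead) (auto simp: H d0)
    also have "prod d UNIV = of_nat m * A"
      by (simp add: UNIV_option_conv prod.reindex d_def)
    also have "(\<Sum>j\<in>UNIV. y j * x j / d j) = A * X / of_nat m + (\<Sum>j\<in>UNIV. fst p $ j * cnj (fst p $ j))"
      using False m by (simp add: UNIV_option_conv sum.reindex d_def x_def y_def X_def field_simps)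
    also have "A * X / of_nat m = X ^ m"
      using m power_minus_mult[of m X] by (simp add: A_def)
    also have "X ^ m + (\<Sum>j\<in>UNIV. fst p $ j * cnj (fst p $ j)) = 1"
      using of_real_egg_rho[of m p] p by (simp add: X_def algebra_simps)
    finally show ?thesis by simp
  qed
  moreover have "of_nat m * A = complex_of_real ((real m)\<^sup>2 * (norm (snd p))\<^sup>2 ^ (m - 1))"
    by (simp add: A_def X power2_eq_square)
  ultimately show ?thesis
    unfolding fefferman_M_def H_def[symmetric] by (simp only: Re_complex_of_real)
qed

section \<open>The Fefferman measure in coordinates\<close>

definition egg_boundary :: "nat \<Rightarrow> 'k::finite cspace set" where
  "egg_boundary m = {p. egg_rho m p = 0}"

definition egg_weight :: "nat \<Rightarrow> 'k::finite cspace \<Rightarrow> real" where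
  "egg_weight m p = ((real m)\<^sup>2 * (norm (snd p))\<^sup>2 ^ (m - 1)) powr (1 / (real CARD('k) + 2)) /
     (2 * sqrt ((norm (fst p))\<^sup>2 + (real m)\<^sup>2 * ((norm (snd p))\<^sup>2 ^ (m - 1))\<^sup>2 * (norm (snd p))\<^sup>2))"

text \<open>The Fefferman measure with an explicit Borel density on the whole space. It agrees with
  the original density on the boundary, where rho = 0 evaluates the determinant.\<close>

definition egg_measure :: "nat \<Rightarrow> 'k::finite cspace measure" where
  "egg_measure m = density (restrict_space (hausdorff_measure (2 * CARD('k) + 1)) (egg_boundary m))
     (\<lambda>p. ennreal (egg_weight m p))"

lemma closed_egg_boundary: "closed (egg_boundary m :: 'k::finite cspace set)"
  unfolding egg_boundary_def by (rule closed_Collect_eq) (auto intro: continuous_egg_rho)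

lemma egg_boundary_borel [measurable]: "egg_boundary m \<in> sets borel"
  by (intro borel_closed closed_egg_boundary)

lemma borel_measurable_fst_snd [measurable (raw)]:
  fixes f :: "'a \<Rightarrow> 'b::euclidean_space \<times> 'c::euclidean_space"
  assumes "f \<in> borel_measurable M"
  shows "(\<lambda>x. fst (f x)) \<in> borel_measurable M" "(\<lambda>x. snd (f x)) \<in> borel_measurable M"
  by (intro measurable_compose[OF assms] borel_measurable_continuous_onI continuous_intros)+

lemma egg_weight_measurable [measurable]: "egg_weight m \<in> borel_measurable (borel :: 'k::finite cspace measure)"
  unfolding egg_weight_def[abs_def] by measurable

lemma egg_weight_nonneg: "egg_weight m p \<ge> 0"
  unfolding egg_weight_def by (intro divide_nonneg_nonneg mult_nonneg_nonneg) auto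

lemma fefferman_measure_egg:
  assumes m: "m \<ge> 1"
  shows "fefferman_measure (egg_rho m) (egg m) = (egg_measure m :: 'k::finite cspace measure)"
proof -
  let ?R = "restrict_space (hausdorff_measure (2 * CARD('k) + 1)) (egg_boundary m) :: 'k cspace measure"
  have fr: "frontier (egg m) = (egg_boundary m :: 'k cspace set)"
    by (simp add: frontier_egg[OF m] egg_boundary_def)
  have dim: "DIM('k cspace) - 1 = 2 * CARD('k) + 1" by simp
  have eq: "ennreal (fefferman_M (egg_rho m) p powr (1 / (real CARD('k) + 2)) / norm (gradient (egg_rho m) p)) = ennreal (egg_weight m p)"
    if "p \<in> space ?R" for p :: "'k cspace"
    using that by (simp add: space_restrict_space egg_boundary_def egg_weight_def fefferman_M_egg[OF m] norm_gradient_egg_rho)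
  have W: "(\<lambda>p. ennreal (egg_weight m p)) \<in> borel_measurable ?R"
    by (rule measurable_restrict_space1) measurable
  have "density ?R (\<lambda>p. ennreal (fefferman_M (egg_rho m) p powr (1 / (real CARD('k) + 2)) / norm (gradient (egg_rho m) p))) =
      density ?R (\<lambda>p. ennreal (egg_weight m p))"
    by (rule density_cong[OF measurable_cong[THEN iffD2, OF eq W] W]) (auto simp: eq)
  then show ?thesis
    unfolding fefferman_measure_def hypersurface_measure_def egg_measure_def fr dim .
qed

lemma space_egg_measure [simp]: "space (egg_measure m) = egg_boundary m"
  by (simp add: egg_measure_def space_restrict_space)

lemma sets_egg_measure [measurable_cong]: "sets (egg_measure m) = sets (restrict_space borel (egg_boundary m))"
  by (simp add: egg_measure_def sets_restrict_space)

lemma nn_integral_egg_measure: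
  fixes h :: "'k::finite cspace \<Rightarrow> ennreal"
  assumes [measurable]: "h \<in> borel_measurable borel"
  shows "(\<integral>\<^sup>+p. h p \<partial>egg_measure m) =
    (\<integral>\<^sup>+p. h p * ennreal (egg_weight m p) * indicator (egg_boundary m) p \<partial>hausdorff_measure (2 * CARD('k) + 1))"
proof -
  let ?H = "hausdorff_measure (2 * CARD('k) + 1) :: 'k cspace measure"
  have h: "h \<in> borel_measurable (restrict_space ?H (egg_boundary m))" "(\<lambda>p. ennreal (egg_weight m p)) \<in> borel_measurable (restrict_space ?H (egg_boundary m))"
    by (rule measurable_restrict_space1; measurable)+
  show ?thesis
    unfolding egg_measure_def
    by (subst nn_integral_density[OF h(2,1)]) (simp add: nn_integral_restrict_space mult.commute)
qed

section \<open>Circle symmetries of the boundary measure\<close>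

lemma hausdorff_measure_distr_isometry:
  fixes R :: "'a::real_normed_vector \<Rightarrow> 'a"
  assumes d: "d > 0" and R: "\<And>x y. dist (R x) (R y) = dist x y" "surj R" and [measurable]: "R \<in> borel \<rightarrow>\<^sub>M borel"
  shows "distr (hausdorff_measure d) borel R = hausdorff_measure d"
proof (rule measure_eqI)
  fix A :: "'a set" assume "A \<in> sets (distr (hausdorff_measure d) borel R)"
  then have A: "A \<in> sets borel" by simp
  have vA: "R -` A \<in> sets borel" using measurable_sets[of R borel borel A] A by simp
  have "emeasure (distr (hausdorff_measure d) borel R) A = emeasure (hausdorff_measure d) (R -` A)"
    using A by (subst emeasure_distr) auto
  also have "\<dots> = hausdorff_outer d (id ` (R -` A))"
    using emeasure_hausdorff_measure[OF d vA] by simp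
  also have "\<dots> = hausdorff_outer d (R ` (R -` A))"
    by (rule hausdorff_outer_isometric) (simp add: R)
  also have "R ` (R -` A) = A" by (rule surj_image_vimage_eq[OF R(2)])
  also have "hausdorff_outer d A = emeasure (hausdorff_measure d) A"
    using emeasure_hausdorff_measure[OF d A] by simp
  finally show "emeasure (distr (hausdorff_measure d) borel R) A = emeasure (hausdorff_measure d) A" .
qed simp

text \<open>Unimodular \<open>a\<close> and \<open>b\<close> give symmetries of the boundary. With
  \<open>a = 1\<close> and \<open>b\<close> running through the closed unit disc, the image of a
  point is an analytic disc whose centre \<open>b = 0\<close> lies on the z_i-axis.\<close>

definition rot :: "'k::finite \<Rightarrow> complex \<Rightarrow> complex \<Rightarrow> 'k cspace \<Rightarrow> 'k cspace" where
  "rot i a b p = (\<chi> j. (if j = i then a else b) * fst p $ j, b * snd p)"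

lemma rot_rot: "rot i a b (rot i c d p) = rot i (a * c) (b * d) p"
  by (simp add: rot_def vec_eq_iff)

lemma rot_one: "rot i 1 1 p = p"
  by (cases p) (simp add: rot_def vec_eq_iff)

lemma rot_diff: "rot i a b p - rot i a b q = rot i a b (p - q)"
  by (simp add: rot_def vec_eq_iff algebra_simps)

lemma norm_rot:
  assumes "norm a = 1" "norm b = 1"
  shows "norm (fst (rot i a b p)) = norm (fst p)" "norm (snd (rot i a b p)) = norm (snd p)" "norm (rot i a b p) = norm p"
proof -
  have *: "norm (((if j = i then a else b) * fst p $ j)) = norm (fst p $ j)" for j
    using assms by (simp add: norm_mult)
  show 1: "norm (fst (rot i a b p)) = norm (fst p)" unfolding rot_def norm_vec_def fst_conv vec_lambda_beta * ..
  show 2: "norm (snd (rot i a b p)) = norm (snd p)" using assms by (simp add: rot_def norm_mult)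
  show "norm (rot i a b p) = norm p" using 1 2 by (simp add: norm_prod_def)
qed

lemma continuous_rot: "continuous_on A (rot i a b)"
  unfolding rot_def by (intro continuous_intros)

lemma rot_measurable [measurable]: "rot i a b \<in> borel \<rightarrow>\<^sub>M borel"
  by (intro borel_measurable_continuous_onI continuous_rot)

text \<open>The map is a surjective isometry and keeps |z| and |w|, on which alone the boundary and
  the weight depend.\<close>

lemma egg_measure_rot:
  fixes i :: "'k::finite"
  assumes ab: "norm a = 1" "norm b = 1"
  shows "rot i a b \<in> egg_measure m \<rightarrow>\<^sub>M egg_measure m"
    and "distr (egg_measure m) (egg_measure m) (rot i a b) = egg_measure m"
proof -
  let ?R = "rot i a b" and ?E = "egg_measure m :: 'k cspace measure"
  let ?H = "hausdorff_measure (2 * CARD('k) + 1) :: 'k cspace measure"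
  have bd: "?R p \<in> egg_boundary m \<longleftrightarrow> p \<in> egg_boundary m" for p
    by (simp add: egg_boundary_def egg_rho_eq norm_rot[OF ab])
  have W: "egg_weight m (?R p) = egg_weight m p" for p
    by (simp add: egg_weight_def norm_rot[OF ab])
  have "a \<noteq> 0" "b \<noteq> 0" using ab by auto
  then have inv: "a * inverse a = 1" "b * inverse b = 1" by simp_all
  have "surj ?R" by (rule surjI[where f = "rot i (inverse a) (inverse b)"]) (simp add: rot_rot inv rot_one)
  then have HR: "distr ?H borel ?R = ?H"
    by (intro hausdorff_measure_distr_isometry) (auto simp: dist_norm rot_diff norm_rot[OF ab])
  have "?R \<in> restrict_space borel (egg_boundary m) \<rightarrow>\<^sub>M restrict_space borel (egg_boundary m)"
    by (intro measurable_restrict_space2 measurable_restrict_space1) (auto simp: space_restrict_space bd)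
  then show M: "?R \<in> ?E \<rightarrow>\<^sub>M ?E" by (simp cong: measurable_cong_sets add: sets_egg_measure)
  have em: "emeasure ?E A = (\<integral>\<^sup>+p. indicator A p * ennreal (egg_weight m p) * indicator (egg_boundary m) p \<partial>?H)"
    if "A \<in> sets ?E" and [measurable]: "A \<in> sets borel" for A
    using that nn_integral_egg_measure[of "indicator A" m] by simp
  show "distr ?E ?E ?R = ?E"
  proof (rule measure_eqI)
    fix A assume "A \<in> sets (distr ?E ?E ?R)"
    then have A: "A \<in> sets ?E" by simp
    then have Ab [measurable]: "A \<in> sets borel" and AF: "A \<subseteq> egg_boundary m"
      by (auto simp: sets_egg_measure sets_restrict_space_iff)
    have v [measurable]: "?R -` A \<in> sets borel" using measurable_sets[of ?R borel borel A] by simp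
    have sub: "?R -` A \<subseteq> egg_boundary m" using AF bd by blast
    then have vE: "?R -` A \<in> sets ?E"
      using v by (simp add: sets_egg_measure sets_restrict_space_iff)
    have "emeasure (distr ?E ?E ?R) A = emeasure ?E (?R -` A)"
      using sub by (subst emeasure_distr[OF M A]) (simp add: Int_absorb2)
    also have "\<dots> = (\<integral>\<^sup>+p. indicator A (?R p) * ennreal (egg_weight m (?R p)) * indicator (egg_boundary m) (?R p) \<partial>?H)"
      unfolding em[OF vE v] by (intro nn_integral_cong) (auto simp: W bd indicator_def)
    also have "\<dots> = (\<integral>\<^sup>+p. indicator A p * ennreal (egg_weight m p) * indicator (egg_boundary m) p \<partial>(distr ?H borel ?R))"
      by (subst nn_integral_distr) auto
    also have "\<dots> = emeasure ?E A" unfolding HR em[OF A Ab] ..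
    finally show "emeasure (distr ?E ?E ?R) A = emeasure ?E A" .
  qed simp
qed

section \<open>Graph charts of the boundary and its moments\<close>

text \<open>The primitive arcsin (u / sqrt P) gains pi from end to end. Because the value is the
  same for all \<open>P\<close>, integrating out Re w adds no further power of 1 - |z|^2 to the
  weight.\<close>

lemma nn_integral_arcsin_density:
  assumes "P > 0"
  shows "(\<integral>\<^sup>+u. ennreal (1 / sqrt (P - u\<^sup>2)) * indicator {u. u\<^sup>2 < P} u \<partial>lborel) = ennreal pi"
proof -
  define r where "r = sqrt P"
  have r: "r > 0" "P = r\<^sup>2" using assms by (auto simp: r_def)
  then have r0: "r \<noteq> 0" by simp
  have less_iff: "u\<^sup>2 < P \<longleftrightarrow> - r < u \<and> u < r" for u
  proof -
    have "P \<le> u\<^sup>2 \<longleftrightarrow> r \<le> \<bar>u\<bar>" using abs_le_square_iff[of r u] r by simp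
    then show ?thesis by linarith
  qed
  have set_eq: "{u. u\<^sup>2 < P} = einterval (ereal (- r)) (ereal r)"
    by (auto simp: einterval_def less_iff)
  have d: "DERIV (\<lambda>u. arcsin (u / r)) u :> 1 / sqrt (P - u\<^sup>2)" if "- r < u" "u < r" for u
  proof -
    have "- 1 < u / r" "u / r < 1" using that r by (simp_all add: field_simps)
    then have "DERIV (\<lambda>u. arcsin (u / r)) u :> inverse (sqrt (1 - (u / r)\<^sup>2)) * (1 / r)"
      using r0 by (auto intro!: derivative_eq_intros)
    moreover have "sqrt (1 - (u / r)\<^sup>2) = sqrt (P - u\<^sup>2) / r"
    proof -
      have "1 - (u / r)\<^sup>2 = (P - u\<^sup>2) / r\<^sup>2" unfolding r(2) using r0 by (simp add: field_simps)
      then show ?thesis using r(1) by (simp add: real_sqrt_divide)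
    qed
    ultimately show ?thesis using r0 by (simp add: field_simps)
  qed
  have pos: "0 < P - u\<^sup>2" if "- r < u" "u < r" for u
    using that less_iff[of u] by simp
  have c: "continuous_on {- r..r} (\<lambda>u. arcsin (u / r))"
    using r by (intro continuous_on_arcsin continuous_intros) (auto simp: field_simps)
  have lim: "((\<lambda>u. arcsin (u / r)) \<longlongrightarrow> - (pi / 2)) (at_right (- r))" "((\<lambda>u. arcsin (u / r)) \<longlongrightarrow> pi / 2) (at_left r)"
    using continuous_on_Icc_at_rightD[OF c] continuous_on_Icc_at_leftD[OF c] r by auto
  have cont: "isCont (\<lambda>u. 1 / sqrt (P - u\<^sup>2)) u" if "- r < u" "u < r" for u
    using pos[OF that] by (intro continuous_intros) auto
  have si: "set_integrable lborel (einterval (- r) r) (\<lambda>u. 1 / sqrt (P - u\<^sup>2))"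
    and val: "(LBINT u=- r..r. 1 / sqrt (P - u\<^sup>2)) = pi / 2 - (- (pi / 2))"
    using interval_integral_FTC_nonneg[of "ereal (- r)" "ereal r" "\<lambda>u. arcsin (u / r)" "\<lambda>u. 1 / sqrt (P - u\<^sup>2)" "- (pi / 2)" "pi / 2"]
      r d cont lim pos by (auto simp: ereal_tendsto_simps less_imp_le)
  have "(\<integral>\<^sup>+u. ennreal (1 / sqrt (P - u\<^sup>2)) * indicator {u. u\<^sup>2 < P} u \<partial>lborel) =
      (\<integral>\<^sup>+u. ennreal (indicator (einterval (- r) r) u *\<^sub>R (1 / sqrt (P - u\<^sup>2))) \<partial>lborel)"
    unfolding set_eq by (intro nn_integral_cong) (auto simp: indicator_def)
  also have "\<dots> = ennreal (\<integral>u. indicator (einterval (- r) r) u *\<^sub>R (1 / sqrt (P - u\<^sup>2)) \<partial>lborel)"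
    using si pos unfolding set_integrable_def
    by (intro nn_integral_eq_integral) (auto simp: indicator_def einterval_def less_imp_le)
  also have "(\<integral>u. indicator (einterval (- r) r) u *\<^sub>R (1 / sqrt (P - u\<^sup>2)) \<partial>lborel) = pi"
    using val r by (simp add: interval_lebesgue_integral_def set_lebesgue_integral_def)
  finally show ?thesis .
qed

lemma powr_inverse_power:
  fixes s :: real
  assumes "s > 0" "m \<ge> 1"
  shows "(s powr (1 / real m)) ^ m = s"
  using assms by (simp add: powr_powr flip: powr_realpow)

text \<open>The boundary is the union of two graphs \<open>Im w = \<epsilon> f (z, Re w)\<close>, \<open>\<epsilon> = \<plusminus>1\<close>, over \<open>chart_dom\<close>
  and of the null set \<open>Im w = 0\<close>.  On the graphs \<open>\<bar>w\<bar>\<^sup>2 = (1 - \<bar>z\<bar>\<^sup>2) powr (1 / m)\<close>.\<close>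

definition chart_dom :: "nat \<Rightarrow> ((complex^'k::finite) \<times> real) set" where
  "chart_dom m = {x. (norm (fst x))\<^sup>2 + snd x ^ (2 * m) < 1}"

definition wsq :: "nat \<Rightarrow> complex^'k::finite \<Rightarrow> real" where
  "wsq m z = (1 - (norm z)\<^sup>2) powr (1 / real m)"

definition chart_fun :: "nat \<Rightarrow> (complex^'k::finite) \<times> real \<Rightarrow> real" where
  "chart_fun m x = sqrt (wsq m (fst x) - (snd x)\<^sup>2)"

text \<open>The power (1 - |z|^2)^(1/m - 1) that arises from differentiating \<open>wsq\<close> is
  written as the reciprocal of \<open>wsq ^ (m - 1)\<close>, that is of |w|^(2(m-1)), to match
  \<open>egg_weight\<close>.\<close>

definition chart_grad :: "nat \<Rightarrow> (complex^'k::finite) \<times> real \<Rightarrow> (complex^'k) \<times> real" where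
  "chart_grad m x = (- (1 / (real m * wsq m (fst x) ^ (m - 1) * chart_fun m x)) *\<^sub>R fst x, - (snd x / chart_fun m x))"

definition chart_emb :: "real \<Rightarrow> ((complex^'k::finite) \<times> real) \<times> real \<Rightarrow> 'k cspace" where
  "chart_emb e q = (fst (fst q), Complex (snd (fst q)) (e * snd q))"

definition chart_proj :: "real \<Rightarrow> 'k::finite cspace \<Rightarrow> ((complex^'k) \<times> real) \<times> real" where
  "chart_proj e p = ((fst p, Re (snd p)), e * Im (snd p))"

lemma power2_less_wsq_iff:
  assumes m: "m \<ge> 1" and s: "0 < 1 - (norm z)\<^sup>2"
  shows "u\<^sup>2 < wsq m z \<longleftrightarrow> (norm z)\<^sup>2 + u ^ (2 * m) < 1"
proof -
  have "u\<^sup>2 < wsq m z \<longleftrightarrow> (u\<^sup>2) ^ m < wsq m z ^ m"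
    using m power_mono_iff[of "wsq m z" "u\<^sup>2" m] by (simp add: wsq_def not_le[symmetric])
  then show ?thesis
    using powr_inverse_power[OF s m] by (auto simp: wsq_def power_mult)
qed

lemma chart_dom_iff:
  assumes m: "m \<ge> 1"
  shows "x \<in> chart_dom m \<longleftrightarrow> (norm (fst x))\<^sup>2 < 1 \<and> (snd x)\<^sup>2 < wsq m (fst x)"
proof -
  have "(norm (fst x))\<^sup>2 < 1" if "x \<in> chart_dom m"
  proof -
    have "(norm (fst x))\<^sup>2 + snd x ^ (2 * m) < 1" using that by (simp add: chart_dom_def)
    then show ?thesis using zero_le_even_power'[of "snd x" m] by linarith
  qed
  then show ?thesis
    using power2_less_wsq_iff[OF m, of "fst x" "snd x"] by (auto simp: chart_dom_def)
qed

lemma chart_dom_facts: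
  assumes m: "m \<ge> 1" and x: "x \<in> chart_dom m"
  shows "0 < 1 - (norm (fst x))\<^sup>2" "0 < wsq m (fst x)" "wsq m (fst x) ^ m = 1 - (norm (fst x))\<^sup>2"
    "0 < chart_fun m x" "(chart_fun m x)\<^sup>2 = wsq m (fst x) - (snd x)\<^sup>2"
proof -
  show s: "0 < 1 - (norm (fst x))\<^sup>2" using x by (simp add: chart_dom_iff[OF m])
  then show "0 < wsq m (fst x)" by (simp add: wsq_def)
  show "wsq m (fst x) ^ m = 1 - (norm (fst x))\<^sup>2" unfolding wsq_def by (rule powr_inverse_power[OF s m])
  show "0 < chart_fun m x" "(chart_fun m x)\<^sup>2 = wsq m (fst x) - (snd x)\<^sup>2"
    using x by (auto simp: chart_dom_iff[OF m] chart_fun_def)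
qed

lemma open_chart_dom: "open (chart_dom m)"
  unfolding chart_dom_def by (intro open_Collect_less continuous_intros)

lemma wsq_powr_minus_one:
  assumes m: "m \<ge> 1" and s: "0 < 1 - (norm z)\<^sup>2"
  shows "(1 - (norm z)\<^sup>2) powr (1 / real m - 1) = 1 / wsq m z ^ (m - 1)"
proof -
  have "wsq m z ^ (m - 1) * wsq m z = 1 - (norm z)\<^sup>2"
    using powr_inverse_power[OF s m] power_minus_mult[of m "wsq m z"] m unfolding wsq_def by simp
  moreover have "wsq m z \<noteq> 0" using s by (simp add: wsq_def)
  ultimately show ?thesis using s by (simp add: powr_diff wsq_def[symmetric] field_simps)
qed

lemma chart_fun_has_derivative:
  fixes x :: "(complex^'k::finite) \<times> real"
  assumes m: "m \<ge> 1" and x: "x \<in> chart_dom m"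
  shows "(chart_fun m has_derivative (\<lambda>h. h \<bullet> chart_grad m x)) (at x)"
proof -
  note F = chart_dom_facts[OF m x]
  have "((\<lambda>x :: (complex^'k) \<times> real. 1 - (norm (fst x))\<^sup>2) has_derivative (\<lambda>h. - (2 * (fst h \<bullet> fst x)))) (at x)"
    unfolding power2_norm_eq_inner by (auto intro!: derivative_eq_intros ext simp: inner_commute)
  moreover have "((\<lambda>s. s powr (1 / real m)) has_real_derivative (1 / real m * (1 / wsq m (fst x) ^ (m - 1)))) (at (1 - (norm (fst x))\<^sup>2))"
    using has_real_derivative_powr[OF F(1), of "1 / real m"] wsq_powr_minus_one[OF m F(1)] by simp
  ultimately have "((\<lambda>x. wsq m (fst x)) has_derivative (\<lambda>h. - (2 * (fst h \<bullet> fst x)) * (1 / real m * (1 / wsq m (fst x) ^ (m - 1))))) (at x)"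
    unfolding wsq_def[of m "fst _"] by (rule DERIV_compose_FDERIV[rotated])
  moreover have "((\<lambda>x :: (complex^'k) \<times> real. (snd x)\<^sup>2) has_derivative (\<lambda>h. 2 * snd h * snd x)) (at x)"
    by (auto intro!: derivative_eq_intros ext)
  ultimately have D: "((\<lambda>x. wsq m (fst x) - (snd x)\<^sup>2) has_derivative
      (\<lambda>h. - (2 * (fst h \<bullet> fst x)) * (1 / real m * (1 / wsq m (fst x) ^ (m - 1))) - 2 * snd h * snd x)) (at x)"
    by (rule has_derivative_diff)
  have "wsq m (fst x) - (snd x)\<^sup>2 > 0" using x by (simp add: chart_dom_iff[OF m])
  from has_derivative_real_sqrt[OF this D] have "(chart_fun m has_derivative (\<lambda>h.
      (- (2 * (fst h \<bullet> fst x)) * (1 / real m * (1 / wsq m (fst x) ^ (m - 1))) - 2 * snd h * snd x) *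
      (inverse (chart_fun m x) / 2))) (at x)"
    by (simp add: chart_fun_def[abs_def])
  then show ?thesis
    by (rule has_derivative_eq_rhs)
      (use F(2,4) m in \<open>auto simp: fun_eq_iff chart_grad_def inner_prod_def field_simps\<close>)
qed

lemma continuous_on_chart_grad:
  assumes m: "m \<ge> 1"
  shows "continuous_on (chart_dom m) (chart_grad m)"
proof -
  have "continuous_on (chart_dom m) (\<lambda>x. wsq m (fst x))"
    unfolding wsq_def using chart_dom_facts(1)[OF m] by (intro continuous_intros) force
  moreover have "continuous_on (chart_dom m) (chart_fun m)"
    using chart_fun_has_derivative[OF m] has_derivative_continuous by (intro continuous_at_imp_continuous_on ballI) blast
  ultimately show ?thesis
    unfolding chart_grad_def using chart_dom_facts(2,4)[OF m] m by (intro continuous_intros) force+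
qed

text \<open>The Jacobian of a graph is |grad rho| divided by the derivative of rho in the direction
  of the graph, here 2 m X f with X = |w|^(2(m-1)). The gradient cancels against the denominator of
  \<open>egg_weight\<close>, leaving X to the power 1/(k+2) - 1, and X = (1 - |z|^2)^((m-1)/m)
  yields \<open>\<alpha>\<close>.\<close>

lemma egg_weight_chart:
  fixes x :: "(complex^'k::finite) \<times> real"
  assumes m: "m \<ge> 1" and x: "x \<in> chart_dom m" and e: "e\<^sup>2 = 1"
  defines "\<alpha> \<equiv> (real m - 1) / real m * (1 / (real CARD('k) + 2) - 1)"
  defines "K \<equiv> ((real m)\<^sup>2) powr (1 / (real CARD('k) + 2)) / (2 * real m)"
  shows "egg_weight m (chart_emb e (x, chart_fun m x)) * sqrt (1 + (norm (chart_grad m x))\<^sup>2) =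
    K * ((1 - (norm (fst x))\<^sup>2) powr \<alpha> * (1 / chart_fun m x))"
proof -
  note F = chart_dom_facts[OF m x]
  define P where "P = wsq m (fst x)"
  define X where "X = P ^ (m - 1)"
  define f where "f = chart_fun m x"
  define s where "s = 1 - (norm (fst x))\<^sup>2"
  define q where "q = real CARD('k) + 2"
  have pos: "P > 0" "X > 0" "f > 0" "real m > 0" "s > 0" using F m by (auto simp: P_def X_def f_def s_def)
  have w: "(norm (snd (chart_emb e (x, chart_fun m x))))\<^sup>2 = P"
    using F(5) e by (simp add: chart_emb_def cmod_power2 power_mult_distrib P_def)
  define N where "N = (norm (fst x))\<^sup>2 + (real m)\<^sup>2 * X\<^sup>2 * P"
  have N: "N > 0" using pos by (auto simp: N_def intro!: add_nonneg_pos)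
  have W: "egg_weight m (chart_emb e (x, chart_fun m x)) = ((real m)\<^sup>2 * X) powr (1 / q) / (2 * sqrt N)"
    unfolding egg_weight_def w X_def[symmetric] q_def N_def by (simp add: chart_emb_def)
  have "(norm (chart_grad m x))\<^sup>2 = (norm (fst x))\<^sup>2 / ((real m)\<^sup>2 * X\<^sup>2 * f\<^sup>2) + (snd x)\<^sup>2 / f\<^sup>2"
    unfolding chart_grad_def P_def[symmetric] X_def[symmetric] f_def[symmetric]
    by (simp add: norm_Pair power_mult_distrib power_divide)
  moreover have "f\<^sup>2 + (snd x)\<^sup>2 = P" using F(5) by (simp add: f_def P_def)
  ultimately have "1 + (norm (chart_grad m x))\<^sup>2 = N / (real m * X * f)\<^sup>2"
    using pos unfolding N_def by (simp add: field_simps power_mult_distrib) (simp add: algebra_simps flip: \<open>f\<^sup>2 + (snd x)\<^sup>2 = P\<close>)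
  then have J: "sqrt (1 + (norm (chart_grad m x))\<^sup>2) = sqrt N / (real m * X * f)"
    using pos by (simp add: real_sqrt_divide)
  have Xs: "X = s powr ((real m - 1) / real m)"
  proof -
    have "X = (s powr (1 / real m)) powr real (m - 1)"
      unfolding X_def P_def wsq_def s_def[symmetric] by (subst powr_realpow) (use pos in auto)
    then show ?thesis using m by (simp add: powr_powr of_nat_diff)
  qed
  have "X powr (1 / q) / X = X powr (1 / q - 1)"
    using pos by (simp add: powr_diff)
  also have "\<dots> = s powr \<alpha>"
    unfolding Xs powr_powr \<alpha>_def q_def ..
  finally have XX: "X powr (1 / q) / X = s powr \<alpha>" .
  have "egg_weight m (chart_emb e (x, chart_fun m x)) * sqrt (1 + (norm (chart_grad m x))\<^sup>2) =
      ((real m)\<^sup>2 * X) powr (1 / q) / (2 * real m * X * f)"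
    unfolding W J using N by simp
  also have "\<dots> = K * ((X powr (1 / q) / X) * (1 / f))"
    unfolding K_def q_def[symmetric] using pos by (simp add: powr_mult field_simps)
  finally show ?thesis unfolding XX s_def f_def .
qed

lemma chart_emb_facts:
  assumes "e\<^sup>2 = (1::real)"
  shows "dist (chart_emb e p) (chart_emb e q) = dist p q" "chart_emb e (chart_proj e r) = r" "chart_proj e (chart_emb e p) = p"
    "chart_emb e \<in> borel \<rightarrow>\<^sub>M borel" "chart_proj e \<in> borel \<rightarrow>\<^sub>M borel"
proof -
  have e: "e * e = 1" using assms by (simp add: power2_eq_square)
  have e': "e * (e * x) = x" for x using e by (simp flip: mult.assoc)
  have "dist (Complex a (e * b)) (Complex c (e * d)) = sqrt ((a - c)\<^sup>2 + (b - d)\<^sup>2)" for a b c d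
    using assms by (simp add: dist_norm cmod_def power_mult_distrib flip: right_diff_distrib)
  then show "dist (chart_emb e p) (chart_emb e q) = dist p q"
    by (simp add: chart_emb_def dist_prod_def dist_real_def)
  show "chart_emb e (chart_proj e r) = r" "chart_proj e (chart_emb e p) = p"
    by (simp_all add: chart_emb_def chart_proj_def e' prod_eq_iff complex_eq_iff)
  have "continuous_on UNIV (chart_emb e)" "continuous_on UNIV (chart_proj e)"
    unfolding chart_emb_def chart_proj_def Complex_eq by (intro continuous_intros)+
  then show "chart_emb e \<in> borel \<rightarrow>\<^sub>M borel" "chart_proj e \<in> borel \<rightarrow>\<^sub>M borel"
    by (auto intro: borel_measurable_continuous_onI)
qed

lemma chart_image:
  assumes m: "m \<ge> 1" and e: "e = 1 \<or> e = -1"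
  shows "(\<lambda>x. chart_emb e (x, chart_fun m x)) ` chart_dom m = {p \<in> egg_boundary m. e * Im (snd p) > 0}"
proof (intro set_eqI iffI)
  fix p assume "p \<in> (\<lambda>x. chart_emb e (x, chart_fun m x)) ` chart_dom m"
  then obtain x where x: "x \<in> chart_dom m" and p: "p = chart_emb e (x, chart_fun m x)" by blast
  note F = chart_dom_facts[OF m x]
  have "(norm (snd p))\<^sup>2 = wsq m (fst x)" "fst p = fst x" "0 < e * Im (snd p)"
    using F(4,5) e by (auto simp: p chart_emb_def cmod_power2)
  then show "p \<in> {p \<in> egg_boundary m. e * Im (snd p) > 0}"
    using F(3) by (simp add: egg_boundary_def egg_rho_eq power_mult)
next
  fix p :: "'a cspace" assume pb: "p \<in> {p \<in> egg_boundary m. e * Im (snd p) > 0}"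
  define z w where "z = fst p" and "w = snd p"
  have p: "p \<in> egg_boundary m" and im: "0 < e * Im w" and zw: "p = (z, w)"
    using pb by (auto simp: z_def w_def)
  have nz: "(norm z)\<^sup>2 + (norm w)\<^sup>2 ^ m = 1" using p by (simp add: zw egg_boundary_def egg_rho_eq power_mult)
  have w0: "norm w > 0" using im by auto
  then have "0 < (norm w)\<^sup>2 ^ m" by simp
  then have s: "0 < 1 - (norm z)\<^sup>2" using nz by linarith
  have P: "wsq m z = (norm w)\<^sup>2"
  proof -
    have "1 - (norm z)\<^sup>2 = (norm w)\<^sup>2 ^ m" using nz by linarith
    then have "wsq m z = ((norm w)\<^sup>2 ^ m) powr (1 / real m)" by (simp only: wsq_def)
    also have "\<dots> = ((norm w)\<^sup>2 powr real m) powr (1 / real m)" using w0 by (simp add: powr_realpow)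
    also have "\<dots> = (norm w)\<^sup>2" using m w0 unfolding powr_powr by simp
    finally show ?thesis .
  qed
  have im2: "(Im w)\<^sup>2 > 0" using im by auto
  have U: "(z, Re w) \<in> chart_dom m"
    using s im2 unfolding chart_dom_iff[OF m] by (simp add: P cmod_power2)
  have f: "chart_fun m (z, Re w) = e * Im w"
  proof -
    have "chart_fun m (z, Re w) = sqrt ((e * Im w)\<^sup>2)"
      using e by (auto simp: chart_fun_def P cmod_power2)
    then show ?thesis using im by simp
  qed
  have "p = chart_emb e ((z, Re w), chart_fun m (z, Re w))"
    unfolding f zw using e by (auto simp: chart_emb_def complex_eq_iff)
  then show "p \<in> (\<lambda>x. chart_emb e (x, chart_fun m x)) ` chart_dom m"
    using U by (rule image_eqI)
qed

text \<open>Here w is real, so the slice is isometric to a subset of \<complex>^k x \<real>, a space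
  of the same dimension as the measure. There Hausdorff measure is a multiple of Lebesgue measure,
  and each line parallel to the real factor meets the set in at most two points.\<close>

lemma hausdorff_real_slice_null:
  assumes m: "m \<ge> 1"
  shows "{p \<in> egg_boundary m. Im (snd p) = 0} \<in> null_sets (hausdorff_measure (2 * CARD('k) + 1) :: 'k::finite cspace measure)"
proof -
  let ?d = "2 * CARD('k) + 1"
  define N where "N = {x :: (complex^'k) \<times> real. (norm (fst x))\<^sup>2 + snd x ^ (2 * m) = 1}"
  have "closed N" unfolding N_def by (intro closed_Collect_eq continuous_intros)
  then have N [measurable]: "N \<in> sets borel" by (rule borel_closed)
  let ?\<iota> = "\<lambda>x :: (complex^'k) \<times> real. (fst x, complex_of_real (snd x))"
  have img: "{p \<in> egg_boundary m. Im (snd p) = 0} = ?\<iota> ` N"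
  proof (intro set_eqI iffI)
    fix p :: "'k cspace" assume p: "p \<in> {p \<in> egg_boundary m. Im (snd p) = 0}"
    then have w: "snd p = complex_of_real (Re (snd p))" by (simp add: complex_eq_iff)
    have "norm (snd p) = \<bar>Re (snd p)\<bar>" by (subst w) simp
    then have "norm (snd p) ^ (2 * m) = Re (snd p) ^ (2 * m)" by (simp add: power_even_abs)
    then have "(fst p, Re (snd p)) \<in> N" using p by (simp add: N_def egg_boundary_def egg_rho_eq)
    moreover have "p = ?\<iota> (fst p, Re (snd p))" using w by (simp add: prod_eq_iff)
    ultimately show "p \<in> ?\<iota> ` N" by (rule image_eqI[rotated])
  next
    fix p assume "p \<in> ?\<iota> ` N"
    then obtain x where "x \<in> N" "p = ?\<iota> x" by blast
    then show "p \<in> {p \<in> egg_boundary m. Im (snd p) = 0}"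
      by (simp add: N_def egg_boundary_def egg_rho_eq power_even_abs)
  qed
  obtain c where c: "\<And>A. A \<in> sets borel \<Longrightarrow> hausdorff_outer (DIM((complex^'k) \<times> real)) (A :: ((complex^'k) \<times> real) set) = ennreal c * emeasure lborel A"
    using hausdorff_outer_eq_lborel[where 'a = "(complex^'k) \<times> real"] by auto
  have slice: "emeasure lborel (Pair z -` N) = 0" for z
  proof -
    have "Pair z -` N \<subseteq> {root (2 * m) (1 - (norm z)\<^sup>2), - root (2 * m) (1 - (norm z)\<^sup>2)}"
    proof
      fix u assume "u \<in> Pair z -` N"
      then have "\<bar>u\<bar> ^ (2 * m) = 1 - (norm z)\<^sup>2" by (simp add: N_def power_even_abs)
      moreover have "root (2 * m) (\<bar>u\<bar> ^ (2 * m)) = \<bar>u\<bar>" using m by (intro real_root_power_cancel) auto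
      ultimately have "root (2 * m) (1 - (norm z)\<^sup>2) = \<bar>u\<bar>" by (simp only:)
      then show "u \<in> {root (2 * m) (1 - (norm z)\<^sup>2), - root (2 * m) (1 - (norm z)\<^sup>2)}" by auto
    qed
    then have "countable (Pair z -` N)" by (meson countable_finite finite.emptyI finite.insertI finite_subset)
    then show ?thesis by (rule emeasure_lborel_countable)
  qed
  have "emeasure lborel N = emeasure (lborel \<Otimes>\<^sub>M lborel) N" by (simp add: lborel_prod)
  also have "\<dots> = (\<integral>\<^sup>+z. emeasure lborel (Pair z -` N) \<partial>lborel)"
    by (rule lborel.emeasure_pair_measure_alt) (simp only: lborel_prod sets_lborel N)
  also have "\<dots> = 0" by (simp add: slice)
  finally have "emeasure lborel N = 0" .
  then have "hausdorff_outer (DIM((complex^'k) \<times> real)) N = 0" using c[OF N] by simp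
  moreover have "DIM((complex^'k) \<times> real) = ?d" by simp
  ultimately have "hausdorff_outer ?d N = 0" by (simp only:)
  moreover have "hausdorff_outer ?d (?\<iota> ` N) = hausdorff_outer ?d (id ` N)"
    by (rule hausdorff_outer_isometric) (simp add: dist_prod_def dist_real_def dist_complex_def flip: of_real_diff)
  moreover have "{p \<in> egg_boundary m. Im (snd p) = 0} \<in> sets (borel :: 'k cspace measure)"
  proof -
    have "closed (egg_boundary m \<inter> {p :: 'k cspace. Im (snd p) = 0})"
      by (intro closed_Int closed_egg_boundary closed_Collect_eq continuous_intros)
    then show ?thesis by (simp add: Int_def borel_closed)
  qed
  ultimately show ?thesis
    by (simp add: null_sets_def emeasure_hausdorff_measure img)
qed

text \<open>The two sheets contribute equally and the arcsine density integrates out Re w. The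
  constant \<open>c * (2 * (K * pi))\<close> collects the normalization of Hausdorff measure, the
  number of sheets, the factor of the weight and the arcsine integral, the same for all
  \<open>i\<close> and \<open>j\<close>.\<close>

lemma egg_measure_moments:
  assumes m: "m \<ge> 1"
  defines "\<alpha> \<equiv> (real m - 1) / real m * (1 / (real CARD('k) + 2) - 1)"
  shows "\<exists>C>0. \<forall>(i::'k::finite) j. (\<integral>\<^sup>+p. ennreal (cmod (fst p $ i) ^ (2 * j)) \<partial>egg_measure m) = ennreal C * ball_moment \<alpha> i j"
proof -
  let ?H = "hausdorff_measure (2 * CARD('k) + 1) :: 'k cspace measure"
  define K where "K = ((real m)\<^sup>2) powr (1 / (real CARD('k) + 2)) / (2 * real m)"
  have K: "K > 0" using m by (simp add: K_def)
  obtain c where c0: "c > 0" and c: "\<And>A. A \<in> sets borel \<Longrightarrow> hausdorff_outer (DIM((complex^'k) \<times> real)) (A :: ((complex^'k) \<times> real) set) = ennreal c * emeasure lborel A"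
    using hausdorff_outer_eq_lborel[where 'a = "(complex^'k) \<times> real"] by auto
  have [measurable]: "wsq m \<in> borel_measurable (borel :: (complex^'k) measure)"
    unfolding wsq_def[abs_def] by measurable
  have moment: "(\<integral>\<^sup>+p. ennreal (cmod (fst p $ i) ^ (2 * j)) \<partial>egg_measure m) = ennreal (c * (2 * (K * pi))) * ball_moment \<alpha> i j" for i :: 'k and j
  proof -
    define h where "h p = ennreal (cmod (fst p $ i) ^ (2 * j)) * ennreal (egg_weight m p)" for p :: "'k cspace"
    have [measurable]: "h \<in> borel_measurable borel" unfolding h_def by measurable
    define T where "T = (\<integral>\<^sup>+x. ennreal (K * (cmod (fst x $ i) ^ (2 * j) * (1 - (norm (fst x))\<^sup>2) powr \<alpha> * (1 / sqrt (wsq m (fst x) - (snd x)\<^sup>2)))) *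
        indicator (chart_dom m) x \<partial>(lborel :: ((complex^'k) \<times> real) measure))"
    have graph: "{p \<in> egg_boundary m. e * Im (snd p) > 0} \<in> sets (borel :: 'k cspace measure)"
      "(\<integral>\<^sup>+p. h p * indicator {p \<in> egg_boundary m. e * Im (snd p) > 0} p \<partial>?H) = ennreal c * T" if e: "e = 1 \<or> e = -1" for e
    proof -
      have e2: "e\<^sup>2 = 1" using e by auto
      have dim: "DIM((complex^'k) \<times> real) = 2 * CARD('k) + 1" by simp
      note G = nn_integral_hausdorff_graph[OF c chart_emb_facts(1-5)[OF e2] open_chart_dom chart_fun_has_derivative[OF m] continuous_on_chart_grad[OF m] \<open>h \<in> _\<close>, unfolded chart_image[OF m e] dim]
      show "{p \<in> egg_boundary m. e * Im (snd p) > 0} \<in> sets (borel :: 'k cspace measure)" by (rule G(1))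
      have "(\<integral>\<^sup>+x. h (chart_emb e (x, chart_fun m x)) * ennreal (sqrt (1 + (norm (chart_grad m x))\<^sup>2)) * indicator (chart_dom m) x \<partial>lborel) = T"
        unfolding T_def
      proof (rule nn_integral_cong)
        fix x :: "(complex^'k) \<times> real"
        have "h (chart_emb e (x, chart_fun m x)) * ennreal (sqrt (1 + (norm (chart_grad m x))\<^sup>2)) =
          ennreal (K * (cmod (fst x $ i) ^ (2 * j) * (1 - (norm (fst x))\<^sup>2) powr \<alpha> * (1 / sqrt (wsq m (fst x) - (snd x)\<^sup>2))))" if x: "x \<in> chart_dom m"
        proof -
          have "h (chart_emb e (x, chart_fun m x)) * ennreal (sqrt (1 + (norm (chart_grad m x))\<^sup>2)) =
            ennreal (cmod (fst x $ i) ^ (2 * j) * (egg_weight m (chart_emb e (x, chart_fun m x)) * sqrt (1 + (norm (chart_grad m x))\<^sup>2)))"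
            unfolding h_def by (simp add: egg_weight_nonneg mult.assoc chart_emb_def flip: ennreal_mult)
          also have "\<dots> = ennreal (K * (cmod (fst x $ i) ^ (2 * j) * (1 - (norm (fst x))\<^sup>2) powr \<alpha> * (1 / sqrt (wsq m (fst x) - (snd x)\<^sup>2))))"
            unfolding egg_weight_chart[OF m x e2] K_def[symmetric] \<alpha>_def[symmetric] by (simp add: chart_fun_def mult_ac)
          finally show ?thesis .
        qed
        then show "h (chart_emb e (x, chart_fun m x)) * ennreal (sqrt (1 + (norm (chart_grad m x))\<^sup>2)) * indicator (chart_dom m) x =
          ennreal (K * (cmod (fst x $ i) ^ (2 * j) * (1 - (norm (fst x))\<^sup>2) powr \<alpha> * (1 / sqrt (wsq m (fst x) - (snd x)\<^sup>2)))) * indicator (chart_dom m) x"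
          by (auto simp: indicator_def)
      qed
      then show "(\<integral>\<^sup>+p. h p * indicator {p \<in> egg_boundary m. e * Im (snd p) > 0} p \<partial>?H) = ennreal c * T"
        using G(2) by (simp only:)
    qed
    note [measurable] = graph(1)[of 1, simplified] graph(1)[of "-1", simplified]
    have "(\<integral>\<^sup>+p. ennreal (cmod (fst p $ i) ^ (2 * j)) \<partial>egg_measure m) = (\<integral>\<^sup>+p. h p * indicator (egg_boundary m) p \<partial>?H)"
      unfolding h_def by (rule nn_integral_egg_measure) measurable
    also have "\<dots> = (\<integral>\<^sup>+p. h p * indicator {p \<in> egg_boundary m. Im (snd p) > 0} p + h p * indicator {p \<in> egg_boundary m. Im (snd p) < 0} p \<partial>?H)"
      by (rule nn_integral_cong_AE, rule AE_mp[OF AE_not_in[OF hausdorff_real_slice_null[OF m]]]) (auto simp: indicator_def)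
    also have "\<dots> = ennreal c * T + ennreal c * T"
      using graph(2)[of 1] graph(2)[of "-1"] by (subst nn_integral_add) simp_all
    also have "\<dots> = ennreal (2 * c) * T"
      using c0 by (simp only: mult_2 ennreal_plus less_imp_le distrib_right)
    also have "T = ennreal (K * pi) * ball_moment \<alpha> i j"
    proof -
      let ?g = "\<lambda>x. ennreal (K * (cmod (fst x $ i) ^ (2 * j) * (1 - (norm (fst x))\<^sup>2) powr \<alpha> * (1 / sqrt (wsq m (fst x) - (snd x)\<^sup>2)))) *
        indicator (chart_dom m) (x :: (complex^'k) \<times> real)"
      have [measurable]: "chart_dom m \<in> sets (borel :: ((complex^'k) \<times> real) measure)" using open_chart_dom by (rule borel_open)
      have [measurable]: "ball (0 :: complex^'k) 1 \<in> sets borel" by simp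
      have gm: "?g \<in> borel_measurable borel" by measurable
      have "T = (\<integral>\<^sup>+x. ?g x \<partial>(lborel \<Otimes>\<^sub>M lborel))" by (simp add: T_def lborel_prod)
      also have "\<dots> = (\<integral>\<^sup>+z. \<integral>\<^sup>+u. ?g (z, u) \<partial>lborel \<partial>lborel)"
        using gm by (intro lborel.nn_integral_fst[symmetric]) (simp add: lborel_prod)
      also have "\<dots> = (\<integral>\<^sup>+z. ennreal (K * pi) * (ennreal (cmod (z $ i) ^ (2 * j) * (1 - (norm z)\<^sup>2) powr \<alpha>) * indicator (ball 0 1) z) \<partial>lborel)"
      proof (rule nn_integral_cong)
        fix z :: "complex^'k"
        define a where "a = K * (cmod (z $ i) ^ (2 * j) * (1 - (norm z)\<^sup>2) powr \<alpha>)"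
        have a0: "a \<ge> 0" using K by (simp add: a_def)
        have ball: "z \<in> ball 0 1 \<longleftrightarrow> (norm z)\<^sup>2 < 1" by (simp add: abs_square_less_1)
        show "(\<integral>\<^sup>+u. ?g (z, u) \<partial>lborel) = ennreal (K * pi) * (ennreal (cmod (z $ i) ^ (2 * j) * (1 - (norm z)\<^sup>2) powr \<alpha>) * indicator (ball 0 1) z)"
        proof (cases "z \<in> ball 0 1")
          case True
          then have P: "wsq m z > 0" using ball by (simp add: wsq_def)
          have "(\<integral>\<^sup>+u. ?g (z, u) \<partial>lborel) = (\<integral>\<^sup>+u. ennreal a * (ennreal (1 / sqrt (wsq m z - u\<^sup>2)) * indicator {u. u\<^sup>2 < wsq m z} u) \<partial>lborel)"
            using True ball a0 by (intro nn_integral_cong) (auto simp: chart_dom_iff[OF m] indicator_def a_def mult.assoc simp flip: ennreal_mult)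
          also have "\<dots> = ennreal a * ennreal pi"
            by (subst nn_integral_cmult) (auto simp: nn_integral_arcsin_density[OF P])
          also have "\<dots> = ennreal (K * pi) * ennreal (cmod (z $ i) ^ (2 * j) * (1 - (norm z)\<^sup>2) powr \<alpha>)"
            using K by (simp add: a_def mult_ac flip: ennreal_mult)
          finally show ?thesis using True by simp
        next
          case False
          then have "(z, u) \<notin> chart_dom m" for u using ball by (auto simp: chart_dom_iff[OF m])
          then show ?thesis using False by (simp add: indicator_def)
        qed
      qed
      also have "\<dots> = ennreal (K * pi) * ball_moment \<alpha> i j"
        unfolding ball_moment_def by (rule nn_integral_cmult) measurable
      finally show ?thesis .
    qed
    also have "ennreal (2 * c) * (ennreal (K * pi) * ball_moment \<alpha> i j) = ennreal (c * (2 * (K * pi))) * ball_moment \<alpha> i j"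
    proof -
      have "ennreal (c * (2 * (K * pi))) = ennreal (2 * c) * ennreal (K * pi)"
        using c0 K by (subst ennreal_mult[symmetric]) (auto simp: mult_ac)
      then show ?thesis by (simp only: mult.assoc)
    qed
    finally show ?thesis .
  qed
  show ?thesis
    by (rule exI[of _ "c * (2 * (K * pi))"]) (use c0 K moment in simp)
qed

section \<open>Averaging over circles\<close>

text \<open>One turn over [0, 1], matching \<open>circlepath 0 1\<close>:
  \<open>unit_interval\<close> is then a probability measure and its integrals are means over the
  circle.\<close>

definition circ :: "real \<Rightarrow> complex" where
  "circ x = exp (2 * of_real pi * \<i> * of_real x)"

lemma norm_circ [simp]: "norm (circ x) = 1"
  by (simp add: circ_def)

lemma circ_cnj: "circ x * cnj (circ x) = 1"
  using complex_norm_square[of "circ x"] by simp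

lemma continuous_on_circ [continuous_intros]: "continuous_on A circ"
  unfolding circ_def by (intro continuous_intros)

abbreviation unit_interval :: "real measure" where
  "unit_interval \<equiv> restrict_space lborel {0..1}"

text \<open>Cauchy's formula for the j-th derivative on the unit circle, where 1 / circ x is the
  conjugate of circ x. The case j = 0 is the mean value property.\<close>

lemma circle_mean:
  assumes hol: "G holomorphic_on S" and S: "cball 0 1 \<subseteq> S"
  shows "(\<integral>x. G (circ x) * cnj (circ x) ^ j \<partial>unit_interval) = (deriv ^^ j) G 0 / fact j"
proof -
  let ?F = "\<lambda>x. G (circ x) * cnj (circ x) ^ j"
  have cont: "continuous_on (cball 0 1) G"
    using hol S holomorphic_on_imp_continuous_on continuous_on_subset by blast
  have hb: "G holomorphic_on ball 0 1"
    using hol S by (rule holomorphic_on_subset[OF _ order_trans[OF ball_subset_cball]])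
  have cp: "circlepath 0 1 x = circ x" for x by (simp add: circlepath circ_def)
  have "((\<lambda>u. G u / (u - 0) ^ Suc j) has_contour_integral (2 * pi * \<i> / fact j * (deriv ^^ j) G 0)) (circlepath 0 1)"
    using cont hb by (intro Cauchy_has_contour_integral_higher_derivative_circlepath) auto
  then have "((\<lambda>x. G (circlepath 0 1 x) / (circlepath 0 1 x - 0) ^ Suc j * vector_derivative (circlepath 0 1) (at x within {0..1}))
      has_integral (2 * pi * \<i> / fact j * (deriv ^^ j) G 0)) {0..1}"
    by (simp only: has_contour_integral_def)
  moreover have "G (circlepath 0 1 x) / (circlepath 0 1 x - 0) ^ Suc j * vector_derivative (circlepath 0 1) (at x within {0..1}) =
      2 * pi * \<i> * ?F x" if x: "x \<in> {0..1}" for x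
  proof -
    have e: "circ x \<noteq> 0" by (simp add: circ_def)
    have "1 / circ x = cnj (circ x)" using circ_cnj[of x] e by (simp add: divide_eq_eq mult.commute)
    then have p: "1 / circ x ^ j = cnj (circ x) ^ j" by (simp add: power_one_over[symmetric])
    have vd: "vector_derivative (circlepath 0 1) (at x within {0..1}) = 2 * pi * \<i> * circ x"
      using vector_derivative_circlepath01[of x 0 1] x by (simp add: circ_def)
    have "G (circ x) / circ x ^ Suc j * (2 * pi * \<i> * circ x) = 2 * pi * \<i> * (G (circ x) * (1 / circ x ^ j))"
      using e by (simp add: field_simps)
    then show ?thesis by (simp only: cp vd p diff_zero)
  qed
  ultimately have "((\<lambda>x. 2 * pi * \<i> * ?F x) has_integral (2 * pi * \<i> / fact j * (deriv ^^ j) G 0)) {0..1}"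
    by (rule has_integral_eq[rotated]) simp
  from has_integral_mult_right[OF this, of "1 / (2 * pi * \<i>)"]
  have hi: "(?F has_integral ((deriv ^^ j) G 0 / fact j)) {0..1}"
    by simp
  have "continuous_on {0..1} ?F"
    using norm_circ by (intro continuous_intros continuous_on_compose2[OF cont]) auto
  then have si: "set_integrable lborel {0..1} ?F" by (rule borel_integrable_atLeastAtMost')
  have "(\<integral>x. ?F x \<partial>unit_interval) = (LINT x : {0..1} | lborel. ?F x)"
    by (subst integral_restrict_space) (auto simp: set_lebesgue_integral_def)
  also have "\<dots> = integral {0..1} ?F"
    by (rule set_borel_integral_eq_integral(2)[OF si])
  also have "\<dots> = (deriv ^^ j) G 0 / fact j"
    using hi by (rule integral_unique)
  finally show ?thesis .
qed

section \<open>Pairing holomorphic functions with powers of one coordinate\<close>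

lemma egg_closure_norm_le:
  fixes p :: "'k::finite cspace"
  assumes m: "m \<ge> 1" and p: "p \<in> closure (egg m)"
  shows "norm (fst p) \<le> 1" "norm (snd p) \<le> 1"
proof -
  have "(norm (fst p))\<^sup>2 + norm (snd p) ^ (2 * m) \<le> 1"
    using p by (simp add: closure_egg[OF m] egg_rho_eq)
  moreover have "0 \<le> (norm (fst p))\<^sup>2" "0 \<le> norm (snd p) ^ (2 * m)" by simp_all
  ultimately have "(norm (fst p))\<^sup>2 \<le> 1" "norm (snd p) ^ (2 * m) \<le> 1" by linarith+
  then show "norm (fst p) \<le> 1" "norm (snd p) \<le> 1"
    using m by (simp_all add: power_le_one_iff)
qed

lemma compact_egg_boundary:
  assumes m: "m \<ge> 1"
  shows "compact (egg_boundary m :: 'k::finite cspace set)"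
proof -
  have "norm p \<le> 1 + 1" if "p \<in> egg_boundary m" for p :: "'k cspace"
  proof -
    have "p \<in> closure (egg m)" using that by (simp add: closure_egg[OF m] egg_boundary_def)
    from egg_closure_norm_le[OF m this] show ?thesis
      using norm_Pair_le[of "fst p" "snd p"] by simp
  qed
  then have "bounded (egg_boundary m :: 'k cspace set)" unfolding bounded_iff by blast
  then show ?thesis by (simp add: compact_eq_bounded_closed closed_egg_boundary)
qed

lemma egg_boundary_subset: "m \<ge> 1 \<Longrightarrow> egg_boundary m \<subseteq> closure (egg m)"
  by (auto simp: closure_egg egg_boundary_def)

lemma norm_component_le_1:
  fixes p :: "'k::finite cspace"
  assumes m: "m \<ge> 1" and p: "p \<in> closure (egg m)"
  shows "norm (fst p $ i) \<le> 1"
  using Finite_Cartesian_Product.norm_nth_le[of "fst p" i] egg_closure_norm_le(1)[OF assms] by linarith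

text \<open>Decreasing the moduli of coordinates does not leave the closure (a complete Reinhardt
  set). So not only the circles of rotated points but the discs they bound stay where g is
  holomorphic.\<close>

lemma rot_mem_closure:
  assumes m: "m \<ge> 1" and ab: "norm a \<le> 1" "norm b \<le> 1" and p: "p \<in> closure (egg m)"
  shows "rot i a b p \<in> closure (egg m)"
proof -
  have "norm (fst (rot i a b p)) \<le> norm (fst p)"
    using ab by (intro norm_le_componentwise_cart) (auto simp: rot_def norm_mult intro!: mult_left_le_one_le)
  moreover have "norm (snd (rot i a b p)) \<le> norm (snd p)"
    using ab by (simp add: rot_def norm_mult mult_left_le_one_le)
  ultimately have "(norm (fst (rot i a b p)))\<^sup>2 + norm (snd (rot i a b p)) ^ (2 * m) \<le> (norm (fst p))\<^sup>2 + norm (snd p) ^ (2 * m)"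
    by (intro add_mono power_mono) auto
  then show ?thesis using p by (simp add: closure_egg[OF m] egg_rho_eq)
qed

lemma axis_mem_closure:
  assumes m: "m \<ge> 1" and c: "norm c \<le> 1"
  shows "(axis i c, 0) \<in> closure (egg m)"
proof -
  have "norm (axis i c) = norm c" by (simp add: norm_eq_sqrt_inner inner_axis_axis)
  then have "(norm (axis i c))\<^sup>2 \<le> 1" using c by (simp add: power_le_one)
  then show ?thesis using m by (simp add: closure_egg egg_rho_eq power_0_left)
qed

lemma borel_measurable_egg_measure:
  assumes "f \<in> borel_measurable borel"
  shows "f \<in> borel_measurable (egg_measure m)"
  unfolding measurable_cong_sets[OF sets_egg_measure refl] using assms by (rule measurable_restrict_space1)

lemma continuous_borel_measurable_egg_measure:
  assumes "continuous_on (egg_boundary m) f"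
  shows "f \<in> borel_measurable (egg_measure m)"
  unfolding measurable_cong_sets[OF sets_egg_measure refl]
  using assms by (rule borel_measurable_continuous_on_restrict)

text \<open>Each rotation preserves the integral, hence so does the mean over x, and Fubini moves
  the mean inside. Arbitrary unimodular \<open>u\<close> and \<open>v\<close> cover both circle
  actions.\<close>

lemma integral_egg_measure_average:
  fixes f :: "'k::finite cspace \<Rightarrow> complex"
  assumes m: "m \<ge> 1" and fin: "finite_measure (egg_measure m :: 'k cspace measure)"
    and u: "continuous_on UNIV u" "\<And>x. norm (u x) = 1" and v: "continuous_on UNIV v" "\<And>x. norm (v x) = 1"
    and f: "continuous_on (egg_boundary m) f"
  shows "(\<integral>p. f p \<partial>egg_measure m) = (\<integral>p. \<integral>x. f (rot i (u x) (v x) p) \<partial>unit_interval \<partial>egg_measure m)"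
proof -
  let ?E = "egg_measure m :: 'k cspace measure"
  interpret E: finite_measure ?E by (rule fin)
  have L1: "emeasure unit_interval (space unit_interval) = 1"
    by (simp add: emeasure_restrict_space space_restrict_space)
  interpret L: finite_measure unit_interval by (rule finite_measureI) (simp only: L1, simp)
  have mL: "measure unit_interval (space unit_interval) = 1" using L1 by (simp add: measure_def)
  interpret P: pair_sigma_finite unit_interval ?E ..
  \<comment> \<open>Extended by 0 the integrand is Borel and bounded on the whole space; joint
    measurability for Fubini then follows from continuity of the action.\<close>
  define f' where "f' p = indicator (egg_boundary m) p *\<^sub>R f p" for p
  have f'm [measurable]: "f' \<in> borel_measurable borel"
    unfolding f'_def using f by (intro borel_measurable_continuous_on_indicator) auto
  have "bounded (f ` egg_boundary m)"
    using compact_continuous_image[OF f compact_egg_boundary[OF m]] by (rule compact_imp_bounded)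
  then obtain B where B: "\<And>p. p \<in> egg_boundary m \<Longrightarrow> norm (f p) \<le> B" "B > 0"
    unfolding bounded_pos by auto
  have f'B: "norm (f' p) \<le> B" for p using B by (auto simp: f'_def indicator_def less_imp_le)
  have bd: "rot i (u x) (v x) p \<in> egg_boundary m" if "p \<in> egg_boundary m" for x p
    using that by (simp add: egg_boundary_def egg_rho_eq norm_rot[OF u(2) v(2)])
  have "continuous_on UNIV (\<lambda>z::real \<times> 'k cspace. rot i (u (fst z)) (v (fst z)) (snd z))"
  proof -
    have 1: "continuous_on UNIV (\<lambda>z::real \<times> 'k cspace. u (fst z))" "continuous_on UNIV (\<lambda>z::real \<times> 'k cspace. v (fst z))"
      by (rule continuous_on_compose2[OF u(1)] continuous_on_compose2[OF v(1)]; (intro continuous_intros)?; simp)+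
    have 2: "continuous_on UNIV (\<lambda>z::real \<times> 'k cspace. (if j = i then u (fst z) else v (fst z)) * fst (snd z) $ j)" for j
      using 1 by (cases "j = i") (auto intro!: continuous_intros)
    show ?thesis unfolding rot_def by (intro continuous_intros continuous_on_vec_lambda 1 2)
  qed
  then have R: "(\<lambda>z::real \<times> 'k cspace. rot i (u (fst z)) (v (fst z)) (snd z)) \<in> borel_measurable borel"
    by (rule borel_measurable_continuous_onI)
  have idE: "(\<lambda>p. p) \<in> ?E \<rightarrow>\<^sub>M borel" by (rule borel_measurable_egg_measure) simp
  have idL: "(\<lambda>x. x) \<in> unit_interval \<rightarrow>\<^sub>M borel" by (rule measurable_restrict_space1) simp
  have "(\<lambda>z. (fst z, snd z)) \<in> unit_interval \<Otimes>\<^sub>M ?E \<rightarrow>\<^sub>M borel \<Otimes>\<^sub>M borel"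
    by (intro measurable_Pair measurable_compose[OF measurable_fst idL] measurable_compose[OF measurable_snd idE])
  then have pr: "(\<lambda>z. (fst z, snd z)) \<in> unit_interval \<Otimes>\<^sub>M ?E \<rightarrow>\<^sub>M (borel :: (real \<times> 'k cspace) measure)"
    by (simp only: borel_prod)
  have hm: "(\<lambda>(x, p). f' (rot i (u x) (v x) p)) \<in> borel_measurable (unit_interval \<Otimes>\<^sub>M ?E)"
    using measurable_compose[OF pr measurable_compose[OF R f'm]] by (simp add: case_prod_beta)
  interpret LE: finite_measure "unit_interval \<Otimes>\<^sub>M ?E"
    by (rule finite_measure_pair_measure) unfold_locales
  have hi: "integrable (unit_interval \<Otimes>\<^sub>M ?E) (\<lambda>(x, p). f' (rot i (u x) (v x) p))"
    by (rule LE.integrable_const_bound[OF AE_I2 hm, of B]) (simp only: case_prod_beta f'B)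
  have inv: "(\<integral>p. f' (rot i (u x) (v x) p) \<partial>?E) = (\<integral>p. f' p \<partial>?E)" for x
  proof -
    have "(\<integral>p. f' p \<partial>?E) = (\<integral>p. f' p \<partial>(distr ?E ?E (rot i (u x) (v x))))"
      by (simp only: egg_measure_rot(2)[OF u(2) v(2)])
    also have "\<dots> = (\<integral>p. f' (rot i (u x) (v x) p) \<partial>?E)"
      by (rule integral_distr[OF egg_measure_rot(1)[OF u(2) v(2)] borel_measurable_egg_measure[OF f'm]])
    finally show ?thesis ..
  qed
  have "(\<integral>p. f p \<partial>?E) = (\<integral>p. f' p \<partial>?E)"
    by (rule Bochner_Integration.integral_cong) (auto simp: f'_def)
  also have "\<dots> = (\<integral>x. (\<integral>p. f' (rot i (u x) (v x) p) \<partial>?E) \<partial>unit_interval)"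
    unfolding inv by (simp only: lebesgue_integral_const mL scaleR_one)
  also have "\<dots> = (\<integral>p. (\<integral>x. f' (rot i (u x) (v x) p) \<partial>unit_interval) \<partial>?E)"
    by (rule P.Fubini_integral[OF hi, symmetric])
  also have "\<dots> = (\<integral>p. (\<integral>x. f (rot i (u x) (v x) p) \<partial>unit_interval) \<partial>?E)"
    using bd by (intro Bochner_Integration.integral_cong) (auto simp: f'_def)
  finally show ?thesis .
qed

lemma bounded_linear_cscale: "bounded_linear (\<lambda>c. cscale c (q :: 'k::finite cspace))"
proof -
  have "linear (\<lambda>c. cscale c q)"
    by (rule linearI) (simp_all add: cscale_def vec_eq_iff algebra_simps prod_eq_iff)
  then show ?thesis by (rule linear_conv_bounded_linear[THEN iffD1])
qed

text \<open>A complex-linear derivative restricts to an ordinary complex derivative along complex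
  lines, which gives access to Cauchy theory in one variable.\<close>

lemma holo_on_slice:
  fixes g :: "'k::finite cspace \<Rightarrow> complex"
  assumes g: "holo_on g U" and U: "open U"
  shows "(\<lambda>c. g (p + cscale c q)) holomorphic_on {c. p + cscale c q \<in> U}"
    and "open {c. p + cscale c q \<in> U}"
proof -
  have d: "((\<lambda>c. p + cscale c q) has_derivative (\<lambda>c. cscale c q)) (at c)" for c
    using has_derivative_add[OF has_derivative_const bounded_linear_imp_has_derivative[OF bounded_linear_cscale]]
    by (simp only: add_0)
  have "continuous_on UNIV (\<lambda>c. p + cscale c q)"
    by (intro continuous_at_imp_continuous_on ballI has_derivative_continuous[OF d])
  from open_vimage[OF U this] show op: "open {c. p + cscale c q \<in> U}"
    by (simp only: vimage_def)
  have "\<exists>g'. ((\<lambda>c. g (p + cscale c q)) has_field_derivative g') (at c)" if c: "p + cscale c q \<in> U" for c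
  proof -
    obtain D where D: "(g has_derivative D) (at (p + cscale c q))" "\<forall>c v. D (cscale c v) = c * D v"
      using bspec[OF g[unfolded holo_on_def] c] by (elim exE conjE)
    have eq: "(\<lambda>c. D (cscale c q)) = (*) (D q)"
      by (rule ext) (simp only: D(2)[rule_format] mult.commute)
    have "((\<lambda>c. g (p + cscale c q)) has_derivative (\<lambda>c. D (cscale c q))) (at c)"
      by (rule has_derivative_compose[OF d D(1)])
    then have "((\<lambda>c. g (p + cscale c q)) has_field_derivative D q) (at c)"
      unfolding eq by (simp only: has_field_derivative_def)
    then show ?thesis by (rule exI)
  qed
  then show "(\<lambda>c. g (p + cscale c q)) holomorphic_on {c. p + cscale c q \<in> U}"
    unfolding holomorphic_on_open[OF op] by (intro ballI) (simp only: mem_Collect_eq)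
qed

lemma holo_closure_continuous:
  assumes "g \<in> holo_closure \<Omega>"
  shows "continuous_on (closure \<Omega>) g"
proof -
  obtain U where U: "closure \<Omega> \<subseteq> U" "holo_on g U" using assms by (auto simp: holo_closure_def)
  have "isCont g p" if "p \<in> closure \<Omega>" for p
  proof -
    have "p \<in> U" using U(1) that by blast
    then obtain D where "(g has_derivative D) (at p)" using U(2) unfolding holo_on_def by blast
    then show ?thesis by (rule has_derivative_continuous)
  qed
  then show ?thesis by (simp add: continuous_at_imp_continuous_on)
qed

lemma integral_holo_monomial:
  fixes g :: "'k::finite cspace \<Rightarrow> complex" and i :: 'k
  assumes m: "m \<ge> 1" and fin: "finite_measure (egg_measure m :: 'k cspace measure)"
    and g: "g \<in> holo_closure (egg m)"
  defines "\<phi> \<equiv> \<lambda>c. g (axis i c, 0)"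
  shows "\<exists>S. open S \<and> cball 0 1 \<subseteq> S \<and> \<phi> holomorphic_on S"
    and "(\<integral>p. g p * cnj (fst p $ i) ^ j \<partial>egg_measure m) =
      (deriv ^^ j) \<phi> 0 / fact j * of_real (\<integral>p. cmod (fst p $ i) ^ (2 * j) \<partial>egg_measure m)"
proof -
  let ?E = "egg_measure m :: 'k cspace measure"
  obtain U where U: "open U" "closure (egg m) \<subseteq> U" "holo_on g U"
    using g by (auto simp: holo_closure_def)
  have ax: "(axis i c, 0) = 0 + cscale c (axis i 1, 0)" for c
    by (simp add: cscale_cbasis)
  define S where "S = {c. 0 + cscale c (axis i 1 :: complex^'k, 0) \<in> U}"
  have S: "open S" "\<phi> holomorphic_on S"
  proof -
    have "\<phi> = (\<lambda>c. g (0 + cscale c (axis i 1, 0)))" unfolding \<phi>_def by (simp only: cscale_cbasis add_0)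
    then show "open S" "\<phi> holomorphic_on S"
      using holo_on_slice[OF U(3,1), of 0 "(axis i 1, 0)"] by (simp_all only: S_def)
  qed
  have cbS: "cball 0 1 \<subseteq> S"
  proof
    fix c :: complex assume "c \<in> cball 0 1"
    then have "(axis i c, 0) \<in> U" using axis_mem_closure[OF m, of c i] U(2) by (auto simp: subset_eq)
    then show "c \<in> S" unfolding S_def mem_Collect_eq ax[symmetric] .
  qed
  show "\<exists>S. open S \<and> cball 0 1 \<subseteq> S \<and> \<phi> holomorphic_on S" using S cbS by blast
  have gc: "continuous_on (egg_boundary m) g"
    using holo_closure_continuous[OF g] egg_boundary_subset[OF m] continuous_on_subset by blast
  have ic: "continuous_on A (\<lambda>p :: 'k cspace. fst p $ i)" for A by (intro continuous_intros)
  have one: "continuous_on UNIV (\<lambda>x::real. 1::complex)" "norm (1::complex) = 1" by auto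
  have i1: "norm (fst p $ i) \<le> 1" if "p \<in> egg_boundary m" for p
    using norm_component_le_1[OF m] egg_boundary_subset[OF m] that by blast
  have "(\<integral>p. g p * cnj (fst p $ i) ^ j \<partial>?E) = (\<integral>p. \<integral>x. g (rot i 1 (circ x) p) * cnj (fst (rot i 1 (circ x) p) $ i) ^ j \<partial>unit_interval \<partial>?E)"
    by (rule integral_egg_measure_average[OF m fin one(1) one(2) continuous_on_circ norm_circ])
      (intro continuous_intros gc ic)
  also have "\<dots> = (\<integral>p. \<phi> (fst p $ i) * cnj (fst p $ i) ^ j \<partial>?E)"
  proof (rule Bochner_Integration.integral_cong)
    fix p assume "p \<in> space ?E"
    then have p: "p \<in> closure (egg m)" using egg_boundary_subset[OF m] by auto
    \<comment> \<open>The rotated point is affine in \<open>c\<close>, so g is holomorphic along it.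
      The centre \<open>c = 0\<close> is the projection of p to the z_i-axis, so the mean over the
      circle is \<phi> (z_i).\<close>
    have r: "rot i 1 c p = rot i 1 0 p + cscale c (rot i 0 1 p)" for c
      by (auto simp: rot_def cscale_def vec_eq_iff)
    have hr: "(\<lambda>c. g (rot i 1 c p)) = (\<lambda>c. g (rot i 1 0 p + cscale c (rot i 0 1 p)))"
      by (rule ext) (rule arg_cong[OF r])
    have r0: "rot i 1 0 p = (axis i (fst p $ i), 0)" by (auto simp: rot_def axis_def vec_eq_iff)
    let ?T = "{c. rot i 1 0 p + cscale c (rot i 0 1 p) \<in> U}"
    have "(\<lambda>c. g (rot i 1 c p)) holomorphic_on ?T"
      unfolding hr by (rule holo_on_slice(1)[OF U(3,1)])
    moreover have "cball 0 1 \<subseteq> ?T"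
    proof
      fix c :: complex assume "c \<in> cball 0 1"
      then have "rot i 1 c p \<in> U" using rot_mem_closure[OF m _ _ p, of 1 c i] U(2) by (auto simp: subset_eq)
      then show "c \<in> ?T" unfolding mem_Collect_eq r[of c, symmetric] .
    qed
    ultimately have "(\<integral>x. g (rot i 1 (circ x) p) * cnj (circ x) ^ 0 \<partial>unit_interval) = (deriv ^^ 0) (\<lambda>c. g (rot i 1 c p)) 0 / fact 0"
      by (rule circle_mean)
    then have "(\<integral>x. g (rot i 1 (circ x) p) \<partial>unit_interval) = \<phi> (fst p $ i)"
      by (simp add: \<phi>_def r0)
    moreover have "fst (rot i 1 (circ x) p) $ i = fst p $ i" for x by (simp add: rot_def)
    ultimately show "(\<integral>x. g (rot i 1 (circ x) p) * cnj (fst (rot i 1 (circ x) p) $ i) ^ j \<partial>unit_interval) = \<phi> (fst p $ i) * cnj (fst p $ i) ^ j"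
      by simp
  qed simp
  also have "\<dots> = (\<integral>p. \<integral>x. \<phi> (fst (rot i (circ x) 1 p) $ i) * cnj (fst (rot i (circ x) 1 p) $ i) ^ j \<partial>unit_interval \<partial>?E)"
  proof (rule integral_egg_measure_average[OF m fin continuous_on_circ norm_circ one(1) one(2)])
    have "continuous_on (cball 0 1) \<phi>"
      using S cbS holomorphic_on_imp_continuous_on continuous_on_subset by blast
    then have "continuous_on (egg_boundary m) (\<lambda>p. \<phi> (fst p $ i))"
      by (rule continuous_on_compose2[OF _ ic]) (use i1 in auto)
    then show "continuous_on (egg_boundary m) (\<lambda>p. \<phi> (fst p $ i) * cnj (fst p $ i) ^ j)"
      by (intro continuous_intros ic)
  qed
  also have "\<dots> = (\<integral>p. (deriv ^^ j) \<phi> 0 / fact j * of_real (cmod (fst p $ i) ^ (2 * j)) \<partial>?E)"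
  proof (rule Bochner_Integration.integral_cong)
    fix p assume "p \<in> space ?E"
    then have p: "norm (fst p $ i) \<le> 1" using i1 by simp
    define z where "z = fst p $ i"
    have z: "norm z \<le> 1" using p by (simp add: z_def)
    define T where "T = {c. z * c \<in> S}"
    have T: "open T"
      using continuous_open_preimage[OF _ open_UNIV S(1), of "\<lambda>c. z * c"] by (simp add: T_def vimage_def continuous_on_mult_const)
    have hol: "(\<lambda>c. \<phi> (z * c)) holomorphic_on T"
      by (rule holomorphic_on_compose_gen[OF _ S(2), of "\<lambda>c. z * c", unfolded o_def]) (auto simp: T_def intro!: holomorphic_intros)
    have cbT: "cball 0 1 \<subseteq> T"
    proof
      fix c :: complex assume "c \<in> cball 0 1"
      then have "z * c \<in> cball 0 1" using z by (simp add: norm_mult mult_le_one)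
      then show "c \<in> T" using cbS unfolding T_def by blast
    qed
    have "(\<integral>x. \<phi> (z * circ x) * cnj (circ x) ^ j \<partial>unit_interval) = (deriv ^^ j) (\<lambda>c. \<phi> (z * c)) 0 / fact j"
      by (rule circle_mean[OF hol cbT])
    \<comment> \<open>The chain rule produces z^j, which combines with the j-th power of the
      conjugate of z to |z|^(2j).\<close>
    also have "(deriv ^^ j) (\<lambda>c. \<phi> (z * c)) 0 = z ^ j * (deriv ^^ j) \<phi> (z * 0)"
      by (intro higher_deriv_compose_linear[OF S(2) T S(1)]) (use cbS in \<open>auto simp: T_def\<close>)
    finally have "(\<integral>x. \<phi> (z * circ x) * cnj (circ x) ^ j \<partial>unit_interval) * cnj z ^ j = (deriv ^^ j) \<phi> 0 / fact j * (z * cnj z) ^ j"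
      by (simp add: power_mult_distrib)
    also have "z * cnj z = of_real ((cmod z)\<^sup>2)" by (rule complex_norm_square[symmetric])
    finally have "(\<integral>x. \<phi> (z * circ x) * cnj (circ x) ^ j * cnj z ^ j \<partial>unit_interval) = (deriv ^^ j) \<phi> 0 / fact j * of_real (cmod z ^ (2 * j))"
      by (simp add: power_mult)
    moreover have "fst (rot i (circ x) 1 p) $ i = z * circ x" for x by (simp add: rot_def z_def mult.commute)
    ultimately show "(\<integral>x. \<phi> (fst (rot i (circ x) 1 p) $ i) * cnj (fst (rot i (circ x) 1 p) $ i) ^ j \<partial>unit_interval) =
        (deriv ^^ j) \<phi> 0 / fact j * of_real (cmod (fst p $ i) ^ (2 * j))"
      by (simp add: power_mult_distrib z_def[symmetric] mult_ac)
  qed simp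
  also have "\<dots> = (deriv ^^ j) \<phi> 0 / fact j * of_real (\<integral>p. cmod (fst p $ i) ^ (2 * j) \<partial>?E)"
    by (simp only: integral_mult_right_zero integral_complex_of_real)
  finally show "(\<integral>p. g p * cnj (fst p $ i) ^ j \<partial>?E) =
      (deriv ^^ j) \<phi> 0 / fact j * of_real (\<integral>p. cmod (fst p $ i) ^ (2 * j) \<partial>?E)" .
qed

section \<open>The reproducing kernel\<close>

text \<open>The section \<open>K'\<close> chosen by \<^const>\<open>kernel_section\<close> need not be \<open>K\<close>, but pairing each with the
  other shows that its value at \<open>q\<close> is \<open>\<langle>K', K\<rangle> = cnj \<langle>K, K'\<rangle> = cnj (K q)\<close>, and \<open>K q = \<langle>K, K\<rangle>\<close> is
  real.\<close>

lemma reproducing_kernel_eqI: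
  fixes \<mu> :: "'k::finite cspace measure"
  assumes fin: "finite_measure \<mu>"
    and meas: "\<And>g. g \<in> holo_closure \<Omega> \<Longrightarrow> g \<in> borel_measurable \<mu>"
    and bdd: "\<And>g. g \<in> holo_closure \<Omega> \<Longrightarrow> \<exists>B. \<forall>p\<in>space \<mu>. norm (g p) \<le> B"
    and K: "K \<in> holo_closure \<Omega>" and rep: "\<And>g. g \<in> holo_closure \<Omega> \<Longrightarrow> g q = L2_inner \<mu> g K"
  shows "reproducing_kernel \<Omega> \<mu> q q = K q"
proof -
  interpret finite_measure \<mu> by (rule fin)
  have fs: "emeasure \<mu> (space \<mu>) < top" by (simp add: less_top[symmetric])
  obtain B0 where "\<And>p. p \<in> space \<mu> \<Longrightarrow> norm (K p) \<le> B0" using bdd[OF K] by blast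
  then obtain B where B: "\<And>p. p \<in> space \<mu> \<Longrightarrow> norm (K p) \<le> B" "B \<ge> 0"
    by (meson max.cobounded1 max.cobounded2 order_trans)
  have [measurable]: "(\<lambda>x. cnj (K x)) \<in> borel_measurable \<mu>"
    by (rule measurable_compose[OF meas[OF K]]) (intro borel_measurable_continuous_onI continuous_intros)
  have intK: "integrable \<mu> (\<lambda>x. f x * cnj (K x))" if f: "integrable \<mu> f" for f
  proof (rule Bochner_Integration.integrable_bound)
    show "integrable \<mu> (\<lambda>x. of_real B * f x)" using f by simp
    show "(\<lambda>x. f x * cnj (K x)) \<in> borel_measurable \<mu>" using f by measurable
    show "AE x in \<mu>. norm (f x * cnj (K x)) \<le> norm (of_real B * f x)"
      using B by (auto simp: norm_mult mult.commute[of "cmod (f _)"] intro!: AE_I2 mult_right_mono)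
  qed
  have intg: "integrable \<mu> g" if g: "g \<in> holo_closure \<Omega>" for g
  proof -
    obtain B where "\<And>p. p \<in> space \<mu> \<Longrightarrow> norm (g p) \<le> B" using bdd[OF g] by blast
    then show ?thesis by (intro integrable_const_bound[of g B] AE_I2 meas[OF g])
  qed
  have inth: "integrable \<mu> f" if f: "f \<in> hardy \<Omega> \<mu>" for f
  proof (rule Bochner_Integration.integrable_bound)
    have [measurable]: "f \<in> borel_measurable \<mu>" and "(\<integral>\<^sup>+x. ennreal ((cmod (f x))\<^sup>2) \<partial>\<mu>) < \<infinity>"
      using f by (auto simp: hardy_def)
    then have "integrable \<mu> (\<lambda>x. (cmod (f x))\<^sup>2)" by (intro integrableI_bounded) auto
    then show "integrable \<mu> (\<lambda>x. 1 + (cmod (f x))\<^sup>2)" by simp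
    show "AE x in \<mu>. norm (f x) \<le> norm (1 + (cmod (f x))\<^sup>2)"
    proof (intro AE_I2)
      fix x
      have "0 \<le> (cmod (f x) - 1)\<^sup>2 + (cmod (f x))\<^sup>2 + 1" by simp
      then have "2 * cmod (f x) \<le> 2 * (1 + (cmod (f x))\<^sup>2)" by (simp add: power2_diff)
      then show "norm (f x) \<le> norm (1 + (cmod (f x))\<^sup>2)" by simp
    qed
  qed (use f in \<open>auto simp: hardy_def\<close>)
  \<comment> \<open>Cauchy-Schwarz against the constant 1, with \<open>K\<close> bounded by
    \<open>B\<close> and the total mass finite: pairing with \<open>K\<close> is continuous for the
    L2 distance.\<close>
  have near: "ennreal ((norm (L2_inner \<mu> g K - L2_inner \<mu> f K))\<^sup>2) \<le> ennreal (B\<^sup>2) * emeasure \<mu> (space \<mu>) * L2_dist_sq \<mu> f g"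
    if f: "f \<in> hardy \<Omega> \<mu>" and g: "g \<in> holo_closure \<Omega>" for f g
  proof -
    note [measurable] = meas[OF g] and fm [measurable] = borel_measurable_integrable[OF inth[OF f]]
    have ifg: "integrable \<mu> (\<lambda>x. g x - f x)" using intg[OF g] inth[OF f] by simp
    have "L2_inner \<mu> g K - L2_inner \<mu> f K = (\<integral>x. (g x - f x) * cnj (K x) \<partial>\<mu>)"
      unfolding L2_inner_def left_diff_distrib
      by (rule Bochner_Integration.integral_diff[symmetric]) (intro intK intg g inth f)+
    then have "norm (L2_inner \<mu> g K - L2_inner \<mu> f K) \<le> (\<integral>x. norm ((g x - f x) * cnj (K x)) \<partial>\<mu>)"
      by simp
    also have "\<dots> \<le> (\<integral>x. B * norm (f x - g x) \<partial>\<mu>)"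
    proof (rule integral_mono)
      show "integrable \<mu> (\<lambda>x. norm ((g x - f x) * cnj (K x)))" using intK[OF ifg] by simp
      show "integrable \<mu> (\<lambda>x. B * norm (f x - g x))" using intg[OF g] inth[OF f] by simp
      fix x assume "x \<in> space \<mu>"
      then show "norm ((g x - f x) * cnj (K x)) \<le> B * norm (f x - g x)"
        using mult_right_mono[OF B(1), of x "norm (f x - g x)"]
        by (simp add: norm_mult norm_minus_commute mult.commute)
    qed
    finally have "norm (L2_inner \<mu> g K - L2_inner \<mu> f K) \<le> B * (\<integral>x. norm (f x - g x) \<partial>\<mu>)" by simp
    then have "ennreal ((norm (L2_inner \<mu> g K - L2_inner \<mu> f K))\<^sup>2) \<le> ennreal ((B * (\<integral>x. norm (f x - g x) \<partial>\<mu>))\<^sup>2)"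
      by (intro ennreal_leI power_mono) auto
    also have "\<dots> = ennreal (B\<^sup>2) * (ennreal (\<integral>x. norm (f x - g x) \<partial>\<mu>))\<^sup>2"
      by (simp add: power_mult_distrib ennreal_mult ennreal_power)
    also have "ennreal (\<integral>x. norm (f x - g x) \<partial>\<mu>) = (\<integral>\<^sup>+x. 1 * ennreal (norm (f x - g x)) \<partial>\<mu>)"
      using intg[OF g] inth[OF f] by (subst nn_integral_eq_integral[symmetric]) auto
    also have "(\<integral>\<^sup>+x. 1 * ennreal (norm (f x - g x)) \<partial>\<mu>)\<^sup>2 \<le> (\<integral>\<^sup>+x. 1 ^ 2 \<partial>\<mu>) * (\<integral>\<^sup>+x. (ennreal (norm (f x - g x)))\<^sup>2 \<partial>\<mu>)"
      by (rule Cauchy_Schwarz_nn_integral) measurable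
    also have "\<dots> = emeasure \<mu> (space \<mu>) * L2_dist_sq \<mu> f g"
      by (simp add: L2_dist_sq_def ennreal_power)
    finally show ?thesis by (simp add: mult.assoc mult_left_mono)
  qed
  have eval: "hardy_eval \<Omega> \<mu> f q = L2_inner \<mu> f K" if f: "f \<in> hardy \<Omega> \<mu>" for f
  proof -
    have conv: "(\<lambda>i. g i q) \<longlonglongrightarrow> L2_inner \<mu> f K"
      if g: "\<And>i::nat. g i \<in> holo_closure \<Omega>" and lim: "(\<lambda>i. L2_dist_sq \<mu> f (g i)) \<longlonglongrightarrow> 0" for g
    proof -
      let ?c = "ennreal (B\<^sup>2) * emeasure \<mu> (space \<mu>)"
      have "?c < top" using fs by (simp add: ennreal_mult_less_top)
      then have "(\<lambda>i. ?c * L2_dist_sq \<mu> f (g i)) \<longlonglongrightarrow> ?c * 0"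
        using lim by (intro ennreal_tendsto_cmult)
      then have c0: "(\<lambda>i. ?c * L2_dist_sq \<mu> f (g i)) \<longlonglongrightarrow> 0" by (simp only: mult_zero_right)
      have le: "ennreal ((norm (g i q - L2_inner \<mu> f K))\<^sup>2) \<le> ?c * L2_dist_sq \<mu> f (g i)" for i
        using near[OF f g[of i]] by (simp only: rep[OF g])
      have "(\<lambda>i. ennreal ((norm (g i q - L2_inner \<mu> f K))\<^sup>2)) \<longlonglongrightarrow> 0"
        by (rule tendsto_sandwich[OF always_eventually always_eventually tendsto_const c0]) (simp_all only: zero_le le simp_thms)
      then have "(\<lambda>i. (norm (g i q - L2_inner \<mu> f K))\<^sup>2) \<longlonglongrightarrow> 0"
        by (subst (asm) ennreal_tendsto_0_iff) auto
      then have "(\<lambda>i. norm (g i q - L2_inner \<mu> f K)) \<longlonglongrightarrow> 0"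
        by (simp add: power_tendsto_0_iff)
      then show ?thesis by (simp add: tendsto_norm_zero_iff LIM_zero_iff)
    qed
    \<comment> \<open>An approximating sequence must be exhibited: otherwise the condition in
      \<open>hardy_eval\<close> would hold vacuously for every value and \<open>THE\<close> would be
      undetermined.\<close>
    have "\<exists>g\<in>holo_closure \<Omega>. L2_dist_sq \<mu> f g < ennreal (1 / real (Suc n))" for n
    proof -
      have "0 < 1 / real (Suc n)" by simp
      then show ?thesis using f unfolding hardy_def by blast
    qed
    then obtain g where g: "\<And>n. g n \<in> holo_closure \<Omega>" "\<And>n. L2_dist_sq \<mu> f (g n) < ennreal (1 / real (Suc n))"
      by metis
    have "(\<lambda>n. ennreal (1 / real (Suc n))) \<longlonglongrightarrow> ennreal 0"
      by (intro tendsto_ennrealI LIMSEQ_Suc[OF lim_1_over_n])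
    then have l0: "(\<lambda>n. ennreal (1 / real (Suc n))) \<longlonglongrightarrow> 0" by (simp only: ennreal_0)
    have g0: "(\<lambda>n. L2_dist_sq \<mu> f (g n)) \<longlonglongrightarrow> 0"
      by (rule tendsto_sandwich[OF always_eventually always_eventually tendsto_const l0])
        (simp_all only: zero_le less_imp_le[OF g(2)] simp_thms)
    show ?thesis
      unfolding hardy_eval_def
    proof (rule the_equality)
      show "\<forall>g. (\<forall>i::nat. g i \<in> holo_closure \<Omega>) \<and> (\<lambda>i. L2_dist_sq \<mu> f (g i)) \<longlonglongrightarrow> 0 \<longrightarrow> (\<lambda>i. g i q) \<longlonglongrightarrow> L2_inner \<mu> f K"
        using conv by blast
      fix w assume "\<forall>g. (\<forall>i::nat. g i \<in> holo_closure \<Omega>) \<and> (\<lambda>i. L2_dist_sq \<mu> f (g i)) \<longlonglongrightarrow> 0 \<longrightarrow> (\<lambda>i. g i q) \<longlonglongrightarrow> w"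
      then have "(\<lambda>i. g i q) \<longlonglongrightarrow> w" using g(1) g0 by blast
      then show "w = L2_inner \<mu> f K" using conv[OF g(1) g0] by (rule LIMSEQ_unique)
    qed
  qed
  have hK: "K \<in> hardy \<Omega> \<mu>"
  proof -
    have "(\<integral>\<^sup>+x. ennreal ((cmod (K x))\<^sup>2) \<partial>\<mu>) \<le> (\<integral>\<^sup>+x. ennreal (B\<^sup>2) \<partial>\<mu>)"
      using B by (intro nn_integral_mono ennreal_leI power_mono) auto
    also have "\<dots> < \<infinity>" using fs by (simp add: ennreal_mult_less_top)
    finally show ?thesis
      using K meas[OF K] by (auto simp: hardy_def L2_dist_sq_def intro!: bexI[of _ K])
  qed
  define K' where "K' = kernel_section \<Omega> \<mu> q"
  have "K' \<in> hardy \<Omega> \<mu> \<and> (\<forall>f\<in>hardy \<Omega> \<mu>. hardy_eval \<Omega> \<mu> f q = L2_inner \<mu> f K')"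
    unfolding K'_def kernel_section_def by (rule someI[of _ K]) (use hK eval in auto)
  then have K': "K' \<in> hardy \<Omega> \<mu>" "hardy_eval \<Omega> \<mu> K q = L2_inner \<mu> K K'" using hK by auto
  have cnj_inner: "L2_inner \<mu> f g = cnj (L2_inner \<mu> g f)" for f g
    unfolding L2_inner_def Bochner_Integration.integral_cnj[symmetric] by (simp add: mult.commute)
  have "reproducing_kernel \<Omega> \<mu> q q = L2_inner \<mu> K' K"
    using eval[OF K'(1)] by (simp add: reproducing_kernel_def K'_def)
  also have "\<dots> = cnj (L2_inner \<mu> K K)"
    using K'(2) eval[OF hK] cnj_inner[of K' K] by simp
  also have "\<dots> = K q" using rep[OF K] cnj_inner[of K K] by simp
  finally show ?thesis .
qed

lemma holo_on_coordinate:
  fixes i :: "'k::finite"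
  assumes \<kappa>: "\<kappa> holomorphic_on T" and T: "open T"
  shows "holo_on (\<lambda>p. \<kappa> (fst p $ i)) {p. fst p $ i \<in> T}" and "open {p :: 'k cspace. fst p $ i \<in> T}"
proof -
  have bl: "bounded_linear (\<lambda>p :: 'k cspace. fst p $ i)"
    by (intro bounded_linear_compose[OF bounded_linear_vec_nth] bounded_linear_fst)
  then show "open {p :: 'k cspace. fst p $ i \<in> T}"
    using continuous_open_preimage[OF linear_continuous_on[OF bl] open_UNIV T] by (simp add: vimage_def)
  show "holo_on (\<lambda>p. \<kappa> (fst p $ i)) {p. fst p $ i \<in> T}"
    unfolding holo_on_def
  proof
    fix p :: "'k cspace" assume "p \<in> {p. fst p $ i \<in> T}"
    then obtain k where "(\<kappa> has_field_derivative k) (at (fst p $ i))"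
      using \<kappa> T by (auto simp: holomorphic_on_open)
    then have "((\<lambda>p. \<kappa> (fst p $ i)) has_derivative (\<lambda>h. k * (fst h $ i))) (at p)"
      unfolding has_field_derivative_def
      by (rule has_derivative_compose[OF bounded_linear_imp_has_derivative[OF bl]])
    then show "\<exists>D. ((\<lambda>p. \<kappa> (fst p $ i)) has_derivative D) (at p) \<and> (\<forall>c v. D (cscale c v) = c * D v)"
      by (intro exI[of _ "\<lambda>h. k * (fst h $ i)"]) (simp add: cscale_def mult_ac)
  qed
qed

section \<open>Binomial expansion of the kernel\<close>

text \<open>The generalized binomial coefficient of -\<gamma> times (-1)^j is the rising factorial
  of \<gamma> over j!, so the binomial series at -z has the stated coefficients in powers of
  z.\<close>

lemma binomial_kernel_sums:
  fixes z :: complex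
  assumes "norm z < 1"
  shows "(\<lambda>j. of_real (pochhammer \<gamma> j / fact j) * z ^ j) sums (1 - z) powr (- of_real \<gamma>)"
proof -
  have "((- of_real \<gamma>) gchoose j) * (- z) ^ j = of_real (pochhammer \<gamma> j / fact j) * z ^ j" for j
  proof -
    have g: "((- complex_of_real \<gamma>) gchoose j) = (- 1) ^ j * of_real (pochhammer \<gamma> j) / fact j"
      by (simp only: gbinomial_pochhammer minus_minus pochhammer_of_real)
    have "((- complex_of_real \<gamma>) gchoose j) * (- z) ^ j = ((- 1) ^ j * (- 1) ^ j) * (of_real (pochhammer \<gamma> j) / fact j * z ^ j)"
      unfolding g power_minus[of z] by (simp only: times_divide_eq_left times_divide_eq_right mult_ac)
    also have "(- 1) ^ j * (- 1) ^ j = (1 :: complex)" by (simp flip: power_mult_distrib)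
    finally show ?thesis by simp
  qed
  then show ?thesis
    using gen_binomial_complex[of "- z" "- of_real \<gamma>"] assms by simp
qed

lemma summable_binomial_kernel:
  fixes s \<gamma> :: real
  assumes "\<gamma> > 0" "0 \<le> s" "s < 1"
  shows "summable (\<lambda>j. pochhammer \<gamma> j / fact j * s ^ j)"
proof -
  have "summable (\<lambda>j. complex_of_real (pochhammer \<gamma> j / fact j) * of_real s ^ j)"
    using binomial_kernel_sums[of "of_real s" \<gamma>] assms by (simp add: sums_summable)
  then have "summable (\<lambda>j. complex_of_real (pochhammer \<gamma> j / fact j * s ^ j))" by simp
  then show ?thesis by (simp only: summable_of_real_iff)
qed

text \<open>Expanding the kernel in powers of \<open>z\<^sub>i\<close> reduces the reproducing property to the moments:
  the Gamma factors cancel against the binomial coefficients.\<close>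

lemma egg_kernel_reproduces:
  fixes g :: "'k::finite cspace \<Rightarrow> complex" and i :: 'k
  assumes m: "m \<ge> 1" and g: "g \<in> holo_closure (egg m)" and \<gamma>: "\<gamma> > 0" and C: "C > 0" and s: "0 < s" "s < 1"
    and mom: "\<And>j. (\<integral>\<^sup>+p. ennreal (cmod (fst p $ i) ^ (2 * j)) \<partial>(egg_measure m :: 'k cspace measure)) = ennreal (C * fact j / Gamma (\<gamma> + j))"
  shows "g (axis i (of_real s), 0) =
    L2_inner (egg_measure m) g (\<lambda>p. of_real (Gamma \<gamma> / C) * (1 - of_real s * fst p $ i) powr (- of_real \<gamma>))"
    and "finite_measure (egg_measure m :: 'k cspace measure)"
proof -
  let ?E = "egg_measure m :: 'k cspace measure"
  \<comment> \<open>The moment of index 0 is the total mass.\<close>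
  have "emeasure ?E (space ?E) = (\<integral>\<^sup>+p. ennreal (cmod (fst p $ i) ^ (2 * 0)) \<partial>?E)" by simp
  also have "\<dots> < top" unfolding mom by simp
  finally show fin: "finite_measure ?E" by (intro finite_measureI) simp
  interpret finite_measure ?E by (rule fin)
  have G: "Gamma (\<gamma> + real j) > 0" for j using \<gamma> by (intro Gamma_real_pos) simp
  have i1: "norm (fst p $ i) \<le> 1" if "p \<in> egg_boundary m" for p
    using norm_component_le_1[OF m] egg_boundary_subset[OF m] that by blast
  have gc: "continuous_on (egg_boundary m) g"
    using holo_closure_continuous[OF g] egg_boundary_subset[OF m] continuous_on_subset by blast
  have ic: "continuous_on A (\<lambda>p :: 'k cspace. fst p $ i)" for A by (intro continuous_intros)
  have "bounded (g ` egg_boundary m)"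
    using compact_continuous_image[OF gc compact_egg_boundary[OF m]] by (rule compact_imp_bounded)
  then obtain B where B: "\<And>p. p \<in> egg_boundary m \<Longrightarrow> norm (g p) \<le> B" "B > 0"
    unfolding bounded_pos by auto
  \<comment> \<open>Since |z_i| \<le> 1 on the boundary, \<open>c j * B\<close> dominates the j-th
    term. As s < 1 these bounds are summable, which justifies exchanging sum and integral.\<close>
  define c where "c j = pochhammer \<gamma> j / fact j * s ^ j" for j
  have c0: "c j \<ge> 0" for j using \<gamma> s by (auto simp: c_def intro!: mult_nonneg_nonneg divide_nonneg_nonneg pochhammer_nonneg)
  have csum: "summable c" unfolding c_def using summable_binomial_kernel[OF \<gamma>, of s] s by simp
  define F where "F j p = of_real (c j) * (g p * cnj (fst p $ i) ^ j)" for j p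
  have mon_bound: "norm (g p * cnj (fst p $ i) ^ j) \<le> B" if "p \<in> egg_boundary m" for p j
  proof -
    have "norm (g p) * norm (fst p $ i) ^ j \<le> B * 1"
      using B that i1[OF that] by (intro mult_mono power_le_one) auto
    then show ?thesis by (simp add: norm_mult norm_power)
  qed
  have F_bound: "norm (F j p) \<le> c j * B" if "p \<in> egg_boundary m" for j p
    using mult_left_mono[OF mon_bound[OF that] c0[of j], of j] c0[of j] unfolding F_def norm_mult norm_of_real by simp
  have F_int: "integrable ?E (F j)" for j
  proof (rule integrable_const_bound[of _ "c j * B"])
    show "AE p in ?E. norm (F j p) \<le> c j * B" using F_bound by (intro AE_I2) simp
    show "F j \<in> borel_measurable ?E"
      unfolding F_def by (intro continuous_borel_measurable_egg_measure continuous_intros gc ic)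
  qed
  have F_norm: "(\<integral>p. norm (F j p) \<partial>?E) \<le> c j * B * measure ?E (space ?E)" for j
  proof -
    have "(\<integral>p. norm (F j p) \<partial>?E) \<le> (\<integral>p. c j * B \<partial>?E)"
      using F_bound by (intro integral_mono integrable_norm F_int) auto
    also have "\<dots> = measure ?E (space ?E) * (c j * B)" by (simp only: lebesgue_integral_const real_scaleR_def)
    finally show ?thesis by (simp only: mult.commute[of "c j * B"])
  qed
  have "(\<lambda>j. integral\<^sup>L ?E (F j)) sums (\<integral>p. (\<Sum>j. F j p) \<partial>?E)"
  proof (rule sums_integral)
    show "AE p in ?E. summable (\<lambda>j. norm (F j p))"
    proof (intro AE_I2)
      fix p assume "p \<in> space ?E"
      then show "summable (\<lambda>j. norm (F j p))"
        using F_bound by (intro summable_comparison_test'[OF summable_mult2[OF csum, of B], of 0]) auto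
    qed
    show "summable (\<lambda>j. \<integral>p. norm (F j p) \<partial>?E)"
      using F_norm by (intro summable_comparison_test'[OF summable_mult2[OF summable_mult2[OF csum, of B], of "measure ?E (space ?E)"], of 0]) auto
  qed (rule F_int)
  moreover have "(\<integral>p. (\<Sum>j. F j p) \<partial>?E) = (\<integral>p. g p * cnj ((1 - of_real s * fst p $ i) powr (- of_real \<gamma>)) \<partial>?E)"
  proof (rule Bochner_Integration.integral_cong)
    fix p assume "p \<in> space ?E"
    then have "s * norm (fst p $ i) \<le> s"
      using i1[of p] s by (intro mult_left_le) auto
    moreover have "norm (of_real s * fst p $ i) = s * norm (fst p $ i)" using s by (simp add: norm_mult)
    ultimately have "norm (of_real s * fst p $ i) < 1" using s by linarith
    from binomial_kernel_sums[OF this, of \<gamma>]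
    have "(\<lambda>j. cnj (of_real (pochhammer \<gamma> j / fact j) * (of_real s * fst p $ i) ^ j)) sums cnj ((1 - of_real s * fst p $ i) powr (- of_real \<gamma>))"
      by (simp only: sums_cnj)
    from sums_mult[OF this, of "g p"] show "(\<Sum>j. F j p) = g p * cnj ((1 - of_real s * fst p $ i) powr (- of_real \<gamma>))"
      by (intro sums_unique[symmetric]) (simp add: F_def c_def power_mult_distrib mult_ac)
  qed simp
  ultimately have S1: "(\<lambda>j. integral\<^sup>L ?E (F j)) sums (\<integral>p. g p * cnj ((1 - of_real s * fst p $ i) powr (- of_real \<gamma>)) \<partial>?E)"
    by simp
  define \<phi> where "\<phi> z = g (axis i z, 0)" for z
  note H = integral_holo_monomial[OF m fin g, of i, folded \<phi>_def[abs_def]]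
  obtain T where T: "open T" "cball 0 1 \<subseteq> T" "\<phi> holomorphic_on T" using H(1) by blast
  have FI: "integral\<^sup>L ?E (F j) = of_real (C / Gamma \<gamma>) * ((deriv ^^ j) \<phi> 0 / fact j * (of_real s - 0) ^ j)" for j
  proof -
    have "(\<integral>p. cmod (fst p $ i) ^ (2 * j) \<partial>?E) = C * fact j / Gamma (\<gamma> + j)"
    proof (rule integral_eq_nn_integral[THEN trans])
      show "(\<lambda>p. cmod (fst p $ i) ^ (2 * j)) \<in> borel_measurable ?E"
        by (intro continuous_borel_measurable_egg_measure continuous_intros ic)
      show "enn2real (\<integral>\<^sup>+p. ennreal (cmod (fst p $ i) ^ (2 * j)) \<partial>?E) = C * fact j / Gamma (\<gamma> + j)"
        unfolding mom using C G[of j] by (simp add: less_imp_le)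
    qed simp
    \<comment> \<open>The rising factorial is a quotient of Gamma values, so it cancels j! / Gamma
      (\<gamma> + j) in the moment. What is left of the coefficient is s^j up to a constant, and the
      series becomes the Taylor series of \<phi> at s.\<close>
    moreover have "pochhammer \<gamma> j = Gamma (\<gamma> + j) / Gamma \<gamma>"
      using \<gamma> by (intro pochhammer_Gamma) (auto dest: nonpos_Ints_nonpos)
    ultimately have cM: "c j * (\<integral>p. cmod (fst p $ i) ^ (2 * j) \<partial>?E) = C / Gamma \<gamma> * s ^ j"
      using G[of j] by (simp add: c_def)
    have "integral\<^sup>L ?E (F j) = of_real (c j) * ((deriv ^^ j) \<phi> 0 / fact j * of_real (\<integral>p. cmod (fst p $ i) ^ (2 * j) \<partial>?E))"
      unfolding F_def integral_mult_right_zero H(2) ..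
    also have "\<dots> = (deriv ^^ j) \<phi> 0 / fact j * of_real (c j * (\<integral>p. cmod (fst p $ i) ^ (2 * j) \<partial>?E))"
      unfolding of_real_mult by (rule mult.left_commute)
    finally show ?thesis unfolding cM by (simp add: mult_ac)
  qed
  have "(\<lambda>j. (deriv ^^ j) \<phi> 0 / fact j * (of_real s - 0) ^ j) sums \<phi> (of_real s)"
    using T s by (intro holomorphic_power_series[of _ _ 1] holomorphic_on_subset[OF T(3)]) auto
  then have S2: "(\<lambda>j. integral\<^sup>L ?E (F j)) sums (of_real (C / Gamma \<gamma>) * \<phi> (of_real s))"
    unfolding FI by (rule sums_mult)
  have I: "(\<integral>p. g p * cnj ((1 - of_real s * fst p $ i) powr (- of_real \<gamma>)) \<partial>?E) = of_real (C / Gamma \<gamma>) * \<phi> (of_real s)"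
    by (rule sums_unique2[OF S1 S2])
  have G0: "Gamma \<gamma> > 0" using G[of 0] by simp
  have "L2_inner ?E g (\<lambda>p. of_real (Gamma \<gamma> / C) * (1 - of_real s * fst p $ i) powr (- of_real \<gamma>)) =
      (\<integral>p. of_real (Gamma \<gamma> / C) * (g p * cnj ((1 - of_real s * fst p $ i) powr (- of_real \<gamma>))) \<partial>?E)"
    unfolding L2_inner_def by (intro Bochner_Integration.integral_cong) (auto simp: mult_ac)
  also have "\<dots> = of_real (Gamma \<gamma> / C) * (of_real (C / Gamma \<gamma>) * \<phi> (of_real s))"
    unfolding integral_mult_right_zero I ..
  also have "\<dots> = \<phi> (of_real s)" using G0 C by simp
  finally show "g (axis i (of_real s), 0) =
    L2_inner ?E g (\<lambda>p. of_real (Gamma \<gamma> / C) * (1 - of_real s * fst p $ i) powr (- of_real \<gamma>))"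
    by (simp add: \<phi>_def)
qed

text \<open>For |z_i| < 1/s the number 1 - s z_i has positive real part and avoids the branch cut of
  the power. As |z_i| \<le> 1 < 1/s on the closure, the candidate kernel is holomorphic in a
  neighbourhood of it.\<close>

lemma fefferman_szego_eq:
  fixes i :: "'k::finite"
  assumes m: "m \<ge> 1" and \<gamma>: "\<gamma> > 0" and C: "C > 0" and s: "0 < s" "s < 1"
    and mom: "\<And>j. (\<integral>\<^sup>+p. ennreal (cmod (fst p $ i) ^ (2 * j)) \<partial>(egg_measure m :: 'k cspace measure)) = ennreal (C * fact j / Gamma (\<gamma> + j))"
  shows "fefferman_szego m (axis i (of_real s), 0) (axis i (of_real s), 0 :: complex) =
    complex_of_real (Gamma \<gamma> / C * (1 - s\<^sup>2) powr (- \<gamma>))"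
proof -
  let ?E = "egg_measure m :: 'k cspace measure" and ?q = "(axis i (of_real s), 0) :: 'k cspace"
  define \<kappa> where "\<kappa> z = complex_of_real (Gamma \<gamma> / C) * (1 - of_real s * z) powr (- of_real \<gamma>)" for z
  let ?K = "\<lambda>p :: 'k cspace. \<kappa> (fst p $ i)"
  have K: "?K \<in> holo_closure (egg m)"
  proof -
    have "1 - of_real s * z \<notin> \<real>\<^sub>\<le>\<^sub>0" if "z \<in> ball 0 (1 / s)" for z :: complex
    proof -
      have "norm (of_real s * z) < 1" using that s by (simp add: norm_mult field_simps)
      then have "Re (1 - of_real s * z) > 0" using complex_Re_le_cmod[of "of_real s * z"] by simp
      then show ?thesis by (metis complex_nonpos_Reals_iff not_le)
    qed
    then have "\<kappa> holomorphic_on ball 0 (1 / s)"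
      unfolding \<kappa>_def by (intro holomorphic_intros) auto
    note U = holo_on_coordinate[OF this open_ball, of i]
    have "closure (egg m) \<subseteq> {p :: 'k cspace. fst p $ i \<in> ball 0 (1 / s)}"
    proof
      fix p :: "'k cspace" assume "p \<in> closure (egg m)"
      then have "norm (fst p $ i) \<le> 1" by (rule norm_component_le_1[OF m])
      moreover have "1 < 1 / s" using s by simp
      ultimately show "p \<in> {p. fst p $ i \<in> ball 0 (1 / s)}" by simp
    qed
    then show ?thesis using U unfolding holo_closure_def by blast
  qed
  have fin: "finite_measure ?E"
    by (rule egg_kernel_reproduces(2)[OF m K \<gamma> C s mom])
  have "reproducing_kernel (egg m) ?E ?q ?q = ?K ?q"
  proof (rule reproducing_kernel_eqI[OF fin _ _ K])
    fix g :: "'k cspace \<Rightarrow> complex" assume g: "g \<in> holo_closure (egg m)"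
    have gc: "continuous_on (egg_boundary m) g"
      using holo_closure_continuous[OF g] egg_boundary_subset[OF m] continuous_on_subset by blast
    then show "g \<in> borel_measurable ?E" by (rule continuous_borel_measurable_egg_measure)
    show "\<exists>B. \<forall>p\<in>space ?E. norm (g p) \<le> B"
      using compact_imp_bounded[OF compact_continuous_image[OF gc compact_egg_boundary[OF m]]] by (auto simp: bounded_iff)
    show "g ?q = L2_inner ?E g ?K"
      unfolding \<kappa>_def by (rule egg_kernel_reproduces(1)[OF m g \<gamma> C s mom])
  qed
  also have "?K ?q = complex_of_real (Gamma \<gamma> / C * (1 - s\<^sup>2) powr (- \<gamma>))"
  proof -
    have "s\<^sup>2 < 1" using s by (simp add: abs_square_less_1)
    then have "complex_of_real (1 - s\<^sup>2) powr of_real (- \<gamma>) = of_real ((1 - s\<^sup>2) powr (- \<gamma>))"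
      by (intro powr_of_real) simp
    moreover have "1 - complex_of_real s * of_real s = of_real (1 - s\<^sup>2)" by (simp add: power2_eq_square)
    ultimately show ?thesis by (simp add: \<kappa>_def axis_def)
  qed
  finally show ?thesis
    by (simp add: fefferman_szego_def fefferman_measure_egg[OF m])
qed

section \<open>The exponent and the final assembly\<close>

text \<open>Rewritten as (n/m + 1) / (n + 1), \<open>mu_exp\<close> depends on m only through
  n/m.\<close>

lemma gamma_exp_strict_antimono:
  assumes "n \<ge> 1"
  shows "strict_antimono_on {1..} (gamma_exp n)"
  unfolding monotone_on_def
proof (intro ballI impI)
  fix x y :: nat assume xy: "x \<in> {1..}" "y \<in> {1..}" "x < y"
  have mu: "mu_exp n m = (real n / real m + 1) / (real n + 1)" if "m \<in> {1..}" for m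
    using that unfolding mu_exp_def by (simp add: field_simps)
  have "real n / real y < real n / real x"
    using xy assms by (intro divide_strict_left_mono) auto
  then show "gamma_exp n y < gamma_exp n x"
    unfolding gamma_exp_def mu[OF xy(1)] mu[OF xy(2)] by (simp add: divide_strict_right_mono)
qed

theorem theorem5p1:
  fixes n m :: nat
  assumes "n \<ge> 2" and "m \<ge> 1" and "CARD('k::finite) = n - 1"
  shows "(\<exists>D>0. \<forall>i::'k. \<forall>s::real. 0 < s \<and> s < 1 \<longrightarrow>
            fefferman_szego m (axis i (of_real s), 0) (axis i (of_real s), 0)
              = complex_of_real (D * (1 - s\<^sup>2) powr (- gamma_exp n m)))
       \<and> strict_antimono_on {1..} (gamma_exp n)
       \<and> inj_on (gamma_exp n) {1..}"
proof (intro conjI)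
  have k: "real CARD('k) = real n - 1" using assms by (simp add: of_nat_diff)
  have n: "real n \<ge> 2" and m: "real m \<ge> 1" using assms by simp_all
  define \<alpha> where "\<alpha> = (real m - 1) / real m * (1 / (real CARD('k) + 2) - 1)"
  \<comment> \<open>As k + 2 = n + 1, \<alpha> equals -(m - 1) n / (m (n + 1)); adding 1 gives (n +
    m) / (m (n + 1)).\<close>
  have \<alpha>_eq: "\<alpha> + 1 = mu_exp n m"
  proof -
    have "(M - 1) / M * (1 / (N - 1 + 2) - 1) + 1 = (N + M) / (M * (N + 1))" if "M > 0" "N > 0" for M N :: real
      using that by (simp add: divide_simps) (simp add: algebra_simps)
    from this[of "real m" "real n"] show ?thesis unfolding \<alpha>_def mu_exp_def k using n m by simp
  qed
  have "mu_exp n m > 0" using n m by (simp add: mu_exp_def)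
  then have \<alpha>: "\<alpha> > -1" using \<alpha>_eq by linarith
  have \<gamma>_eq: "real CARD('k) + \<alpha> + 1 = gamma_exp n m"
    using \<alpha>_eq by (simp add: gamma_exp_def k)
  have \<gamma>: "gamma_exp n m > 0" using \<open>mu_exp n m > 0\<close> n by (simp add: gamma_exp_def)
  obtain C1 where C1: "C1 > 0" "\<And>(i::'k) j. (\<integral>\<^sup>+p. ennreal (cmod (fst p $ i) ^ (2 * j)) \<partial>egg_measure m) = ennreal C1 * ball_moment \<alpha> i j"
    using egg_measure_moments[OF assms(2), where 'k='k] unfolding \<alpha>_def by blast
  obtain C2 where C2: "C2 > 0" "\<And>(i::'k) j. ball_moment \<alpha> i j = ennreal (C2 * fact j / Gamma (gamma_exp n m + j))"
    using ball_moment_formula[OF \<alpha>, where 'k='k] unfolding \<gamma>_eq by blast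
  have mom: "(\<integral>\<^sup>+p. ennreal (cmod (fst p $ i) ^ (2 * j)) \<partial>egg_measure m) = ennreal (C1 * C2 * fact j / Gamma (gamma_exp n m + j))"
    for i :: 'k and j
  proof -
    have "Gamma (gamma_exp n m + real j) > 0" using \<gamma> by (intro Gamma_real_pos) simp
    then show ?thesis unfolding C1(2) C2(2) using C1(1) C2(1) by (simp add: mult.assoc flip: ennreal_mult)
  qed
  have C: "C1 * C2 > 0" using C1(1) C2(1) by simp
  show "\<exists>D>0. \<forall>i::'k. \<forall>s::real. 0 < s \<and> s < 1 \<longrightarrow>
      fefferman_szego m (axis i (of_real s), 0) (axis i (of_real s), 0) = complex_of_real (D * (1 - s\<^sup>2) powr (- gamma_exp n m))"
  \<comment> \<open>\<open>Gamma (gamma_exp n m)\<close> comes from the binomial coefficients,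
    \<open>C1\<close> from the passage to the unit ball and \<open>C2\<close> from the ball moments;
    none of them depends on \<open>i\<close> or \<open>s\<close>.\<close>
  proof (intro exI[of _ "Gamma (gamma_exp n m) / (C1 * C2)"] conjI allI impI)
    show "0 < Gamma (gamma_exp n m) / (C1 * C2)" using C \<gamma> by (intro divide_pos_pos Gamma_real_pos)
    fix i :: 'k and s :: real assume "0 < s \<and> s < 1"
    then show "fefferman_szego m (axis i (of_real s), 0) (axis i (of_real s), 0) =
        complex_of_real (Gamma (gamma_exp n m) / (C1 * C2) * (1 - s\<^sup>2) powr (- gamma_exp n m))"
      using fefferman_szego_eq[OF assms(2) \<gamma> C _ _ mom] by blast
  qed
  show anti: "strict_antimono_on {1..} (gamma_exp n)"
    using assms(1) by (intro gamma_exp_strict_antimono) simp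
  show "inj_on (gamma_exp n) {1..}"
    using anti unfolding monotone_on_def inj_on_def by (metis less_irrefl linorder_neqE_nat)
qed

end
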